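(* Let $\mu$ be a locally finite signed Borel measure on $\mathbb{R}$, with distribution function $\mu(x):=\mu((-\infty,x])$, such that: $\operatorname{supp}(\mu)\subset[0,\infty)$; $0\le\mu(x)\le1$ for all $x\in\mathbb{R}$; and $\lim_{y\to\infty}\frac1y\int_{-\infty}^y\mu(x)\,dx=1$. Let $\widetilde{\mathscr{F}}_\mu$ be the odd $1$-periodic function defined in the context. Let $\vartheta$ be a nontrivial probability measure on $\mathbb{R}/\mathbb{Z}$ and let $N\in\mathbb{Z}^+$. Let $\mathscr{K}_N$ and $\mathscr{B}_{N+1}$ be as defined in the context (they depend on $\vartheta$). (i) If $\mathscr{L}:\mathbb{C}\to\mathbb{C}$ is a real trigonometric polynomial of degree at most $N$ such that $$\mathscr{L}(x)\le\widetilde{\mathscr{F}}_\mu(x)\quad\text{for all }x\in\mathbb{R}/\mathbb{Z},\qquad(\ast)$$ then $$\int_{\mathbb{R}/\mathbb{Z}}\mathscr{L}(x)\,d\vartheta(x)\le-\frac{1}{\mathscr{K}_N(1,1)}+\sum_{\substack{\xi\in\mathbb{R}/\mathbb{Z},\ \xi\neq0\\ \mathscr{B}_{N+1}(e(\xi))=0}}\frac{\widetilde{\mathscr{F}}_\mu(\xi)}{\mathscr{K}_N(e(\xi),e(\xi))}.\qquad(\ast\ast)$$ Moreover, there is a unique real trigonometric polynomial $\widetilde{\mathscr{L}}_\mu:\mathbb{C}\to\mathbb{C}$ of degree at most $N$ satisfying $(\ast)$ for which equality in $(\ast\ast)$ holds. (ii) If $\mathscr{M}:\mathbb{C}\to\mathbb{C}$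 is a real trigonometric polynomial of degree at most $N$ such that $$\widetilde{\mathscr{F}}_\mu(x)\le\mathscr{M}(x)\quad\text{for all }x\in\mathbb{R}/\mathbb{Z},\qquad(\dagger)$$ then $$\int_{\mathbb{R}/\mathbb{Z}}\mathscr{M}(x)\,d\vartheta(x)\ge\frac{1}{\mathscr{K}_N(1,1)}+\sum_{\substack{\xi\in\mathbb{R}/\mathbb{Z},\ \xi\neq0\\ \mathscr{B}_{N+1}(e(\xi))=0}}\frac{\widetilde{\mathscr{F}}_\mu(\xi)}{\mathscr{K}_N(e(\xi),e(\xi))}.\qquad(\dagger\dagger)$$ Moreover, there is a unique real trigonometric polynomial $\widetilde{\mathscr{M}}_\mu:\mathbb{C}\to\mathbb{C}$ of degree at most $N$ satisfying $(\dagger)$ for which equality in $(\dagger\dagger)$ holds.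
   Context: $e(z)=e^{2\pi i z}$. $\mathbb{Z}^+$ denotes the nonnegative integers. A trigonometric polynomial of degree at most $N$ is an entire function $\mathscr{W}(z)=\sum_{k=-N}^N a_k e(kz)$ with $a_k\in\mathbb{C}$; it is real if it is real valued on $\mathbb{R}$. A probability measure on $\mathbb{R}/\mathbb{Z}$ is trivial if it is supported on finitely many points, nontrivial otherwise. Definition of $\widetilde{\mathscr{F}}_\mu$. For $\lambda>0$ let $v(\lambda,x)=xe^{-\lambda x}$ if $x>0$ and $v(\lambda,x)=0$ if $x\le0$; let $\widetilde v(\lambda,x)=v(\lambda,x)-v(\lambda,-x)$ and $\widetilde h(\lambda,x)=\sum_{n\in\mathbb{Z}}\widetilde v(\lambda,x+n)$. Then $$\widetilde{\mathscr{F}}_\mu(x)=\int_0^\infty\widetilde h(\lambda,x)\,\mu(\lambda)\,d\lambda$$ (the integral converges since $\widetilde h(\lambda,x)=O(\lambda)$ as $\lambda\to0$ for each $x$). Orthogonal polynomials. Identify $\mathbb{R}/\mathbb{Z}$ with the unit circle $\partial\mathbb{D}$ via $x\mapsto e(x)$, and let $\langle f,g\rangle=\int_{\mathbb{R}/\mathbb{Z}}f(e(x))\overline{g(e(x))}\,d\vartheta(x)$. $\Phi_n$ is the monic polynomial of degree $n$ with $\langle\Phi_n,z^j\rangle=0$ for $0\le j<n$, and $\varphi_n=c_n\Phi_n/\|\Phi_n\|$ with $|c_n|=1$ chosen so that $\varphi_n(1)\in\mathbb{R}$ (norm in $L^2(\vartheta)$). For $Q$ of exact degree $n$, $Q^*(z)=z^n\,\overline{Q(\overline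 z^{\,-1})}$. Define $$\mathscr{K}_N(w,z)=\frac{\varphi_{N+1}^*(z)\overline{\varphi_{N+1}^*(w)}-\varphi_{N+1}(z)\overline{\varphi_{N+1}(w)}}{1-\overline w z},\qquad \mathscr{B}_{N+1}(z)=\frac i2\{\varphi_{N+1}^*(z)-\varphi_{N+1}(z)\}.$$ $\mathscr{K}_N$ is a polynomial in $\overline w,z$ (the quotient being extended by continuity when $\overline wz=1$); it is the reproducing kernel of the space of polynomials of degree at most $N$ with the inner product $\langle\cdot,\cdot\rangle$, and $\mathscr{K}_N(w,w)>0$ for all $w\in\mathbb{C}$. *)

theory Defs
  imports "HOL-Probability.Probability" "HOL-Computational_Algebra.Polynomial"
begin

text \<open>
  A locally finite signed Borel measure on the line (whose positive and negative parts may both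
  have infinite total mass) is given by its values on bounded Borel sets; the values of \<open>m\<close> on all
  other sets are irrelevant.  The condition \<open>m {} = 0\<close> follows by taking all \<open>A i\<close> empty.
\<close>
definition locally_finite_signed_measure :: "(real set \<Rightarrow> real) \<Rightarrow> bool" where
  "locally_finite_signed_measure m \<longleftrightarrow>
     (\<forall>A :: nat \<Rightarrow> real set.
        range A \<subseteq> sets borel \<longrightarrow> disjoint_family A \<longrightarrow> bounded (\<Union>i. A i) \<longrightarrow>
        (\<lambda>i. m (A i)) sums m (\<Union>i. A i))"

definition signed_support :: "(real set \<Rightarrow> real) \<Rightarrow> real set" where
  "signed_support m =
     {x. \<forall>U. open U \<and> x \<in> U \<longrightarrow> (\<exists>A\<in>sets borel. bounded A \<and> A \<subseteq> U \<and> m A \<noteq> 0)}"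

text \<open>
  The mass of the unbounded set \<open>{..x}\<close> is the limit of the masses of \<open>{a<..x}\<close> as \<open>a\<close> tends to
  minus infinity.  If the support lies in \<open>{0..}\<close>, these are constant for \<open>a < 0\<close>.
\<close>
definition signed_cdf :: "(real set \<Rightarrow> real) \<Rightarrow> real \<Rightarrow> real" where
  "signed_cdf m x = Lim at_bot (\<lambda>a. m {a<..x})"

definition trunc_v :: "real \<Rightarrow> real \<Rightarrow> real" where
  "trunc_v l x = (if x > 0 then x * exp (- l * x) else 0)"

definition odd_v :: "real \<Rightarrow> real \<Rightarrow> real" where
  "odd_v l x = trunc_v l x - trunc_v l (- x)"

definition odd_h :: "real \<Rightarrow> real \<Rightarrow> real" where
  "odd_h l x = (\<Sum>\<^sub>\<infinity>n\<in>(UNIV :: int set). odd_v l (x + of_int n))"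

definition odd_F :: "(real set \<Rightarrow> real) \<Rightarrow> real \<Rightarrow> real" where
  "odd_F m x = (LINT l:{0<..}|lborel. odd_h l x * signed_cdf m l)"

definition circle_e :: "complex \<Rightarrow> complex" where
  "circle_e z = exp (2 * complex_of_real pi * \<i> * z)"

definition trig_poly :: "nat \<Rightarrow> (complex \<Rightarrow> complex) \<Rightarrow> bool" where
  "trig_poly N W \<longleftrightarrow>
     (\<exists>a :: int \<Rightarrow> complex. \<forall>z. W z = (\<Sum>k = - int N..int N. a k * circle_e (of_int k * z)))"

definition real_trig_poly :: "nat \<Rightarrow> (complex \<Rightarrow> complex) \<Rightarrow> bool" where
  "real_trig_poly N W \<longleftrightarrow> trig_poly N W \<and> (\<forall>x :: real. W (of_real x) \<in> \<real>)"

text \<open>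
  Functions on R/Z are 1-periodic functions on R, and R/Z as a measurable space is represented by
  the fundamental domain \<open>{0..<1}\<close> with its Borel sets.
\<close>
definition prob_measure_on_circle :: "real measure \<Rightarrow> bool" where
  "prob_measure_on_circle \<theta> \<longleftrightarrow>
     prob_space \<theta> \<and> sets \<theta> = sets (restrict_space borel {0..<1 :: real})"

definition nontrivial_measure :: "real measure \<Rightarrow> bool" where
  "nontrivial_measure \<theta> \<longleftrightarrow> \<not> (\<exists>S. finite S \<and> (AE x in \<theta>. x \<in> S))"

definition inner_circle :: "real measure \<Rightarrow> complex poly \<Rightarrow> complex poly \<Rightarrow> complex" where
  "inner_circle \<theta> p q =
     (LINT x|\<theta>. poly p (circle_e (of_real x)) * cnj (poly q (circle_e (of_real x))))"

definition norm_circle :: "real measure \<Rightarrow> complex poly \<Rightarrow> real" where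
  "norm_circle \<theta> p = sqrt (Re (inner_circle \<theta> p p))"

definition monic_OP :: "real measure \<Rightarrow> nat \<Rightarrow> complex poly" where
  "monic_OP \<theta> n =
     (THE p. degree p = n \<and> lead_coeff p = 1 \<and> (\<forall>j<n. inner_circle \<theta> p (monom 1 j) = 0))"

definition normalized_OP :: "real measure \<Rightarrow> (nat \<Rightarrow> complex) \<Rightarrow> nat \<Rightarrow> complex poly" where
  "normalized_OP \<theta> c n =
     smult (c n / of_real (norm_circle \<theta> (monic_OP \<theta> n))) (monic_OP \<theta> n)"

text \<open>
  The phases \<open>c n\<close> make \<open>normalized_OP \<theta> c n\<close> real at 1; they are determined up to sign, and
  no particular sign is chosen.
\<close>
definition admissible_phases :: "real measure \<Rightarrow> (nat \<Rightarrow> complex) \<Rightarrow> bool" where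
  "admissible_phases \<theta> c \<longleftrightarrow>
     (\<forall>n. cmod (c n) = 1 \<and> poly (normalized_OP \<theta> c n) 1 \<in> \<real>)"

text \<open>
  The polynomial \<open>z ^ n * cnj (poly Q (1 / cnj z))\<close>, \<open>n = degree Q\<close>; see \<open>poly_star_poly\<close>.
\<close>
definition star_poly :: "complex poly \<Rightarrow> complex poly" where
  "star_poly Q = reflect_poly (map_poly cnj Q)"

lemma poly_star_poly:
  assumes "z \<noteq> 0"
  shows "poly (star_poly Q) z = z ^ degree Q * cnj (poly Q (inverse (cnj z)))"
proof -
  have deg: "degree (map_poly cnj Q) = degree Q"
    by (rule degree_map_poly) auto
  have "poly (star_poly Q) z = z ^ degree Q * poly (map_poly cnj Q) (inverse z)"
    unfolding star_poly_def poly_reflect_poly_nz[OF assms] deg ..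
  moreover have "cnj (poly Q (inverse (cnj z))) = poly (map_poly cnj Q) (inverse z)"
    using poly_cnj[of Q "inverse (cnj z)"] unfolding complex_cnj_inverse complex_cnj_cnj .
  ultimately show ?thesis
    by (simp only:)
qed

definition kernel_quot ::
    "real measure \<Rightarrow> (nat \<Rightarrow> complex) \<Rightarrow> nat \<Rightarrow> complex \<Rightarrow> complex \<Rightarrow> complex" where
  "kernel_quot \<theta> c N w z =
     (poly (star_poly (normalized_OP \<theta> c (N + 1))) z
        * cnj (poly (star_poly (normalized_OP \<theta> c (N + 1))) w)
      - poly (normalized_OP \<theta> c (N + 1)) z * cnj (poly (normalized_OP \<theta> c (N + 1)) w))
     / (1 - cnj w * z)"

text \<open>
  If \<open>cnj w * z = 1\<close> then \<open>cnj w * u \<noteq> 1\<close> for all \<open>u \<noteq> z\<close>, so the limit below is the extension of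
  the quotient by continuity.
\<close>
definition kernel_K ::
    "real measure \<Rightarrow> (nat \<Rightarrow> complex) \<Rightarrow> nat \<Rightarrow> complex \<Rightarrow> complex \<Rightarrow> complex" where
  "kernel_K \<theta> c N w z =
     (if cnj w * z = 1 then Lim (at z) (kernel_quot \<theta> c N w) else kernel_quot \<theta> c N w z)"

text \<open>The index is that of the orthogonal polynomial, so the function below is used at \<open>N + 1\<close>.\<close>
definition companion_B :: "real measure \<Rightarrow> (nat \<Rightarrow> complex) \<Rightarrow> nat \<Rightarrow> complex \<Rightarrow> complex" where
  "companion_B \<theta> c n z =
     \<i> / 2 * (poly (star_poly (normalized_OP \<theta> c n)) z - poly (normalized_OP \<theta> c n) z)"

definition B_nodes :: "real measure \<Rightarrow> (nat \<Rightarrow> complex) \<Rightarrow> nat \<Rightarrow> real set" where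
  "B_nodes \<theta> c n = {\<xi> \<in> {0..<1}. \<xi> \<noteq> 0 \<and> companion_B \<theta> c n (circle_e (of_real \<xi>)) = 0}"

end

theory Submission
  imports Defs "HOL-Computational_Algebra.Fundamental_Theorem_Algebra" "HOL-Real_Asymp.Real_Asymp"
begin

text \<open>
  Write \<open>\<phi>\<close> for the orthonormal polynomial of degree \<open>N + 1\<close> and \<open>B = \<phi>\<^sup>* - \<phi>\<close>.  Because \<open>B\<close> is
  orthogonal to \<open>z, \<dots>, z ^ N\<close> and vanishes at 1, its \<open>N + 1\<close> zeros are simple and lie on the unit
  circle, and the kernels \<open>K(w, \<sqdot>)\<close> at these zeros are multiples of \<open>B(z) / (z - w)\<close>: up to factors, the
  reproducing kernels are also Lagrange basis polynomials.  This gives the Gauss quadrature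
  \<open>\<integral> W d\<theta> = (\<Sum>\<xi>. W(\<xi>) / K(\<xi>, \<xi>))\<close> for trigonometric polynomials of degree at most \<open>N\<close>
  (\<open>real_quadrature\<close>).  The function \<open>F\<close> jumps at 0 from -1 to 1, so a minorant is at most -1 there,
  and at most \<open>F(\<xi>)\<close> at the other nodes; inserting this into the quadrature is the inequality.
  Equality forces \<open>L(0) = - 1\<close> and \<open>L(\<xi>) = F(\<xi>)\<close> at the \<open>N\<close> other nodes, hence also
  \<open>L'(\<xi>) = F'(\<xi>)\<close>, since \<open>F - L\<close> has a minimum at \<open>\<xi>\<close>.  These are \<open>2 N + 1\<close> conditions, and they
  determine a trigonometric polynomial of degree at most \<open>N\<close> (\<open>trig_poly_eq_0\<close>).

  What remains is that the solution of this Hermite interpolation problem is a minorant of \<open>F\<close>.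
  Let \<open>u\<^sub>\<lambda>\<close> be the periodization of \<open>v(\<lambda>, \<sqdot>)\<close> minus its value at the integers (\<open>pinned_v\<close>), and
  \<open>u\<^sub>-\<^sub>\<lambda>(x) = u\<^sub>\<lambda>(1 - x)\<close>, which is the same formula at a negative parameter.  On \<open>(0, 1)\<close> one has
  \<open>h(\<lambda>, x) = u\<^sub>\<lambda>(x) - u\<^sub>-\<^sub>\<lambda>(x)\<close> and \<open>\<integral> u\<^sub>\<lambda>(x) d\<lambda> = 1 - x\<close> over \<open>\<lambda> > 0\<close>, so that
  \<open>F(x) + 1 = \<integral> (u\<^sub>\<lambda>(x) (1 + \<mu>(\<lambda>)) + u\<^sub>-\<^sub>\<lambda>(x) (1 - \<mu>(\<lambda>))) d\<lambda>\<close>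
  is a superposition of the functions \<open>u\<^sub>\<lambda>\<close> with nonnegative weights.  Hermite interpolation is linear,
  so it suffices that each \<open>u\<^sub>\<lambda>\<close>, \<open>\<lambda> \<noteq> 0\<close>, lies above the trigonometric polynomial that vanishes
  at 0 and touches it at the other nodes (\<open>hermite_interpolant_below\<close>).

  The substitution \<open>s = cot (\<pi> x)\<close>, followed by multiplication with \<open>(1 + s\<^sup>2) ^ N\<close>, turns
  trigonometric polynomials of degree at most \<open>N\<close> that vanish at 0 into polynomials in \<open>s\<close> of degree
  less than \<open>2 N\<close>.  By the error formula for Hermite interpolation at \<open>N\<close> double nodes, the interpolant
  lies below as soon as the derivative of order \<open>2 N\<close> of \<open>(1 + s\<^sup>2) ^ N u\<^sub>\<lambda>\<close> is nonnegative.  That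
  derivative is \<open>(2 N)!\<close> times \<open>\<integral> r(y) sin (\<pi> y) ^ (2 N) dy\<close> over \<open>[x, 1]\<close>, where
  \<open>r(y)\<close> is a positive multiple of \<open>exp (- \<lambda> y) (y - m)\<close> and \<open>m\<close> is the mean of the density
  proportional to \<open>exp (- \<lambda> y) sin (\<pi> y) ^ (2 N)\<close>.  The integral vanishes over all of \<open>[0, 1]\<close> and
  the integrand changes sign once, from minus to plus, so it is nonnegative for every \<open>x\<close>
  (\<open>rational_lift_derivative_nonneg\<close>).

  Majorants of \<open>F\<close> are the negatives of minorants of \<open>- F\<close>, and \<open>1 - F\<close> is the superposition in which
  the two weights are exchanged, so the same argument applies.
\<close>

section \<open>Orthogonal polynomials on the unit circle\<close>

lemma circle_e_of_real: "circle_e (of_real x) = cis (2 * pi * x)"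
  by (simp add: circle_e_def cis_conv_exp mult_ac)

lemma norm_circle_e [simp]: "cmod (circle_e (of_real x)) = 1"
  by (simp add: circle_e_of_real)

lemma continuous_on_circle_e [continuous_intros]:
  "continuous_on A f \<Longrightarrow> continuous_on A (\<lambda>x. circle_e (f x))"
  unfolding circle_e_def by (intro continuous_intros)

lemma inj_on_circle_e: "inj_on (\<lambda>x::real. circle_e (of_real x)) {0..<1}"
proof (rule inj_onI)
  fix x y :: real
  assume xy: "x \<in> {0..<1}" "y \<in> {0..<1}" and "circle_e (of_real x) = circle_e (of_real y)"
  then have "cis (2 * pi * x) = cis (2 * pi * y)"
    by (simp add: circle_e_of_real)
  then have "sin (2 * pi * x) = sin (2 * pi * y) \<and> cos (2 * pi * x) = cos (2 * pi * y)"
    by (metis cis.sel(1) cis.sel(2))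
  then obtain n :: int where "2 * pi * x = 2 * pi * y + 2 * pi * n"
    by (auto simp: sin_cos_eq_iff)
  then have "2 * pi * x = 2 * pi * (y + n)"
    by (simp add: algebra_simps)
  then have "x = y + n"
    by simp
  then have "of_int n < (1::real)" "of_int n > (-1::real)"
    using xy by auto
  then have "n = 0"
    by linarith
  with \<open>x = y + n\<close> show "x = y"
    by simp
qed

lemma circle_e_surj:
  assumes "cmod w = 1"
  obtains x where "x \<in> {0..<1}" "circle_e (of_real x) = w"
proof
  let ?x = "frac (Arg w / (2 * pi))"
  show "?x \<in> {0..<1}"
    by (simp add: frac_lt_1)
  have "2 * pi * ?x = Arg w - 2 * pi * of_int \<lfloor>Arg w / (2 * pi)\<rfloor>"
    by (simp add: frac_def algebra_simps)
  then have "cis (2 * pi * ?x) = cis (Arg w) / cis (2 * pi * of_int \<lfloor>Arg w / (2 * pi)\<rfloor>)"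
    by (simp add: cis_divide[symmetric])
  also have "\<dots> = w"
    using rcis_cmod_Arg[of w] assms by (subst cis_multiple_2pi) (auto simp: rcis_def)
  finally show "circle_e (of_real ?x) = w"
    by (simp add: circle_e_of_real)
qed

text \<open>
  The inner product is definite exactly because \<open>\<theta>\<close> is not carried by finitely many points; this is
  what makes orthogonal polynomials of every degree exist.
\<close>
locale nontrivial_circle_measure =
  fixes \<theta> :: "real measure"
  assumes circle: "prob_measure_on_circle \<theta>" and nontrivial: "nontrivial_measure \<theta>"
begin

lemma sets_measure: "sets \<theta> = sets (restrict_space borel {0..<1 :: real})"
  using circle by (simp add: prob_measure_on_circle_def)

lemma space_measure: "space \<theta> = {0..<1}"
  using sets_eq_imp_space_eq[OF sets_measure] by (simp add: space_restrict_space)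

sublocale prob_space \<theta>
  using circle by (simp add: prob_measure_on_circle_def)

lemma integrable_continuous:
  fixes g :: "real \<Rightarrow> 'a::{banach, second_countable_topology}"
  assumes "continuous_on UNIV g"
  shows "integrable \<theta> g"
proof -
  have "bounded (g ` {0..1})"
    by (intro compact_imp_bounded compact_continuous_image continuous_on_subset[OF assms]) auto
  then obtain b where b: "\<forall>y\<in>g ` {0..1}. norm y \<le> b"
    unfolding bounded_iff by blast
  have "g \<in> borel_measurable (restrict_space borel {0..<1})"
    using assms by (intro measurable_restrict_space1 borel_measurable_continuous_onI)
  then have "g \<in> borel_measurable \<theta>"
    by (simp add: measurable_cong_sets[OF sets_measure refl])
  then show ?thesis
    using b by (intro integrable_const_bound[where B = b] AE_I2) (auto simp: space_measure)
qed

lemma integrable_inner: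
  "integrable \<theta> (\<lambda>x. poly p (circle_e (of_real x)) * cnj (poly q (circle_e (of_real x))))"
  by (intro integrable_continuous continuous_intros)

abbreviation ip :: "complex poly \<Rightarrow> complex poly \<Rightarrow> complex" where
  "ip \<equiv> inner_circle \<theta>"

lemma ip_zero [simp]: "ip 0 p = 0" "ip p 0 = 0"
  by (simp_all add: inner_circle_def)

lemma ip_add_left: "ip (p + q) r = ip p r + ip q r"
  unfolding inner_circle_def by (simp add: ring_distribs integrable_inner)

lemma ip_diff_left: "ip (p - q) r = ip p r - ip q r"
  unfolding inner_circle_def by (simp add: ring_distribs integrable_inner)

lemma ip_smult_left: "ip (smult a p) r = a * ip p r"
  unfolding inner_circle_def by (simp add: mult.assoc)

lemma ip_commute: "ip p q = cnj (ip q p)"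
proof -
  have "cnj (ip q p) = (LINT x|\<theta>. cnj (poly q (circle_e (of_real x)) * cnj (poly p (circle_e (of_real x)))))"
    unfolding inner_circle_def by (rule Bochner_Integration.integral_cnj[symmetric])
  then show ?thesis
    by (simp add: inner_circle_def mult.commute)
qed

lemma ip_add_right: "ip r (p + q) = ip r p + ip r q"
  by (subst (1 2 3) ip_commute) (simp add: ip_add_left)

lemma ip_diff_right: "ip r (p - q) = ip r p - ip r q"
  by (subst (1 2 3) ip_commute) (simp add: ip_diff_left)

lemma ip_smult_right: "ip r (smult a p) = cnj a * ip r p"
  by (subst (1 2) ip_commute) (simp add: ip_smult_left)

lemma ip_sum_right: "ip r (\<Sum>i\<in>A. f i) = (\<Sum>i\<in>A. ip r (f i))"
  by (induction A rule: infinite_finite_induct) (auto simp: ip_add_right)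

lemma ip_self: "ip p p = of_real (LINT x|\<theta>. (cmod (poly p (circle_e (of_real x))))\<^sup>2)"
  unfolding inner_circle_def
  by (simp only: complex_norm_square[symmetric] integral_complex_of_real)

text \<open>
  A nonzero polynomial has finitely many zeros on the circle, and these cannot carry \<open>\<theta>\<close>.
\<close>
lemma ip_self_pos:
  assumes "p \<noteq> 0"
  shows "Re (ip p p) > 0"
proof -
  let ?g = "\<lambda>x::real. (cmod (poly p (circle_e (of_real x))))\<^sup>2"
  have int: "integrable \<theta> ?g"
    by (intro integrable_continuous continuous_intros)
  have "integral\<^sup>L \<theta> ?g \<noteq> 0"
  proof
    assume "integral\<^sup>L \<theta> ?g = 0"
    then have ae: "AE x in \<theta>. ?g x = 0"
      using integral_nonneg_eq_0_iff_AE[OF int] by simp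
    let ?S = "(\<lambda>x::real. circle_e (of_real x)) -` {z. poly p z = 0} \<inter> {0..<1}"
    have "finite ?S"
      using finite_vimage_IntI[OF poly_roots_finite[OF assms] inj_on_circle_e] .
    moreover have "AE x in \<theta>. x \<in> ?S"
      using ae AE_space by eventually_elim (auto simp: space_measure)
    ultimately show False
      using nontrivial unfolding nontrivial_measure_def by blast
  qed
  moreover have "integral\<^sup>L \<theta> ?g \<ge> 0"
    by (rule Bochner_Integration.integral_nonneg) simp
  ultimately have "integral\<^sup>L \<theta> ?g > 0"
    by linarith
  then show ?thesis
    by (simp add: ip_self)
qed

lemma ip_self_real: "ip p p = of_real (Re (ip p p))"
  by (simp add: ip_self)

lemma ip_self_nonneg: "Re (ip p p) \<ge> 0"
  by (cases "p = 0") (auto intro: less_imp_le ip_self_pos)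

lemma ip_self_eq_0_iff: "ip p p = 0 \<longleftrightarrow> p = 0"
  using ip_self_pos[of p] by (cases "p = 0") auto

text \<open>
  Multiplication by \<open>z\<close> is an isometry, since \<open>\<bar>z\<bar> = 1\<close> on the circle.
\<close>
lemma ip_shift: "ip (pCons 0 p) (pCons 0 q) = ip p q"
proof -
  have "z * a * cnj (z * b) = a * cnj b" if "cmod z = 1" for z a b
  proof -
    have "z * a * cnj (z * b) = (z * cnj z) * (a * cnj b)"
      by simp
    then show ?thesis
      using that by (simp only: complex_norm_square[symmetric]) simp
  qed
  then show ?thesis
    unfolding inner_circle_def by (intro Bochner_Integration.integral_cong) (simp_all del: complex_cnj_mult)
qed

lemma ip_orthogonal:
  assumes "\<And>j. coeff q j \<noteq> 0 \<Longrightarrow> ip p (monom 1 j) = 0"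
  shows "ip p q = 0"
proof -
  have "ip p q = ip p (\<Sum>i\<le>degree q. smult (coeff q i) (monom 1 i))"
    by (simp add: smult_monom poly_as_sum_of_monoms)
  also have "\<dots> = 0"
    unfolding ip_sum_right ip_smult_right using assms by (intro sum.neutral) auto
  finally show ?thesis .
qed

text \<open>
  Gram--Schmidt: the residual of the monomial of degree \<open>n\<close> is a monic polynomial orthogonal to all
  smaller degrees, and subtracting a multiple of it extends the projection by one dimension.
\<close>
lemma orthogonal_projection_exists:
  "\<exists>g. (\<forall>i\<ge>n. coeff g i = 0) \<and> (\<forall>j<n. ip (f - g) (monom 1 j) = 0)"
proof (induction n arbitrary: f)
  case 0
  then show ?case by (intro exI[of _ 0]) simp
next
  case (Suc n)
  obtain g where g: "\<forall>i\<ge>n. coeff g i = 0" "\<forall>j<n. ip (monom 1 n - g) (monom 1 j) = 0"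
    using Suc.IH[of "monom 1 n"] by blast
  define P where "P = monom 1 n - g"
  have cP: "coeff P n = 1"
    using g(1) by (simp add: P_def)
  have "P \<noteq> 0"
    using cP by auto
  obtain h where h: "\<forall>i\<ge>n. coeff h i = 0" "\<forall>j<n. ip (f - h) (monom 1 j) = 0"
    using Suc.IH[of f] by blast
  define c where "c = ip (f - h) P / ip P P"
  define r where "r = f - (h + smult c P)"
  have r: "r = (f - h) - smult c P"
    by (simp add: r_def)
  have low: "ip r (monom 1 j) = 0" if "j < n" for j
    using that h(2) g(2) by (simp add: r ip_diff_left ip_smult_left P_def)
  have "ip r g = 0"
    by (rule ip_orthogonal) (metis g(1) low not_le)
  moreover have "ip r P = 0"
    using \<open>P \<noteq> 0\<close> by (simp add: r ip_diff_left ip_smult_left c_def ip_self_eq_0_iff)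
  ultimately have "ip r (monom 1 n) = 0"
    by (simp add: P_def ip_diff_right)
  with low have "\<forall>j<Suc n. ip r (monom 1 j) = 0"
    by (auto simp: less_Suc_eq)
  moreover have "\<forall>i\<ge>Suc n. coeff (h + smult c P) i = 0"
    using h(1) g(1) by (simp add: P_def)
  ultimately show ?case
    unfolding r_def by blast
qed

lemma monic_OP_ex1:
  "\<exists>!p. degree p = n \<and> lead_coeff p = 1 \<and> (\<forall>j<n. ip p (monom 1 j) = 0)"
proof -
  obtain g where g: "\<forall>i\<ge>n. coeff g i = 0" "\<forall>j<n. ip (monom 1 n - g) (monom 1 j) = 0"
    using orthogonal_projection_exists by blast
  let ?P = "monom 1 n - g"
  have "degree ?P \<le> n"
    using g(1) by (intro degree_le) auto
  moreover have "coeff ?P n = 1"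
    using g(1) by simp
  ultimately have "degree ?P = n"
    by (metis le_antisym le_degree zero_neq_one)
  show ?thesis
  proof (rule ex1I[of _ ?P])
    show "degree ?P = n \<and> lead_coeff ?P = 1 \<and> (\<forall>j<n. ip ?P (monom 1 j) = 0)"
      using \<open>degree ?P = n\<close> \<open>coeff ?P n = 1\<close> g(2) by simp
  next
    fix p assume p: "degree p = n \<and> lead_coeff p = 1 \<and> (\<forall>j<n. ip p (monom 1 j) = 0)"
    have "ip (p - ?P) (p - ?P) = 0"
    proof (rule ip_orthogonal)
      fix j assume j: "coeff (p - ?P) j \<noteq> 0"
      have "j < n"
      proof (rule ccontr)
        assume "\<not> j < n"
        then consider "j = n" | "j > n" by linarith
        then show False
          using j p \<open>coeff ?P n = 1\<close> g(1) by cases (auto simp: coeff_eq_0)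
      qed
      then show "ip (p - ?P) (monom 1 j) = 0"
        using p g(2) by (simp add: ip_diff_left)
    qed
    then show "p = ?P"
      by (simp add: ip_self_eq_0_iff)
  qed
qed

lemma monic_OP:
  "degree (monic_OP \<theta> n) = n" "lead_coeff (monic_OP \<theta> n) = 1"
  "j < n \<Longrightarrow> ip (monic_OP \<theta> n) (monom 1 j) = 0"
  using theI'[OF monic_OP_ex1[of n], folded monic_OP_def] by auto

lemma norm_circle_monic_OP_pos: "norm_circle \<theta> (monic_OP \<theta> n) > 0"
  unfolding norm_circle_def real_sqrt_gt_0_iff
  by (rule ip_self_pos) (metis leading_coeff_0_iff monic_OP(2) zero_neq_one)

lemma normalized_OP:
  assumes "cmod (c n) = 1"
  shows "degree (normalized_OP \<theta> c n) = n"
    and "j < n \<Longrightarrow> ip (normalized_OP \<theta> c n) (monom 1 j) = 0"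
    and "ip (normalized_OP \<theta> c n) (normalized_OP \<theta> c n) = 1"
proof -
  let ?P = "monic_OP \<theta> n" and ?a = "norm_circle \<theta> (monic_OP \<theta> n)"
  have a: "?a > 0"
    by (rule norm_circle_monic_OP_pos)
  have c: "c n \<noteq> 0"
    using assms by auto
  show "degree (normalized_OP \<theta> c n) = n"
    unfolding normalized_OP_def using a c by (simp add: monic_OP)
  show "j < n \<Longrightarrow> ip (normalized_OP \<theta> c n) (monom 1 j) = 0"
    unfolding normalized_OP_def by (simp add: ip_smult_left monic_OP)
  have "ip ?P ?P = of_real (?a\<^sup>2)"
    unfolding norm_circle_def using ip_self_real[of ?P] ip_self_nonneg[of ?P] by simp
  moreover have "c n * cnj (c n) = 1"
    using assms by (simp add: complex_norm_square[symmetric])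
  ultimately show "ip (normalized_OP \<theta> c n) (normalized_OP \<theta> c n) = 1"
    unfolding normalized_OP_def using a
    by (simp add: ip_smult_left ip_smult_right power2_eq_square field_simps)
qed

end

section \<open>Zeros of the companion polynomial and reproducing kernels\<close>

lemma poly_star_circle:
  assumes "cmod z = 1"
  shows "poly (star_poly Q) z = z ^ degree Q * cnj (poly Q z)"
proof -
  have "z \<noteq> 0" using assms by auto
  moreover have "z * cnj z = 1" using assms by (simp add: complex_norm_square[symmetric])
  then have "inverse (cnj z) = z"
    by (metis inverse_unique mult.commute)
  ultimately show ?thesis
    by (simp add: poly_star_poly)
qed

lemma coeff_star_poly:
  "coeff (star_poly Q) i = (if i \<le> degree Q then cnj (coeff Q (degree Q - i)) else 0)"
proof -
  have "degree (map_poly cnj Q) = degree Q"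
    by (rule degree_map_poly) auto
  then show ?thesis
    by (auto simp: star_poly_def coeff_reflect_poly coeff_map_poly)
qed

lemma root_factor:
  fixes p :: "'a::idom poly"
  assumes "poly p w = 0"
  obtains r where "p = [:- w, 1:] * r"
  using assms poly_eq_0_iff_dvd by (metis dvdE)

lemma poly_linear_mult:
  fixes r :: "complex poly"
  shows "poly ([:- w, 1:] * r) z = (z - w) * poly r z"
  by (simp add: algebra_simps)

lemma coeff_linear_factor_eq_0:
  fixes r :: "complex poly"
  assumes "\<And>i. i > m \<Longrightarrow> coeff ([:- w, 1:] * r) i = 0" and "i \<ge> m"
  shows "coeff r i = 0"
proof (cases "r = 0")
  case False
  then have "degree ([:- w, 1:] * r) = Suc (degree r)"
    by (subst degree_mult_eq) auto
  moreover have "degree ([:- w, 1:] * r) \<le> m"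
    using assms(1) by (intro degree_le) auto
  ultimately show ?thesis
    using assms(2) by (intro coeff_eq_0) simp
qed simp

context nontrivial_circle_measure
begin

lemma ip_cong_circle:
  assumes "\<And>x::real. poly p (circle_e (of_real x)) * cnj (poly q (circle_e (of_real x)))
    = poly r (circle_e (of_real x)) * cnj (poly s (circle_e (of_real x)))"
  shows "ip p q = ip r s"
  unfolding inner_circle_def using assms by simp

text \<open>
  Polynomials of this kind are multiples of \<open>\<Phi>\<^sub>m\<^sup>*\<close>, and this is the classical fact that the zeros of
  \<open>\<Phi>\<^sub>m\<close> lie in the open disc.  If \<open>P = (z - w) R\<close>, then \<open>w R\<close> is \<open>z R\<close> minus \<open>P\<close>, which are
  orthogonal, so Pythagoras and the isometry give \<open>\<bar>w\<bar>\<^sup>2 \<parallel>R\<parallel>\<^sup>2 = \<parallel>R\<parallel>\<^sup>2 + \<parallel>P\<parallel>\<^sup>2\<close>.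
\<close>
lemma root_outside_disc:
  assumes P: "\<And>i. i > m \<Longrightarrow> coeff P i = 0" "\<And>j. 1 \<le> j \<Longrightarrow> j \<le> m \<Longrightarrow> ip P (monom 1 j) = 0"
    and "P \<noteq> 0" and "poly P w = 0"
  shows "cmod w > 1"
proof -
  obtain R where R: "P = [:- w, 1:] * R"
    using root_factor[OF \<open>poly P w = 0\<close>] .
  have cR: "coeff R i = 0" if "i \<ge> m" for i
    using coeff_linear_factor_eq_0[of m w R i] P(1) that unfolding R by blast
  have perp: "ip P (pCons 0 R) = 0"
  proof (rule ip_orthogonal)
    fix j assume "coeff (pCons 0 R) j \<noteq> 0"
    then obtain i where i: "j = Suc i" "coeff R i \<noteq> 0"
      by (cases j) auto
    then have "i < m"
      using cR not_le by blast
    then show "ip P (monom 1 j) = 0"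
      using i by (intro P(2)) auto
  qed
  have wR: "smult w R = pCons 0 R - P"
    by (simp add: R)
  have "ip (smult w R) (smult w R) = ip R R + ip P P"
    using perp ip_commute[of "pCons 0 R" P]
    by (simp add: wR ip_diff_left ip_diff_right ip_shift)
  moreover have "ip (smult w R) (smult w R) = of_real ((cmod w)\<^sup>2) * ip R R"
    by (simp only: ip_smult_left ip_smult_right complex_norm_square mult_ac)
  ultimately have "of_real ((cmod w)\<^sup>2) * ip R R = ip R R + ip P P"
    by simp
  then have "(cmod w)\<^sup>2 * Re (ip R R) = Re (ip R R) + Re (ip P P)"
    by (simp add: complex_eq_iff)
  moreover have "Re (ip P P) > 0" "Re (ip R R) \<ge> 0"
    using ip_self_pos[OF \<open>P \<noteq> 0\<close>] ip_self_nonneg by auto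
  ultimately have "(cmod w)\<^sup>2 * Re (ip R R) > 1 * Re (ip R R)"
    by linarith
  then have "(cmod w)\<^sup>2 > 1"
    using \<open>Re (ip R R) \<ge> 0\<close> mult_right_less_imp_less by blast
  then show ?thesis
    by (metis one_power2 power2_less_imp_less norm_ge_zero)
qed

end

text \<open>
  The index is shifted so that \<open>N\<close> is the degree of the trigonometric polynomials that the quadrature
  integrates exactly.
\<close>
locale orthonormal_polynomial = nontrivial_circle_measure +
  fixes N :: nat and \<phi> :: "complex poly"
  assumes deg: "degree \<phi> = Suc N"
    and orth: "\<And>j. j \<le> N \<Longrightarrow> ip \<phi> (monom 1 j) = 0"
    and normed: "ip \<phi> \<phi> = 1"
    and real_at_1: "poly \<phi> 1 \<in> \<real>"
begin

text \<open>
  The companion polynomial up to the factor \<open>\<i> / 2\<close>, which affects neither its zeros nor the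
  kernels at them.
\<close>
definition B :: "complex poly" where "B = star_poly \<phi> - \<phi>"

text \<open>
  On the circle \<open>\<phi>\<^sup>*\<close> is \<open>z ^ (N + 1)\<close> times the conjugate of \<open>\<phi>\<close>, so pairing it with \<open>z ^ j\<close> amounts
  to pairing \<open>\<phi>\<close> with \<open>z ^ (N + 1 - j)\<close>.
\<close>
lemma star_orth:
  assumes "1 \<le> j" "j \<le> Suc N"
  shows "ip (star_poly \<phi>) (monom 1 j) = 0"
proof -
  have "ip (star_poly \<phi>) (monom 1 j) = ip (monom 1 (Suc N - j)) \<phi>"
  proof (rule ip_cong_circle)
    fix x :: real
    let ?z = "circle_e (of_real x)"
    have "?z ^ Suc N * cnj ?z ^ j = ?z ^ (Suc N - j) * (?z * cnj ?z) ^ j"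
      using assms by (simp add: power_mult_distrib power_add[symmetric] mult.assoc[symmetric]
        del: power_Suc)
    also have "?z * cnj ?z = 1"
      by (simp add: complex_norm_square[symmetric])
    finally have "?z ^ Suc N * cnj ?z ^ j = ?z ^ (Suc N - j)"
      by simp
    then show "poly (star_poly \<phi>) ?z * cnj (poly (monom 1 j) ?z)
        = poly (monom 1 (Suc N - j)) ?z * cnj (poly \<phi> ?z)"
      by (simp add: poly_star_circle deg poly_monom mult_ac)
  qed
  also have "\<dots> = cnj (ip \<phi> (monom 1 (Suc N - j)))"
    by (rule ip_commute)
  finally show ?thesis
    using assms by (simp add: orth)
qed

lemma ip_star_star: "ip (star_poly \<phi>) (star_poly \<phi>) = 1"
proof -
  have "ip (star_poly \<phi>) (star_poly \<phi>) = ip \<phi> \<phi>"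
  proof (rule ip_cong_circle)
    fix x :: real
    let ?z = "circle_e (of_real x)"
    have "?z ^ Suc N * cnj (?z ^ Suc N) = 1"
      by (simp only: complex_norm_square[symmetric] norm_power norm_circle_e) simp
    then show "poly (star_poly \<phi>) ?z * cnj (poly (star_poly \<phi>) ?z)
        = poly \<phi> ?z * cnj (poly \<phi> ?z)"
      by (simp add: poly_star_circle deg mult_ac del: power_Suc complex_cnj_power)
  qed
  then show ?thesis by (simp add: normed)
qed

lemma coeff_star_high: "i > Suc N \<Longrightarrow> coeff (star_poly \<phi>) i = 0"
  by (simp add: coeff_star_poly deg)

lemma coeff_B_high: "i > Suc N \<Longrightarrow> coeff B i = 0"
  by (simp add: B_def coeff_star_high coeff_eq_0 deg)

lemma B_orth:
  assumes "1 \<le> j" "j \<le> N"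
  shows "ip B (monom 1 j) = 0"
  using assms by (simp add: B_def ip_diff_left star_orth orth)

lemma B_at_1: "poly B 1 = 0"
  using real_at_1 by (simp add: B_def poly_star_circle Reals_cnj_iff)

lemma B_nonzero: "B \<noteq> 0"
proof
  assume "B = 0"
  then have eq: "star_poly \<phi> = \<phi>" by (simp add: B_def)
  have "ip \<phi> \<phi> = 0"
  proof (rule ip_orthogonal)
    fix j assume "coeff \<phi> j \<noteq> 0"
    then have "j \<le> Suc N" using deg le_degree by metis
    then consider "j \<le> N" | "1 \<le> j" "j \<le> Suc N" by linarith
    then show "ip \<phi> (monom 1 j) = 0"
      using orth star_orth eq by cases auto
  qed
  then show False by (simp add: normed)
qed

text \<open>
  Otherwise \<open>B\<close> would have degree at most \<open>N\<close> and be orthogonal to \<open>z, \<dots>, z ^ N\<close>, hence have all its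
  zeros outside the closed disc, but it vanishes at 1.
\<close>
lemma coeff_B_top: "coeff B (Suc N) \<noteq> 0"
proof
  assume "coeff B (Suc N) = 0"
  then have "coeff B i = 0" if "i > N" for i
    using coeff_B_high[of i] that by (cases "i = Suc N") auto
  from root_outside_disc[of N B 1, OF this B_orth B_nonzero B_at_1]
  show False by simp
qed

lemma degree_B: "degree B = Suc N"
  using coeff_B_top coeff_B_high by (metis degree_le le_antisym le_degree)

lemma B_at_0: "poly B 0 = - cnj (coeff B (Suc N))"
  by (simp add: B_def coeff_star_poly deg poly_0_coeff_0)

lemma B_at_0_nonzero: "poly B 0 \<noteq> 0"
  using coeff_B_top by (simp add: B_at_0)

text \<open>
  Two zeros \<open>w\<close> and \<open>1 / cnj w\<close>, or a double zero on the circle, would give this factorization.  On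
  the circle \<open>(z - w) (cnj w * z - 1) = - z * \<bar>z - w\<bar>\<^sup>2\<close>, so \<open>B\<close> would have a nonzero inner
  product with \<open>z R\<close>, although it is orthogonal to \<open>z, \<dots>, z ^ N\<close>.
\<close>
lemma no_symmetric_root_pair: "B \<noteq> [:- w, 1:] * ([:- 1, cnj w:] * R)"
proof
  assume B: "B = [:- w, 1:] * ([:- 1, cnj w:] * R)"
  then have "R \<noteq> 0"
    using B_nonzero by auto
  have w: "w \<noteq> 0"
    using B_at_0_nonzero by (auto simp: B)
  have cR: "coeff R i = 0" if "i \<ge> N" for i
  proof -
    have "degree B = Suc (Suc (degree R))"
      unfolding B using \<open>R \<noteq> 0\<close> w
      by (simp add: degree_mult_eq del: mult_pCons_left mult_pCons_right)
    then show ?thesis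
      using degree_B that by (intro coeff_eq_0) simp
  qed
  have "ip B (pCons 0 R) = 0"
  proof (rule ip_orthogonal)
    fix j assume "coeff (pCons 0 R) j \<noteq> 0"
    then obtain i where i: "j = Suc i" "coeff R i \<noteq> 0"
      by (cases j) auto
    then have "i < N"
      using cR not_le by blast
    then show "ip B (monom 1 j) = 0"
      using i by (intro B_orth) auto
  qed
  moreover have "ip B (pCons 0 R) = - ip ([:- w, 1:] * R) ([:- w, 1:] * R)"
  proof -
    have "ip B (pCons 0 R) = ip (smult (- 1) ([:- w, 1:] * R)) ([:- w, 1:] * R)"
    proof (rule ip_cong_circle)
      fix x :: real
      let ?z = "circle_e (of_real x)"
      have zz: "cnj ?z * ?z = 1"
        by (simp add: complex_norm_square[symmetric] mult.commute)
      have "(?z * cnj w - 1) * cnj ?z = - cnj (?z - w)"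
        using zz by (simp add: algebra_simps)
      moreover have "poly B ?z * cnj (poly (pCons 0 R) ?z) =
          (?z - w) * poly R ?z * cnj (poly R ?z) * ((?z * cnj w - 1) * cnj ?z)"
        by (simp add: B algebra_simps)
      ultimately have "poly B ?z * cnj (poly (pCons 0 R) ?z)
          = - ((?z - w) * poly R ?z * cnj ((?z - w) * poly R ?z))"
        by (simp only: complex_cnj_mult) (simp add: mult_ac del: complex_cnj_diff)
      then show "poly B ?z * cnj (poly (pCons 0 R) ?z) =
          poly (smult (- 1) ([:- w, 1:] * R)) ?z * cnj (poly ([:- w, 1:] * R) ?z)"
        by (simp only: poly_linear_mult poly_smult mult_1_left mult_minus_left)
    qed
    then show ?thesis
      by (simp only: ip_smult_left) simp
  qed
  ultimately have "[:- w, 1:] * R = 0"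
    by (simp only: ip_self_eq_0_iff neg_equal_0_iff_equal)
  then show False
    using \<open>R \<noteq> 0\<close> unfolding mult_eq_0_iff by simp
qed

text \<open>
  The polynomial \<open>B\<close> is its own reversed conjugate up to sign.
\<close>
lemma B_reflected_root:
  assumes "poly B w = 0"
  shows "poly B (inverse (cnj w)) = 0"
proof -
  have w: "w \<noteq> 0"
    using assms B_at_0_nonzero by auto
  have "poly (star_poly \<phi>) w = poly \<phi> w"
    using assms by (simp add: B_def)
  then have "w ^ Suc N * cnj (poly \<phi> (inverse (cnj w))) = poly \<phi> w"
    using w by (simp add: poly_star_poly deg)
  then have "cnj w ^ Suc N * poly \<phi> (inverse (cnj w)) = cnj (poly \<phi> w)"
    by (metis complex_cnj_cnj complex_cnj_mult complex_cnj_power)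
  then have "poly \<phi> (inverse (cnj w)) = inverse (cnj w) ^ Suc N * cnj (poly \<phi> w)"
    using w by (simp add: field_simps)
  moreover have "poly (star_poly \<phi>) (inverse (cnj w)) = inverse (cnj w) ^ Suc N * cnj (poly \<phi> w)"
    using w by (subst poly_star_poly) (auto simp: deg)
  ultimately show ?thesis
    by (simp add: B_def)
qed

lemma B_root_on_circle:
  assumes "poly B w = 0"
  shows "cmod w = 1"
proof (rule ccontr)
  assume "cmod w \<noteq> 1"
  have w: "w \<noteq> 0"
    using assms B_at_0_nonzero by auto
  have ne: "inverse (cnj w) \<noteq> w"
  proof
    assume "inverse (cnj w) = w"
    then have "cmod (inverse (cnj w)) = cmod w" by simp
    then have "cmod w * cmod w = 1"
      using w by (simp add: norm_divide field_simps)
    then have "(cmod w)\<^sup>2 = 1\<^sup>2" by (simp add: power2_eq_square)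
    then show False
      using \<open>cmod w \<noteq> 1\<close> by (simp only: power2_eq_iff) (use norm_ge_zero[of w] in linarith)
  qed
  obtain R where R: "B = [:- w, 1:] * R"
    using root_factor[OF assms] .
  have "poly R (inverse (cnj w)) = 0"
    using B_reflected_root[OF assms] ne by (simp add: R)
  then obtain S where S: "R = [:- inverse (cnj w), 1:] * S"
    using root_factor by blast
  have "[:- inverse (cnj w), 1:] = smult (inverse (cnj w)) [:- 1, cnj w:]"
    using w by simp
  then have "B = [:- w, 1:] * ([:- 1, cnj w:] * smult (inverse (cnj w)) S)"
    by (simp only: R S mult_smult_left mult_smult_right)
  then show False
    using no_symmetric_root_pair by blast
qed

lemma B_root_simple:
  assumes "poly B w = 0"
  shows "poly (pderiv B) w \<noteq> 0"
proof
  assume d: "poly (pderiv B) w = 0"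
  have w: "w \<noteq> 0"
    using assms B_at_0_nonzero by auto
  have ww: "w * cnj w = 1"
    using B_root_on_circle[OF assms] by (simp add: complex_norm_square[symmetric])
  obtain R where R: "B = [:- w, 1:] * R"
    using root_factor[OF assms] .
  have "poly R w = 0"
    using d by (simp add: R pderiv_mult pderiv_pCons del: mult_pCons_left)
  then obtain S where S: "R = [:- w, 1:] * S"
    using root_factor by blast
  have "[:- w, 1:] = smult w [:- 1, cnj w:]"
    using ww by simp
  then have "B = [:- w, 1:] * ([:- 1, cnj w:] * smult w S)"
    by (simp only: R S mult_smult_left mult_smult_right)
  then show False
    using no_symmetric_root_pair by blast
qed

definition roots :: "complex set" where "roots = {w. poly B w = 0}"

lemma finite_roots: "finite roots"
  unfolding roots_def by (rule poly_roots_finite[OF B_nonzero])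

lemma card_roots: "card roots = Suc N"
proof -
  have "rsquarefree B"
    using B_root_simple by (simp add: rsquarefree_roots)
  then have "order w B = 1" if "w \<in> roots" for w
    using that B_nonzero by (simp add: roots_def rsquarefree_root_order)
  moreover have "order w B = 0" if "w \<notin> roots" for w
    using that by (intro order_0I) (simp add: roots_def)
  ultimately have "proots B = mset_set roots"
    by (intro multiset_eqI) (simp add: count_mset_set' finite_roots B_nonzero)
  then have "card roots = size (proots B)"
    by simp
  then show ?thesis
    by (simp add: size_proots_complex degree_B)
qed

lemma star_eq_at_root: "w \<in> roots \<Longrightarrow> poly (star_poly \<phi>) w = poly \<phi> w"
  by (simp add: roots_def B_def)

lemma phi_nonzero_at_root:
  assumes "w \<in> roots"
  shows "poly \<phi> w \<noteq> 0"
proof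
  assume "poly \<phi> w = 0"
  then have "poly (star_poly \<phi>) w = 0"
    using assms by (simp add: star_eq_at_root)
  moreover have "star_poly \<phi> \<noteq> 0"
    using ip_star_star by auto
  ultimately have "cmod w > 1"
    using root_outside_disc[of "Suc N" "star_poly \<phi>" w] coeff_star_high star_orth by blast
  then show False
    using B_root_on_circle assms by (simp add: roots_def)
qed

definition quotient :: "complex \<Rightarrow> complex poly" where
  "quotient w = (THE R. B = [:- w, 1:] * R)"

lemma quotient:
  assumes "w \<in> roots"
  shows "B = [:- w, 1:] * quotient w"
proof -
  obtain R where R: "B = [:- w, 1:] * R"
    using root_factor assms unfolding roots_def by blast
  have "quotient w = R"
    unfolding quotient_def
  proof (rule the_equality)
    show "B = [:- w, 1:] * R" by (rule R)
    show "S = R" if "B = [:- w, 1:] * S" for S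
      using that unfolding R mult_cancel_left by auto
  qed
  with R show ?thesis by simp
qed

lemma coeff_quotient_high: "w \<in> roots \<Longrightarrow> i > N \<Longrightarrow> coeff (quotient w) i = 0"
  using coeff_linear_factor_eq_0[of "Suc N" w "quotient w" i] coeff_B_high quotient[of w] by simp

lemma quotient_at_other_root:
  assumes "w \<in> roots" "v \<in> roots" "v \<noteq> w"
  shows "poly (quotient w) v = 0"
proof -
  have "(v - w) * poly (quotient w) v = poly B v"
    by (subst quotient[OF assms(1)]) (simp add: algebra_simps)
  then show ?thesis
    using assms by (simp add: roots_def)
qed

text \<open>
  The kernel \<open>K(w, \<sqdot>)\<close> at a zero \<open>w\<close> of \<open>B\<close>: there \<open>\<phi>\<^sup>*(w) = \<phi>(w)\<close>, so the numerator of the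
  Christoffel--Darboux quotient is a multiple of \<open>B\<close>; the quotient is computed in \<open>kern_limit\<close>.
\<close>
definition kern :: "complex \<Rightarrow> complex poly" where
  "kern w = smult (- w * cnj (poly \<phi> w)) (quotient w)"

text \<open>
  Write \<open>P - P(w) = (z - w) R\<close> and move the factor \<open>z - w\<close> to the other side of the inner product,
  where it completes the kernel to \<open>B\<close>; what appears is the inner product of \<open>z R\<close> with \<open>B\<close>, which
  vanishes.  The remaining factor does not depend on \<open>P\<close>.
\<close>
lemma kern_reproducing_up_to_factor:
  assumes w: "w \<in> roots" and P: "\<And>i. i > N \<Longrightarrow> coeff P i = 0"
  shows "ip P (kern w) = poly P w * ip 1 (kern w)"
proof -
  obtain R where R: "P - [:poly P w:] = [:- w, 1:] * R"
    using root_factor[of "P - [:poly P w:]" w] by auto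
  have cR: "coeff R i = 0" if "i \<ge> N" for i
  proof (rule coeff_linear_factor_eq_0[OF _ that])
    fix i assume "i > N"
    then show "coeff ([:- w, 1:] * R) i = 0"
      unfolding R[symmetric] using P by (cases i) auto
  qed
  have ww: "w * cnj w = 1"
    using B_root_on_circle w by (simp add: roots_def complex_norm_square[symmetric])
  have "ip ([:- w, 1:] * R) (quotient w) = ip (smult (- w) (pCons 0 R)) B"
  proof (rule ip_cong_circle)
    fix x :: real
    let ?z = "circle_e (of_real x)"
    have zz: "?z * cnj ?z = 1"
      by (simp add: complex_norm_square[symmetric] mult.commute)
    have "- w * ?z * cnj (?z - w) = - w * (?z * cnj ?z) + ?z * (w * cnj w)"
      by (simp add: algebra_simps)
    then have "- w * ?z * cnj (?z - w) = ?z - w"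
      unfolding zz ww by simp
    moreover have "poly B ?z = (?z - w) * poly (quotient w) ?z"
      by (subst quotient[OF w]) (simp add: algebra_simps)
    then have "poly (smult (- w) (pCons 0 R)) ?z * cnj (poly B ?z)
        = (- w * ?z * cnj (?z - w)) * (poly R ?z * cnj (poly (quotient w) ?z))"
      by (simp only: complex_cnj_mult) (simp add: mult_ac del: complex_cnj_diff)
    ultimately have "poly (smult (- w) (pCons 0 R)) ?z * cnj (poly B ?z)
        = (?z - w) * poly R ?z * cnj (poly (quotient w) ?z)"
      by (simp only: mult.assoc)
    then show "poly ([:- w, 1:] * R) ?z * cnj (poly (quotient w) ?z)
        = poly (smult (- w) (pCons 0 R)) ?z * cnj (poly B ?z)"
      by (simp only: poly_linear_mult)
  qed
  also have "\<dots> = - w * cnj (ip B (pCons 0 R))"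
    by (simp only: ip_smult_left ip_commute[of "pCons 0 R" B])
  also have "ip B (pCons 0 R) = 0"
  proof (rule ip_orthogonal)
    fix j assume "coeff (pCons 0 R) j \<noteq> 0"
    then obtain i where i: "j = Suc i" "coeff R i \<noteq> 0"
      by (cases j) auto
    then have "i < N"
      using cR not_le by blast
    then show "ip B (monom 1 j) = 0"
      using i by (intro B_orth) auto
  qed
  finally have "ip (P - [:poly P w:]) (kern w) = 0"
    by (simp only: R kern_def ip_smult_right) simp
  then show ?thesis
    using ip_smult_left[of "poly P w" 1 "kern w"] by (simp add: ip_diff_left one_pCons)
qed

text \<open>
  The Christoffel--Darboux kernel \<open>K(0, \<sqdot>)\<close>.  Its reproducing property needs no division, and it
  supplies the test polynomial that fixes the normalization of the other kernels.
\<close>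
definition kern0 :: "complex poly" where
  "kern0 = smult (coeff \<phi> (Suc N)) (star_poly \<phi>) - smult (cnj (coeff \<phi> 0)) \<phi>"

lemma coeff_kern0_high: "i > N \<Longrightarrow> coeff kern0 i = 0"
  by (cases "i = Suc N") (auto simp: kern0_def coeff_star_poly deg coeff_eq_0)

lemma ip_phi_low:
  assumes "\<And>i. i > N \<Longrightarrow> coeff P i = 0"
  shows "ip P \<phi> = 0"
proof -
  have "ip \<phi> P = 0"
    by (rule ip_orthogonal) (metis assms not_le orth)
  then show ?thesis
    using ip_commute[of P \<phi>] by simp
qed

lemma ip_star_low:
  assumes "\<And>i. i > Suc N \<Longrightarrow> coeff P i = 0"
  shows "ip P (star_poly \<phi>) = coeff P 0 * ip 1 (star_poly \<phi>)"
proof -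
  have "ip (star_poly \<phi>) (P - [:coeff P 0:]) = 0"
  proof (rule ip_orthogonal)
    fix j assume j: "coeff (P - [:coeff P 0:]) j \<noteq> 0"
    then have "j \<noteq> 0" "j \<le> Suc N"
      using assms[of j] by (cases j; cases "j > Suc N"; simp)+
    then show "ip (star_poly \<phi>) (monom 1 j) = 0"
      by (intro star_orth) auto
  qed
  then have "ip (P - [:coeff P 0:]) (star_poly \<phi>) = 0"
    using ip_commute[of "P - [:coeff P 0:]" "star_poly \<phi>"] by simp
  then show ?thesis
    using ip_smult_left[of "coeff P 0" 1 "star_poly \<phi>"] by (simp add: ip_diff_left one_pCons)
qed

lemma kern0_reproducing:
  assumes "\<And>i. i > N \<Longrightarrow> coeff P i = 0"
  shows "ip P kern0 = coeff P 0"
proof -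
  have "1 = cnj (coeff \<phi> (Suc N)) * ip 1 (star_poly \<phi>)"
    using ip_star_low[of "star_poly \<phi>"] coeff_star_high
    by (simp add: ip_star_star coeff_star_poly deg)
  moreover have "ip P kern0 = cnj (coeff \<phi> (Suc N)) * (coeff P 0 * ip 1 (star_poly \<phi>))"
    using ip_phi_low[of P] ip_star_low[of P] assms
    by (simp add: kern0_def ip_diff_right ip_smult_right)
  ultimately show ?thesis
    by (metis mult.left_commute mult.right_neutral)
qed

text \<open>
  The inner product of \<open>K(0, \<sqdot>)\<close> and \<open>K(w, \<sqdot>)\<close> is evaluated with either reproducing property, and
  \<open>K(0, w)\<close>, the conjugate of \<open>K(w, 0)\<close>, does not vanish.
\<close>
lemma ip_1_kern:
  assumes w: "w \<in> roots"
  shows "ip 1 (kern w) = 1"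
proof -
  have k0: "poly kern0 w = poly \<phi> w * (coeff \<phi> (Suc N) - cnj (coeff \<phi> 0))"
    using star_eq_at_root[OF w] by (simp add: kern0_def algebra_simps)
  have B0: "poly B 0 = cnj (coeff \<phi> (Suc N)) - coeff \<phi> 0"
    by (simp add: B_def poly_0_coeff_0 coeff_star_poly deg)
  have "coeff (kern w) 0 = cnj (poly \<phi> w) * (- w * coeff (quotient w) 0)"
    by (simp add: kern_def)
  also have "- w * coeff (quotient w) 0 = poly B 0"
    by (subst quotient[OF w]) (simp add: poly_0_coeff_0)
  finally have kw: "cnj (coeff (kern w) 0) = poly kern0 w"
    by (simp add: k0 B0)
  have nz: "poly kern0 w \<noteq> 0"
    using B_at_0_nonzero phi_nonzero_at_root[OF w] unfolding k0 B0
    by (metis complex_cnj_cnj eq_iff_diff_eq_0 mult_eq_0_iff)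
  have "ip (kern w) kern0 = coeff (kern w) 0"
    using coeff_quotient_high[OF w] by (intro kern0_reproducing) (simp add: kern_def)
  then have "ip kern0 (kern w) = poly kern0 w"
    using ip_commute[of kern0 "kern w"] kw by simp
  then show ?thesis
    using kern_reproducing_up_to_factor[OF w coeff_kern0_high] nz by simp
qed

lemma kern_reproducing:
  assumes "w \<in> roots" "\<And>i. i > N \<Longrightarrow> coeff P i = 0"
  shows "ip P (kern w) = poly P w"
  using kern_reproducing_up_to_factor[OF assms] ip_1_kern[OF assms(1)] by simp

lemma kern_at_other_root: "w \<in> roots \<Longrightarrow> v \<in> roots \<Longrightarrow> v \<noteq> w \<Longrightarrow> poly (kern w) v = 0"
  by (simp add: kern_def quotient_at_other_root)

lemma coeff_kern_high: "w \<in> roots \<Longrightarrow> i > N \<Longrightarrow> coeff (kern w) i = 0"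
  by (simp add: kern_def coeff_quotient_high)

lemma kern_diagonal_pos:
  assumes "w \<in> roots"
  shows "poly (kern w) w = of_real (Re (poly (kern w) w))" "Re (poly (kern w) w) > 0"
proof -
  have eq: "ip (kern w) (kern w) = poly (kern w) w"
    using assms coeff_kern_high by (intro kern_reproducing) auto
  have "kern w \<noteq> 0"
    using ip_1_kern[OF assms] by auto
  then show "poly (kern w) w = of_real (Re (poly (kern w) w))" "Re (poly (kern w) w) > 0"
    using ip_self_pos[of "kern w"] ip_self_real[of "kern w"] unfolding eq by auto
qed

text \<open>
  The kernels vanish at the other zeros, so they form a Lagrange basis.
\<close>
lemma kern_interpolation:
  assumes P: "\<And>i. i > N \<Longrightarrow> coeff P i = 0"
  shows "P = (\<Sum>w\<in>roots. smult (poly P w / poly (kern w) w) (kern w))" (is "P = ?Q")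
proof (rule ccontr)
  assume "P \<noteq> ?Q"
  then have nz: "P - ?Q \<noteq> 0" by simp
  have "poly (P - ?Q) v = 0" if "v \<in> roots" for v
  proof -
    have "poly ?Q v = (\<Sum>w\<in>roots. if w = v then poly P v else 0)"
      unfolding poly_sum using that kern_diagonal_pos(2)[OF that]
      by (intro sum.cong) (auto simp: kern_at_other_root)
    then show ?thesis
      using that finite_roots by simp
  qed
  then have "roots \<subseteq> {w. poly (P - ?Q) w = 0}" by blast
  then have "Suc N \<le> card {w. poly (P - ?Q) w = 0}"
    unfolding card_roots[symmetric] by (rule card_mono[OF poly_roots_finite[OF nz]])
  also have "\<dots> \<le> degree (P - ?Q)"
    by (rule card_poly_roots_bound[OF nz])
  also have "\<dots> \<le> N"
    by (intro degree_le) (auto simp: P coeff_sum coeff_kern_high)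
  finally show False by simp
qed

text \<open>
  By the reproducing property the Lagrange basis is orthogonal, so no error term is left.
\<close>
lemma ip_quadrature:
  assumes P: "\<And>i. i > N \<Longrightarrow> coeff P i = 0" and Q: "\<And>i. i > N \<Longrightarrow> coeff Q i = 0"
  shows "ip P Q = (\<Sum>w\<in>roots. poly P w * cnj (poly Q w) / poly (kern w) w)"
proof -
  have "ip P Q = (\<Sum>w\<in>roots. cnj (poly Q w / poly (kern w) w) * poly P w)"
    using kern_reproducing[OF _ P]
    by (subst kern_interpolation[OF Q]) (simp_all add: ip_sum_right ip_smult_right)
  also have "\<dots> = (\<Sum>w\<in>roots. poly P w * cnj (poly Q w) / poly (kern w) w)"
  proof (rule sum.cong[OF refl])
    fix w assume "w \<in> roots"
    then have "cnj (poly (kern w) w) = poly (kern w) w"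
      by (metis kern_diagonal_pos(1) complex_cnj_complex_of_real)
    then show "cnj (poly Q w / poly (kern w) w) * poly P w
        = poly P w * cnj (poly Q w) / poly (kern w) w"
      by simp
  qed
  finally show ?thesis .
qed

end

section \<open>Trigonometric polynomials\<close>

lemma circle_e_add: "circle_e (z + w) = circle_e z * circle_e w"
  by (simp add: circle_e_def distrib_left exp_add)

lemma circle_e_zero [simp]: "circle_e 0 = 1"
  by (simp add: circle_e_def)

lemma circle_e_nonzero [simp]: "circle_e z \<noteq> 0"
  by (simp add: circle_e_def)

lemma circle_e_of_nat_mult: "circle_e (of_nat n * z) = circle_e z ^ n"
  by (simp add: circle_e_def exp_of_nat_mult[symmetric] mult_ac)

lemma circle_e_minus: "circle_e (- z) = inverse (circle_e z)"
  by (simp add: circle_e_def exp_minus)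

lemma circle_e_of_int: "circle_e (of_int n) = 1"
  by (auto simp: circle_e_def exp_eq_1)

lemma poly_sum_coeff:
  fixes p :: "'a::comm_semiring_1 poly"
  assumes "degree p \<le> n"
  shows "poly p x = (\<Sum>i\<le>n. coeff p i * x ^ i)"
proof -
  have "poly p x = poly (\<Sum>i\<le>n. monom (coeff p i) i) x"
    using poly_as_sum_of_monoms'[OF assms] by simp
  then show ?thesis by (simp add: poly_sum poly_monom)
qed

text \<open>
  Multiplication by \<open>e(N z)\<close> turns trigonometric polynomials into ordinary ones of degree at most
  \<open>2 N\<close>, for which zeros can be counted.
\<close>
lemma trig_poly_iff_poly:
  "trig_poly N W \<longleftrightarrow> (\<exists>P. (\<forall>i>2 * N. coeff P i = 0) \<and>
     (\<forall>z. W z = circle_e (- (of_nat N * z)) * poly P (circle_e z)))"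
proof
  assume "trig_poly N W"
  then obtain a where a: "\<And>z. W z = (\<Sum>k = - int N..int N. a k * circle_e (of_int k * z))"
    unfolding trig_poly_def by blast
  define P where "P = (\<Sum>i\<le>2 * N. monom (a (int i - int N)) i)"
  have "W z = circle_e (- (of_nat N * z)) * poly P (circle_e z)" for z
  proof -
    have "W z = (\<Sum>i\<le>2 * N. a (int i - int N) * circle_e (of_int (int i - int N) * z))"
      unfolding a
      by (rule sum.reindex_bij_witness[where j = "\<lambda>k. nat (k + int N)" and i = "\<lambda>i. int i - int N"]) auto
    also have "\<dots> = (\<Sum>i\<le>2 * N. circle_e (- (of_nat N * z)) * (a (int i - int N) * circle_e z ^ i))"
    proof (rule sum.cong[OF refl])
      fix i
      have "of_int (int i - int N) * z = - (of_nat N * z) + of_nat i * z"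
        by (simp add: algebra_simps)
      then have "circle_e (of_int (int i - int N) * z) = circle_e (- (of_nat N * z)) * circle_e z ^ i"
        by (simp only: circle_e_add circle_e_of_nat_mult)
      then show "a (int i - int N) * circle_e (of_int (int i - int N) * z)
          = circle_e (- (of_nat N * z)) * (a (int i - int N) * circle_e z ^ i)"
        by simp
    qed
    finally show ?thesis
      by (simp add: P_def poly_sum poly_monom sum_distrib_left)
  qed
  then show "\<exists>P. (\<forall>i>2 * N. coeff P i = 0) \<and>
     (\<forall>z. W z = circle_e (- (of_nat N * z)) * poly P (circle_e z))"
    by (intro exI[of _ P]) (auto simp: P_def coeff_sum)
next
  assume "\<exists>P. (\<forall>i>2 * N. coeff P i = 0) \<and>
     (\<forall>z. W z = circle_e (- (of_nat N * z)) * poly P (circle_e z))"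
  then obtain P where P: "\<forall>i>2 * N. coeff P i = 0"
    "\<And>z. W z = circle_e (- (of_nat N * z)) * poly P (circle_e z)" by blast
  have "W z = (\<Sum>k = - int N..int N. coeff P (nat (k + int N)) * circle_e (of_int k * z))" for z
  proof -
    have deg: "degree P \<le> 2 * N"
      using P(1) by (intro degree_le) auto
    have "W z = (\<Sum>i\<le>2 * N. circle_e (- (of_nat N * z)) * (coeff P i * circle_e z ^ i))"
      unfolding P(2) poly_sum_coeff[OF deg] sum_distrib_left ..
    also have "\<dots> = (\<Sum>k = - int N..int N. coeff P (nat (k + int N)) * circle_e (of_int k * z))"
    proof (rule sum.reindex_bij_witness[where i = "\<lambda>k. nat (k + int N)" and j = "\<lambda>i. int i - int N"])
      fix i
      have "of_int (int i - int N) * z = - (of_nat N * z) + of_nat i * z"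
        by (simp add: algebra_simps)
      then have "circle_e (of_int (int i - int N) * z) = circle_e (- (of_nat N * z)) * circle_e z ^ i"
        by (simp only: circle_e_add circle_e_of_nat_mult)
      then show "coeff P (nat (int i - int N + int N)) * circle_e (of_int (int i - int N) * z)
          = circle_e (- (of_nat N * z)) * (coeff P i * circle_e z ^ i)"
        by simp
    qed auto
    finally show ?thesis .
  qed
  then show "trig_poly N W"
    unfolding trig_poly_def by (intro exI[of _ "\<lambda>k. coeff P (nat (k + int N))"]) blast
qed

lemma trig_poly_cmult: "trig_poly N W \<Longrightarrow> trig_poly N (\<lambda>z. c * W z)"
  unfolding trig_poly_def by (elim exE, rule_tac x = "\<lambda>k. c * a k" in exI) (simp add: sum_distrib_left mult.assoc)

lemma trig_poly_add: "trig_poly N V \<Longrightarrow> trig_poly N W \<Longrightarrow> trig_poly N (\<lambda>z. V z + W z)"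
  unfolding trig_poly_def
  by (elim exE, rule_tac x = "\<lambda>k. a k + aa k" in exI) (simp add: sum.distrib distrib_right)

lemma trig_poly_const: "trig_poly N (\<lambda>z. c)"
  unfolding trig_poly_def
proof (intro exI[of _ "\<lambda>k. if k = 0 then c else 0"] allI)
  fix z
  have "(\<Sum>k = - int N..int N. (if k = 0 then c else 0) * circle_e (of_int k * z))
      = (\<Sum>k = - int N..int N. if k = 0 then c else 0)"
    by (intro sum.cong) auto
  then show "c = (\<Sum>k = - int N..int N. (if k = 0 then c else 0) * circle_e (of_int k * z))"
    by simp
qed

lemma trig_poly_sum: "(\<And>i. i \<in> A \<Longrightarrow> trig_poly N (W i)) \<Longrightarrow> trig_poly N (\<lambda>z. \<Sum>i\<in>A. W i z)"
  by (induction A rule: infinite_finite_induct) (auto intro: trig_poly_add trig_poly_const)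

lemma trig_poly_periodic:
  assumes "trig_poly N W"
  shows "W (z + of_int n) = W z"
proof -
  obtain a where a: "\<And>z. W z = (\<Sum>k = - int N..int N. a k * circle_e (of_int k * z))"
    using assms unfolding trig_poly_def by blast
  have "circle_e (of_int k * (z + of_int n)) = circle_e (of_int k * z)" for k
    using circle_e_of_int[of "k * n"] by (simp add: distrib_left circle_e_add)
  then show ?thesis by (simp add: a)
qed

lemma has_field_derivative_circle_e:
  "(circle_e has_field_derivative (2 * of_real pi * \<i>) * circle_e z) (at z)"
  unfolding circle_e_def[abs_def] by (auto intro!: derivative_eq_intros)

lemma trig_poly_differentiable:
  assumes "trig_poly N W"
  shows "W field_differentiable (at z)"
proof -
  obtain a where a: "\<And>z. W z = (\<Sum>k = - int N..int N. a k * circle_e (of_int k * z))"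
    using assms unfolding trig_poly_def by blast
  show ?thesis
    unfolding a[abs_def] field_differentiable_def circle_e_def
    by (rule exI) (rule derivative_eq_intros refl)+
qed

text \<open>
  These are \<open>2 N + 1\<close> zeros counted with multiplicity, one more than the associated polynomial of
  degree at most \<open>2 N\<close> can have.
\<close>
lemma trig_poly_eq_0:
  assumes W: "trig_poly N W" and X: "finite X" "card X = N" "X \<subseteq> {0<..<1}"
    and W0: "W 0 = 0" and W1: "\<And>x. x \<in> X \<Longrightarrow> W (of_real x) = 0"
    and W2: "\<And>x. x \<in> X \<Longrightarrow> deriv W (of_real x) = 0"
  shows "W z = 0"
proof -
  obtain P where P: "\<forall>i>2 * N. coeff P i = 0"
    "\<And>z. W z = circle_e (- (of_nat N * z)) * poly P (circle_e z)"
    using W unfolding trig_poly_iff_poly by blast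
  have deg: "degree P \<le> 2 * N"
    using P(1) by (intro degree_le) auto
  have "P = 0"
  proof (rule ccontr)
    assume nz: "P \<noteq> 0"
    let ?Y = "(\<lambda>x::real. circle_e (of_real x)) ` X"
    have inj: "inj_on (\<lambda>x::real. circle_e (of_real x)) (insert 0 X)"
      by (rule inj_on_subset[OF inj_on_circle_e]) (use X in auto)
    have "0 \<notin> X" using X by auto
    then have "1 \<notin> ?Y"
      using inj by (auto simp: image_iff)
    have Y: "finite ?Y" "card ?Y = N"
      using X inj by (auto simp: card_image inj_on_subset)
    have two: "order y P \<ge> 2" if y: "y \<in> ?Y" for y
    proof -
      obtain x where x: "x \<in> X" "y = circle_e (of_real x)" using y by blast
      have Py: "poly P y = 0"
        using W1[OF x(1)] unfolding P(2) x(2) by simp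
      have "(W has_field_derivative
          - of_nat N * (2 * of_real pi * \<i> * circle_e (- (of_nat N * of_real x))) * poly P y
          + circle_e (- (of_nat N * of_real x)) * (poly (pderiv P) y * (2 * of_real pi * \<i> * y))) (at (of_real x))"
        unfolding P(2)[abs_def] x(2)
        by (rule derivative_eq_intros DERIV_chain2[OF has_field_derivative_circle_e]
            DERIV_chain2[OF poly_DERIV] refl | simp)+
      then have "deriv W (of_real x) = circle_e (- (of_nat N * of_real x)) * (poly (pderiv P) y * (2 * of_real pi * \<i> * y))"
        unfolding Py by (simp add: DERIV_imp_deriv)
      then have dP: "poly (pderiv P) y = 0"
        using W2[OF x(1)] x(2) by simp
      have "order y P \<noteq> 0"
        using Py nz order_root by blast
      moreover have "order y P \<noteq> 1"
      proof
        assume o: "order y P = 1"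
        have "pderiv P \<noteq> 0"
        proof
          assume "pderiv P = 0"
          then have "degree P = 0" by (simp add: pderiv_eq_0_iff)
          then have "order y P = 0"
            using nz Py by (metis degree_0_id degree_eq_zeroE mult_zero_right pCons_0_0 poly_pCons add.right_neutral poly_0)
          then show False using o by simp
        qed
        then have "order y (pderiv P) \<noteq> 0"
          using dP order_root by blast
        moreover have "order y P = Suc (order y (pderiv P))"
          using Py \<open>pderiv P \<noteq> 0\<close> by (intro order_pderiv) auto
        ultimately show False using o by simp
      qed
      ultimately show ?thesis by linarith
    qed
    have "poly P 1 = 0"
      using W0 unfolding P(2) by simp
    then have one: "order 1 P \<ge> 1"
      using nz order_root[of P 1] by linarith
    have "2 * N + 1 = 1 + (\<Sum>y\<in>?Y. 2)"
      using Y by simp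
    also have "\<dots> \<le> order 1 P + (\<Sum>y\<in>?Y. order y P)"
      by (intro add_mono one sum_mono two)
    also have "\<dots> = (\<Sum>y\<in>insert 1 ?Y. order y P)"
      using Y \<open>1 \<notin> ?Y\<close> by simp
    also have "\<dots> \<le> (\<Sum>y | poly P y = 0. order y P)"
    proof (rule sum_mono2)
      show "finite {y. poly P y = 0}" by (rule poly_roots_finite[OF nz])
      show "insert 1 ?Y \<subseteq> {y. poly P y = 0}"
        using W1 \<open>poly P 1 = 0\<close> unfolding P(2) by auto
    qed simp
    also have "\<dots> \<le> degree P"
      by (rule sum_order_le_degree[OF nz])
    finally show False using deg by simp
  qed
  then show ?thesis by (simp add: P(2))
qed

section \<open>Gauss quadrature on the circle\<close>

context orthonormal_polynomial
begin

definition nodes :: "real set" where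
  "nodes = {\<xi> \<in> {0<..<1}. poly B (circle_e (of_real \<xi>)) = 0}"

definition weight :: "real \<Rightarrow> real" where
  "weight \<xi> = Re (poly (kern (circle_e (of_real \<xi>))) (circle_e (of_real \<xi>)))"

lemma roots_eq_nodes: "roots = (\<lambda>\<xi>. circle_e (of_real \<xi>)) ` insert 0 nodes"
proof (intro equalityI subsetI)
  fix w assume w: "w \<in> roots"
  then obtain x where x: "x \<in> {0..<1}" "circle_e (of_real x) = w"
    using circle_e_surj[of w] B_root_on_circle by (auto simp: roots_def)
  then have "x \<in> insert 0 nodes"
    using w by (auto simp: nodes_def roots_def)
  with x show "w \<in> (\<lambda>\<xi>. circle_e (of_real \<xi>)) ` insert 0 nodes" by blast
next
  fix w assume "w \<in> (\<lambda>\<xi>. circle_e (of_real \<xi>)) ` insert 0 nodes"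
  then show "w \<in> roots"
    using B_at_1 by (auto simp: nodes_def roots_def)
qed

lemma inj_nodes: "inj_on (\<lambda>\<xi>. circle_e (of_real \<xi>)) (insert 0 nodes)"
  by (rule inj_on_subset[OF inj_on_circle_e]) (auto simp: nodes_def)

lemma finite_nodes: "finite nodes"
  using finite_roots inj_nodes unfolding roots_eq_nodes by (simp add: finite_image_iff)

lemma zero_notin_nodes: "0 \<notin> nodes"
  by (simp add: nodes_def)

lemma card_nodes: "card nodes = N"
proof -
  have "card roots = card (insert 0 nodes)"
    unfolding roots_eq_nodes by (rule card_image[OF inj_nodes])
  then show ?thesis
    using card_roots finite_nodes zero_notin_nodes by simp
qed

lemma node_in_roots: "\<xi> \<in> insert 0 nodes \<Longrightarrow> circle_e (of_real \<xi>) \<in> roots"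
  unfolding roots_eq_nodes by (rule imageI)

lemma kern_node: "\<xi> \<in> insert 0 nodes \<Longrightarrow>
    poly (kern (circle_e (of_real \<xi>))) (circle_e (of_real \<xi>)) = of_real (weight \<xi>)"
  unfolding weight_def by (rule kern_diagonal_pos(1)[OF node_in_roots])

lemma weight_pos: "\<xi> \<in> insert 0 nodes \<Longrightarrow> weight \<xi> > 0"
  unfolding weight_def by (rule kern_diagonal_pos(2)[OF node_in_roots])

text \<open>
  A single exponential is \<open>z ^ n\<close> or its conjugate on the circle, hence an inner product of
  polynomials of degree at most \<open>N\<close>.
\<close>
lemma exponential_quadrature:
  assumes "- int N \<le> k" "k \<le> int N"
  shows "(LINT x|\<theta>. circle_e (of_int k * of_real x))
    = (\<Sum>\<xi>\<in>insert 0 nodes. circle_e (of_int k * of_real \<xi>) / of_real (weight \<xi>))"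
proof -
  have pos: "(LINT x|\<theta>. circle_e (of_nat n * of_real x))
      = (\<Sum>\<xi>\<in>insert 0 nodes. circle_e (of_nat n * of_real \<xi>) / of_real (weight \<xi>))" if "n \<le> N" for n
  proof -
    have "(LINT x|\<theta>. circle_e (of_nat n * of_real x)) = ip (monom 1 n) 1"
      by (simp add: inner_circle_def poly_monom circle_e_of_nat_mult)
    also have "\<dots> = (\<Sum>w\<in>roots. poly (monom 1 n) w * cnj (poly 1 w) / poly (kern w) w)"
      using that by (intro ip_quadrature) (auto simp: one_pCons coeff_pCons split: nat.splits)
    also have "\<dots> = (\<Sum>\<xi>\<in>insert 0 nodes. circle_e (of_nat n * of_real \<xi>) / of_real (weight \<xi>))"
      unfolding roots_eq_nodes sum.reindex[OF inj_nodes]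
      by (intro sum.cong refl) (simp add: poly_monom circle_e_of_nat_mult kern_node del: insert_iff)
    finally show ?thesis .
  qed
  show ?thesis
  proof (cases "k \<ge> 0")
    case True
    then show ?thesis
      using pos[of "nat k"] assms by (simp add: of_nat_nat)
  next
    case False
    define n where "n = nat (- k)"
    have k: "of_int k = (- of_nat n :: complex)" and n: "n \<le> N"
      using False assms by (simp_all add: n_def)
    have c: "circle_e (of_int k * of_real x) = cnj (circle_e (of_nat n * of_real x))" for x :: real
      by (simp add: k circle_e_def exp_cnj)
    have "(LINT x|\<theta>. circle_e (of_int k * of_real x)) = cnj (LINT x|\<theta>. circle_e (of_nat n * of_real x))"
      unfolding c by (rule Bochner_Integration.integral_cnj)
    then show ?thesis
      unfolding pos[OF n] c by simp
  qed
qed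

lemma quadrature:
  assumes "trig_poly N W"
  shows "(LINT x|\<theta>. W (of_real x)) = (\<Sum>\<xi>\<in>insert 0 nodes. W (of_real \<xi>) / of_real (weight \<xi>))"
proof -
  obtain a where a: "\<And>z. W z = (\<Sum>k = - int N..int N. a k * circle_e (of_int k * z))"
    using assms unfolding trig_poly_def by blast
  have int: "integrable \<theta> (\<lambda>x. circle_e (of_int k * of_real x))" for k
    by (intro integrable_continuous continuous_intros)
  have "(LINT x|\<theta>. W (of_real x))
      = (\<Sum>k = - int N..int N. a k * (LINT x|\<theta>. circle_e (of_int k * of_real x)))"
    unfolding a using int by simp
  also have "\<dots> = (\<Sum>k = - int N..int N. a k *
      (\<Sum>\<xi>\<in>insert 0 nodes. circle_e (of_int k * of_real \<xi>) / of_real (weight \<xi>)))"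
    by (intro sum.cong refl arg_cong2[where f = "(*)"] exponential_quadrature) auto
  also have "\<dots> = (\<Sum>\<xi>\<in>insert 0 nodes. W (of_real \<xi>) / of_real (weight \<xi>))"
    unfolding a sum_distrib_left sum_divide_distrib
    by (subst sum.swap) simp
  finally show ?thesis .
qed

lemma real_quadrature:
  assumes "trig_poly N W"
  shows "(LINT x|\<theta>. Re (W (of_real x))) = Re (W 0) / weight 0 + (\<Sum>\<xi>\<in>nodes. Re (W (of_real \<xi>)) / weight \<xi>)"
proof -
  have "continuous_on UNIV (\<lambda>x::real. W (of_real x))"
  proof -
    have "continuous_on UNIV W"
      using trig_poly_differentiable[OF assms]
      by (intro continuous_at_imp_continuous_on ballI field_differentiable_imp_continuous_at)
    from continuous_on_compose2[OF this, of UNIV of_real] show ?thesis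
      by (simp add: continuous_on_of_real)
  qed
  then have "(LINT x|\<theta>. Re (W (of_real x))) = Re (LINT x|\<theta>. W (of_real x))"
    by (intro integral_Re integrable_continuous)
  also have "\<dots> = (\<Sum>\<xi>\<in>insert 0 nodes. Re (W (of_real \<xi>)) / weight \<xi>)"
    unfolding quadrature[OF assms] by simp
  finally show ?thesis
    using finite_nodes zero_notin_nodes by simp
qed

text \<open>
  Since \<open>\<bar>w\<bar> = 1\<close>, one has \<open>1 - cnj w * z = - cnj w * (z - w)\<close>, which cancels the zero of \<open>B\<close> at \<open>w\<close>.
\<close>
lemma kern_limit:
  assumes w: "w \<in> roots"
  shows "((\<lambda>z. (poly (star_poly \<phi>) z * cnj (poly (star_poly \<phi>) w) - poly \<phi> z * cnj (poly \<phi> w))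
    / (1 - cnj w * z)) \<longlongrightarrow> poly (kern w) w) (at w)"
proof (rule Lim_transform_eventually)
  show "(poly (kern w) \<longlongrightarrow> poly (kern w) w) (at w)"
    using poly_isCont isCont_def by blast
  have ww: "w * cnj w = 1"
    using B_root_on_circle w by (simp add: roots_def complex_norm_square[symmetric])
  have w0: "w \<noteq> 0" using ww by auto
  have "poly (kern w) z = (poly (star_poly \<phi>) z * cnj (poly (star_poly \<phi>) w) - poly \<phi> z * cnj (poly \<phi> w))
    / (1 - cnj w * z)" if "z \<noteq> w" for z
  proof -
    have "1 - cnj w * z = - cnj w * (z - w)"
      using ww by (simp add: algebra_simps)
    moreover have "poly (star_poly \<phi>) z * cnj (poly (star_poly \<phi>) w) - poly \<phi> z * cnj (poly \<phi> w)
        = cnj (poly \<phi> w) * poly B z"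
      unfolding star_eq_at_root[OF w] by (simp add: B_def algebra_simps)
    moreover have "poly B z = (z - w) * poly (quotient w) z"
      by (subst quotient[OF w]) (simp add: algebra_simps)
    moreover have "inverse (cnj w) = w"
      using ww by (metis inverse_unique mult.commute)
    then have "1 / cnj w = w"
      by (simp add: inverse_eq_divide)
    ultimately have "(poly (star_poly \<phi>) z * cnj (poly (star_poly \<phi>) w) - poly \<phi> z * cnj (poly \<phi> w))
        / (1 - cnj w * z) = (cnj (poly \<phi> w) * poly (quotient w) z) * (z - w) / (- cnj w * (z - w))"
      by (simp only: mult_ac)
    also have "\<dots> = - (1 / cnj w) * (cnj (poly \<phi> w) * poly (quotient w) z)"
      using that by simp
    finally show ?thesis
      by (simp add: kern_def \<open>1 / cnj w = w\<close>)
  qed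
  then show "eventually (\<lambda>z. poly (kern w) z = (poly (star_poly \<phi>) z * cnj (poly (star_poly \<phi>) w)
      - poly \<phi> z * cnj (poly \<phi> w)) / (1 - cnj w * z)) (at w)"
    by (auto simp: eventually_at_filter)
qed

end

section \<open>Rolle's theorem and Hermite interpolation\<close>

text \<open>
  The zeros of the derivative are taken strictly between neighbouring points of \<open>A\<close>.  That they avoid
  \<open>A\<close> matters when points of \<open>A\<close> are themselves zeros of the derivative.
\<close>
lemma rolle_many:
  fixes f f' :: "real \<Rightarrow> real"
  assumes "finite A" "card A = Suc k" "\<And>a. a \<in> A \<Longrightarrow> f a = 0"
    and deriv: "\<And>x. (f has_real_derivative f' x) (at x)"
  shows "\<exists>B. finite B \<and> card B = k \<and> B \<inter> A = {} \<and> (\<forall>b\<in>B. f' b = 0 \<and> Min A < b \<and> b < Max A)"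
  using assms(1-3)
proof (induction k arbitrary: A)
  case 0
  then show ?case by (intro exI[of _ "{}"]) auto
next
  case (Suc k)
  define M where "M = Max A"
  define A' where "A' = A - {M}"
  have "A \<noteq> {}" using Suc.prems by auto
  then have "M \<in> A" using Suc.prems by (simp add: M_def)
  have A'0: "finite A'" "card A' = Suc k"
    using Suc.prems \<open>M \<in> A\<close> by (auto simp: A'_def)
  then have A': "finite A'" "card A' = Suc k" "A' \<noteq> {}"
    by auto
  obtain B where B: "finite B" "card B = k" "B \<inter> A' = {}"
    "\<forall>b\<in>B. f' b = 0 \<and> Min A' < b \<and> b < Max A'"
    using Suc.IH[OF A'(1,2)] Suc.prems(3) by (auto simp: A'_def)
  have "Max A' \<in> A'" using A' by simp
  then have mm: "Max A' < M"
    using Suc.prems(1) by (auto simp: A'_def M_def order.strict_iff_order)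
  have mi: "Min A \<le> Min A'"
    using A' Suc.prems(1) by (intro Min_antimono) (auto simp: A'_def)
  have "f (Max A') = f M"
    using \<open>Max A' \<in> A'\<close> \<open>M \<in> A\<close> Suc.prems(3) by (simp add: A'_def)
  moreover have "continuous_on {Max A'..M} f"
    by (intro continuous_at_imp_continuous_on ballI DERIV_isCont[OF deriv])
  ultimately obtain z where z: "Max A' < z" "z < M" "DERIV f z :> 0"
    using Rolle[OF mm, of f] deriv real_differentiable_def by blast
  have z0: "f' z = 0"
    using DERIV_unique[OF deriv z(3)] .
  have "z \<notin> A'"
    using z(1) Max_ge[OF A'(1), of z] by auto
  then have zB: "z \<notin> B" "z \<notin> A"
    using B(4) z(1,2) by (auto simp: A'_def)
  have "M \<notin> B"
    using B(4) mm by force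
  have "Min A' \<le> Max A'" using A' by simp
  show ?case
  proof (intro exI[of _ "insert z B"] conjI)
    show "card (insert z B) = Suc k" using B zB by simp
    show "insert z B \<inter> A = {}"
      using B(3) zB \<open>M \<notin> B\<close> by (auto simp: A'_def)
    show "\<forall>b\<in>insert z B. f' b = 0 \<and> Min A < b \<and> b < Max A"
      using B(4) z z0 mm mi \<open>Min A' \<le> Max A'\<close> unfolding M_def[symmetric] by fastforce
  qed (use B in auto)
qed

lemma iterated_rolle:
  fixes D :: "nat \<Rightarrow> real \<Rightarrow> real"
  assumes "finite A" "card A = Suc k" "\<And>a. a \<in> A \<Longrightarrow> D j a = 0"
    and "\<And>i x. j \<le> i \<Longrightarrow> i < j + k \<Longrightarrow> (D i has_real_derivative D (Suc i) x) (at x)"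
  shows "\<exists>z. D (j + k) z = 0"
  using assms
proof (induction k arbitrary: j A)
  case 0
  then obtain a where "a \<in> A"
    by (metis card.empty ex_in_conv nat.distinct(1))
  then have "D j a = 0"
    by (rule 0(3))
  then show ?case by auto
next
  case (Suc k)
  obtain B where B: "finite B" "card B = Suc k" "\<forall>b\<in>B. D (Suc j) b = 0"
    using rolle_many[OF Suc.prems(1,2,3) Suc.prems(4)] by auto
  have "\<exists>z. D (Suc j + k) z = 0"
  proof (rule Suc.IH[OF B(1,2)])
    show "D (Suc j) b = 0" if "b \<in> B" for b
      using B(3) that by blast
    show "(D i has_real_derivative D (Suc i) x) (at x)" if "Suc j \<le> i" "i < Suc j + k" for i x
      using that by (intro Suc.prems(4)) auto
  qed
  then show ?case by simp
qed

text \<open>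
  The derivative vanishes at the \<open>n\<close> double zeros and, by Rolle, at \<open>n\<close> further points between the
  \<open>n + 1\<close> zeros; these \<open>2 n\<close> zeros leave one for the derivative of order \<open>2 n\<close>.
\<close>
lemma rolle_double_zeros:
  fixes D :: "nat \<Rightarrow> real \<Rightarrow> real"
  assumes "finite Z" "s \<notin> Z" "D 0 s = 0" "\<And>z. z \<in> Z \<Longrightarrow> D 0 z = 0"
    and "\<And>z. z \<in> Z \<Longrightarrow> D 1 z = 0"
    and "\<And>i x. i < 2 * card Z \<Longrightarrow> (D i has_real_derivative D (Suc i) x) (at x)"
  shows "\<exists>t. D (2 * card Z) t = 0"
proof (cases "Z = {}")
  case True
  then show ?thesis using assms(3) by auto
next
  case False
  then obtain k where k: "card Z = Suc k"
    using assms(1) by (metis card_eq_0_iff not0_implies_Suc)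
  have ins: "card (insert s Z) = Suc (Suc k)"
    using assms k by simp
  have zero: "D 0 a = 0" if "a \<in> insert s Z" for a
    using that assms(3,4) by blast
  have deriv: "(D 0 has_real_derivative D 1 x) (at x)" for x
    using assms(6)[of 0] k by simp
  obtain B where B: "finite B" "card B = Suc k" "B \<inter> insert s Z = {}" "\<forall>b\<in>B. D 1 b = 0"
    using rolle_many[OF _ ins zero deriv] assms(1) by auto
  have "card (B \<union> Z) = Suc (2 * k + 1)"
    using B assms(1) k by (subst card_Un_disjoint) auto
  moreover have "D 1 a = 0" if "a \<in> B \<union> Z" for a
    using that B(4) assms(5) by blast
  moreover have "(D i has_real_derivative D (Suc i) x) (at x)" if "i < 1 + (2 * k + 1)" for i x
    using that k by (intro assms(6)) simp
  ultimately have "\<exists>t. D (1 + (2 * k + 1)) t = 0"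
    using B(1) assms(1) by (intro iterated_rolle[of "B \<union> Z"]) blast+
  then show ?thesis by (simp add: k)
qed

definition node_square :: "real set \<Rightarrow> real poly" where
  "node_square Z = (\<Prod>z\<in>Z. [:- z, 1:]) * (\<Prod>z\<in>Z. [:- z, 1:])"

lemma node_square:
  assumes Z: "finite Z"
  shows degree_node_square: "degree (node_square Z) = 2 * card Z"
    and coeff_node_square: "coeff (node_square Z) (2 * card Z) = 1"
    and node_square_double_root: "z \<in> Z \<Longrightarrow> poly (node_square Z) z = 0"
      "z \<in> Z \<Longrightarrow> poly (pderiv (node_square Z)) z = 0"
    and node_square_pos: "s \<notin> Z \<Longrightarrow> poly (node_square Z) s > 0"
proof -
  define r where "r = (\<Prod>z\<in>Z. [:- z, 1:])"
  have q: "node_square Z = r * r"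
    by (simp add: node_square_def r_def)
  have "degree r = (\<Sum>z\<in>Z. degree [:- z, 1:])"
    unfolding r_def by (rule degree_prod_eq_sum_degree) auto
  then have degr: "degree r = card Z"
    by simp
  have "r \<noteq> 0"
    using Z by (simp add: r_def)
  then show deg: "degree (node_square Z) = 2 * card Z"
    by (simp add: q degree_mult_eq degr)
  have "lead_coeff r = 1"
    by (simp add: r_def lead_coeff_prod)
  then have "lead_coeff (node_square Z) = 1"
    by (simp add: q lead_coeff_mult)
  then show "coeff (node_square Z) (2 * card Z) = 1"
    by (simp add: deg)
  have rz: "poly r z = 0" if "z \<in> Z" for z
    using that Z by (auto simp: r_def poly_prod)
  show "z \<in> Z \<Longrightarrow> poly (node_square Z) z = 0" "z \<in> Z \<Longrightarrow> poly (pderiv (node_square Z)) z = 0"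
    using rz by (auto simp: q pderiv_mult)
  assume "s \<notin> Z"
  then have "poly r s \<noteq> 0"
    using Z by (auto simp: r_def poly_prod)
  then show "poly (node_square Z) s > 0"
    by (simp add: q zero_less_mult_iff linorder_neq_iff) auto
qed

text \<open>
  As in Newton interpolation, a new node is added by a correction that is a multiple of the polynomial
  with double zeros at the old nodes.
\<close>
lemma hermite_interpolation_exists:
  fixes Z :: "real set"
  assumes "finite Z"
  shows "\<exists>p. (\<forall>i\<ge>2 * card Z. coeff p i = 0) \<and> (\<forall>z\<in>Z. poly p z = a z \<and> poly (pderiv p) z = b z)"
  using assms
proof (induction Z rule: finite_induct)
  case empty
  then show ?case by (intro exI[of _ 0]) simp
next
  case (insert w Z)
  then obtain p where p: "\<forall>i\<ge>2 * card Z. coeff p i = 0"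
    "\<forall>z\<in>Z. poly p z = a z \<and> poly (pderiv p) z = b z" by blast
  define q where "q = node_square Z"
  note q = node_square[OF insert.hyps(1), folded q_def]
  have degq: "degree q = 2 * card Z"
    by (rule q(1))
  have qw: "poly q w \<noteq> 0"
    using q(5)[OF insert.hyps(2)] by simp
  define u where "u = (a w - poly p w) / poly q w"
  define v where "v = (b w - poly (pderiv p) w - u * poly (pderiv q) w) / poly q w"
  define l where "l = [:u - v * w, v:]"
  have l: "degree l \<le> 1" "poly l w = u" "pderiv l = [:v:]"
    by (auto simp: l_def pderiv_pCons)
  define P where "P = p + l * q"
  have "coeff P i = 0" if "i \<ge> 2 * card (insert w Z)" for i
  proof -
    have "degree (l * q) \<le> 1 + 2 * card Z"
      using degree_mult_le[of l q] degq l(1) by linarith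
    then show ?thesis
      using that insert.hyps p(1) by (simp add: P_def coeff_eq_0)
  qed
  moreover have "poly P w = a w"
    using qw by (simp add: P_def l u_def)
  moreover have "poly (pderiv P) w = b w"
    using qw by (simp add: P_def pderiv_add pderiv_mult l v_def)
  moreover have "poly P z = a z \<and> poly (pderiv P) z = b z" if "z \<in> Z" for z
    using p(2) q(3,4)[OF that] that by (simp add: P_def pderiv_add pderiv_mult)
  ultimately show ?case
    by (intro exI[of _ P]) auto
qed

section \<open>The periodized function in the cotangent variable\<close>

text \<open>
  The inverse of \<open>x \<mapsto> cot (\<pi> x)\<close> on the interval from 0 to 1.
\<close>
definition angle :: "real \<Rightarrow> real" where
  "angle s = 1 / 2 - arctan s / pi"

lemma angle_bounds: "0 < angle s" "angle s < 1"
  using arctan_ubound[of s] arctan_lbound[of s] by (auto simp: angle_def field_simps)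

lemma pi_angle: "pi * angle s = pi / 2 - arctan s"
  by (simp add: angle_def field_simps)

lemma cos_angle: "cos (pi * angle s) = s * sin (pi * angle s)"
proof -
  have "tan (arctan s) = s" by (rule tan_arctan)
  then show ?thesis
    unfolding pi_angle by (simp add: cos_diff sin_diff tan_def divide_eq_eq)
qed

lemma sin_angle_square: "(sin (pi * angle s))\<^sup>2 * (1 + s\<^sup>2) = 1"
  using sin_cos_squared_add[of "pi * angle s"]
  by (simp add: cos_angle power_mult_distrib algebra_simps)

lemma sin_angle_power: "sin (pi * angle s) ^ (2 * N) * (1 + s\<^sup>2) ^ N = 1"
  by (simp only: power_mult power_mult_distrib[symmetric] sin_angle_square power_one)

lemma angle_cot:
  assumes "0 < x" "x < 1"
  shows "angle (cot (pi * x)) = x"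
proof -
  have "cot (pi * x) = tan (pi / 2 - pi * x)"
    using tan_cot[of "pi * x"] by (simp add: cot_altdef)
  moreover have "arctan (tan (pi / 2 - pi * x)) = pi / 2 - pi * x"
    using assms by (intro arctan_tan) (auto simp: field_simps)
  ultimately show ?thesis
    by (simp add: angle_def field_simps)
qed

lemma DERIV_angle: "(angle has_real_derivative - 1 / (pi * (1 + s\<^sup>2))) (at s)"
proof -
  have "(angle has_real_derivative 0 - inverse (1 + s\<^sup>2) / pi) (at s)"
    unfolding angle_def[abs_def] by (rule derivative_eq_intros refl | simp)+
  then show ?thesis
    by (simp add: inverse_eq_divide mult.commute)
qed

text \<open>
  This is the rule for differentiating \<open>\<integral> (s - \<sigma>) ^ (n + 1) w(\<sigma>) d\<sigma>\<close>, taken over \<open>\<sigma> \<le> s\<close> and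
  expanded by the binomial theorem, so that only the moments \<open>W j\<close> are integrals.
\<close>
lemma truncated_binomial_deriv:
  fixes W :: "nat \<Rightarrow> real \<Rightarrow> real"
  assumes W: "\<And>j. j \<le> Suc n \<Longrightarrow> (W j has_real_derivative (- s) ^ j * w) (at s)"
  shows "((\<lambda>t. \<Sum>i\<le>Suc n. of_nat (Suc n choose i) * t ^ i * W (Suc n - i) t) has_real_derivative
    of_nat (Suc n) * (\<Sum>i\<le>n. of_nat (n choose i) * s ^ i * W (n - i) s)) (at s)"
proof -
  have "((\<lambda>t. \<Sum>i\<le>Suc n. of_nat (Suc n choose i) * t ^ i * W (Suc n - i) t) has_real_derivative
      (\<Sum>i\<le>Suc n. of_nat (Suc n choose i) * (of_nat i * s ^ (i - 1)) * W (Suc n - i) s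
        + of_nat (Suc n choose i) * s ^ i * ((- s) ^ (Suc n - i) * w))) (at s)"
  proof (intro DERIV_sum)
    fix i assume "i \<in> {..Suc n}"
    show "((\<lambda>t. of_nat (Suc n choose i) * t ^ i * W (Suc n - i) t) has_real_derivative
      of_nat (Suc n choose i) * (of_nat i * s ^ (i - 1)) * W (Suc n - i) s
        + of_nat (Suc n choose i) * s ^ i * ((- s) ^ (Suc n - i) * w)) (at s)"
      by (rule derivative_eq_intros W refl diff_le_self)+ (simp add: algebra_simps)
  qed
  moreover have "(\<Sum>i\<le>Suc n. of_nat (Suc n choose i) * s ^ i * ((- s) ^ (Suc n - i) * w))
      = (s + (- s)) ^ Suc n * w"
    by (simp only: binomial_ring sum_distrib_right mult.assoc)
  moreover have "(\<Sum>i\<le>Suc n. of_nat (Suc n choose i) * (of_nat i * s ^ (i - 1)) * W (Suc n - i) s)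
      = (\<Sum>i\<le>n. of_nat (Suc n choose Suc i) * (of_nat (Suc i) * s ^ i) * W (n - i) s)"
    by (subst sum.atMost_Suc_shift) simp
  moreover have "\<dots> = of_nat (Suc n) * (\<Sum>i\<le>n. of_nat (n choose i) * s ^ i * W (n - i) s)"
    unfolding sum_distrib_left
  proof (rule sum.cong[OF refl])
    fix i
    have "real (Suc i) * real (Suc n choose Suc i) = real (Suc n) * real (n choose i)"
      by (metis Suc_times_binomial of_nat_mult)
    moreover have "real (Suc n choose Suc i) * (real (Suc i) * s ^ i) * W (n - i) s
        = (real (Suc i) * real (Suc n choose Suc i)) * (s ^ i * W (n - i) s)"
      by (simp only: mult_ac)
    ultimately show "real (Suc n choose Suc i) * (real (Suc i) * s ^ i) * W (n - i) s
        = real (Suc n) * (real (n choose i) * s ^ i * W (n - i) s)"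
      by (simp only: mult.assoc)
  qed
  ultimately show ?thesis
    by (simp only: sum.distrib) simp
qed

lemma DERIV_integral_lower:
  fixes h :: "real \<Rightarrow> real"
  assumes h: "continuous_on UNIV h" and x: "0 < x" "x < 1"
  shows "((\<lambda>x. integral {x..1} h) has_real_derivative - h x) (at x)"
proof -
  have int: "h integrable_on {a..b}" for a b
    by (intro integrable_continuous_interval continuous_on_subset[OF h]) auto
  have "((\<lambda>x. integral {0..x} h) has_real_derivative h x) (at x within {0..1})"
    using x by (intro integral_has_real_derivative continuous_on_subset[OF h]) auto
  then have "((\<lambda>x. integral {0..x} h) has_real_derivative h x) (at x within {0<..<1})"
    by (rule DERIV_subset) auto
  then have "((\<lambda>x. integral {0..x} h) has_real_derivative h x) (at x)"
    using x at_within_open[of x "{0<..<1}"] by simp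
  then have "((\<lambda>x. integral {0..1} h - integral {0..x} h) has_real_derivative - h x) (at x)"
    by (auto intro!: derivative_eq_intros)
  then show ?thesis
  proof (rule has_field_derivative_transform_within_open[of _ _ _ "{0<..<1}"])
    fix y :: real assume "y \<in> {0<..<1}"
    then show "integral {0..1} h - integral {0..y} h = integral {y..1} h"
      using Henstock_Kurzweil_Integration.integral_combine[of 0 y 1 h] int by simp
  qed (use x in auto)
qed

text \<open>
  For \<open>l > 0\<close> and \<open>0 < x \<le> 1\<close> this is \<open>\<Sum>j. (x + j) exp (- l (x + j))\<close>, the periodization of
  \<open>trunc_v l\<close>; see \<open>periodic_v_has_sum\<close>.  The closed form also makes sense for negative \<open>l\<close>, where it
  describes the reflected function.
\<close>
definition periodic_v :: "real \<Rightarrow> real \<Rightarrow> real" where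
  "periodic_v l x = exp (- l * x) * (x / (1 - exp (- l)) + exp (- l) / (1 - exp (- l))\<^sup>2)"

definition pinned_v :: "real \<Rightarrow> real \<Rightarrow> real" where
  "pinned_v l x = periodic_v l x - periodic_v l 1"

text \<open>
  The integral of \<open>sin (\<pi> (y - x)) ^ (2 N) g(y)\<close> over a full period starting at \<open>x\<close> is folded
  back to the unit interval.  The last integral is a trigonometric polynomial in \<open>x\<close>, so modulo such
  polynomials only the integral over \<open>[x, 1]\<close> remains.
\<close>
lemma sin_convolution:
  fixes g :: "real \<Rightarrow> real"
  assumes g: "continuous_on UNIV g" and x: "0 \<le> x" "x \<le> 1"
  shows "integral {0..1} (\<lambda>t. sin (pi * t) ^ (2 * N) * g (t + x))
    = integral {x..1} (\<lambda>y. (g y - g (y + 1)) * sin (pi * (y - x)) ^ (2 * N))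
      + integral {0..1} (\<lambda>y. g (y + 1) * sin (pi * (y - x)) ^ (2 * N))"
proof -
  let ?S = "\<lambda>y. sin (pi * (y - x)) ^ (2 * N)"
  have g': "continuous_on A (\<lambda>y. g (f y))" if "continuous_on A f" for A f
    using continuous_on_compose2[OF g that] by auto
  have int: "(\<lambda>y. g (y + c) * ?S y) integrable_on {a..b}" for a b c
    by (intro integrable_continuous_interval continuous_intros g')
  have "integral {0..1} (\<lambda>t. sin (pi * t) ^ (2 * N) * g (t + x))
      = integral {0..1} ((\<lambda>y. g y * ?S y) \<circ> (\<lambda>t. t + x))"
    by (simp add: o_def mult.commute)
  also have "\<dots> = integral {x..1 + x} (\<lambda>y. g y * ?S y)"
    using integral_shift[of 0 x 1 "\<lambda>y. g y * ?S y"]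
    by (simp add: continuous_intros g')
  also have "\<dots> = integral {x..1} (\<lambda>y. g y * ?S y) + integral {1..1 + x} (\<lambda>y. g y * ?S y)"
    using Henstock_Kurzweil_Integration.integral_combine[of x 1 "1 + x" "\<lambda>y. g y * ?S y"] int[of 0] x
    by simp
  also have "integral {1..1 + x} (\<lambda>y. g y * ?S y)
      = integral {0..x} ((\<lambda>y. g y * ?S y) \<circ> (\<lambda>t. t + 1))"
    using integral_shift[of 0 1 x "\<lambda>y. g y * ?S y"]
    by (simp add: continuous_intros g' add.commute)
  also have "\<dots> = integral {0..x} (\<lambda>y. g (y + 1) * ?S y)"
  proof -
    have "sin (pi * (y + 1 - x)) ^ (2 * N) = ?S y" for y
    proof -
      have "pi * (y + 1 - x) = pi * (y - x) + pi"
        by (simp add: algebra_simps)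
      then have "sin (pi * (y + 1 - x)) = - sin (pi * (y - x))"
        by (simp only: sin_periodic_pi)
      then show ?thesis
        by (simp add: power_mult)
    qed
    then show ?thesis by (simp add: o_def)
  qed
  also have "\<dots> = integral {0..1} (\<lambda>y. g (y + 1) * ?S y) - integral {x..1} (\<lambda>y. g (y + 1) * ?S y)"
    using Henstock_Kurzweil_Integration.integral_combine[of 0 x 1 "\<lambda>y. g (y + 1) * ?S y"] int[of 1] x
    by simp
  also have "integral {x..1} (\<lambda>y. g y * ?S y)
      + (integral {0..1} (\<lambda>y. g (y + 1) * ?S y) - integral {x..1} (\<lambda>y. g (y + 1) * ?S y))
      = integral {x..1} (\<lambda>y. g y * ?S y - g (y + 1) * ?S y) + integral {0..1} (\<lambda>y. g (y + 1) * ?S y)"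
    using int[of 0] int[of 1] by (subst Henstock_Kurzweil_Integration.integral_diff) auto
  finally show ?thesis
    by (simp add: left_diff_distrib)
qed

text \<open>
  In the variable \<open>s = cot (\<pi> x)\<close> one has \<open>sin (\<pi> (y - x)) = sin (\<pi> x) (s sin (\<pi> y) - cos (\<pi> y))\<close>, so
  multiplication with \<open>(1 + s\<^sup>2) ^ N = sin (\<pi> x) ^ (- 2 N)\<close> produces a power of a linear function of
  \<open>s\<close>.
\<close>
lemma binomial_sin_integral:
  fixes h :: "real \<Rightarrow> real"
  assumes h: "continuous_on UNIV h"
  shows "(1 + s\<^sup>2) ^ N * integral {a..b} (\<lambda>y. h y * sin (pi * (y - angle s)) ^ (2 * N))
    = (\<Sum>i\<le>2 * N. of_nat (2 * N choose i) * s ^ i *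
        integral {a..b} (\<lambda>y. h y * ((- cos (pi * y)) ^ (2 * N - i) * sin (pi * y) ^ (2 * N - (2 * N - i)))))"
proof -
  let ?f = "\<lambda>i y. h y * ((- cos (pi * y)) ^ (2 * N - i) * sin (pi * y) ^ (2 * N - (2 * N - i)))"
  have pointwise: "(1 + s\<^sup>2) ^ N * (h y * sin (pi * (y - angle s)) ^ (2 * N))
      = (\<Sum>i\<le>2 * N. of_nat (2 * N choose i) * s ^ i * ?f i y)" for y
  proof -
    have "sin (pi * (y - angle s)) = sin (pi * angle s) * (s * sin (pi * y) + - cos (pi * y))"
      by (simp add: right_diff_distrib sin_diff cos_angle algebra_simps)
    then have "(1 + s\<^sup>2) ^ N * sin (pi * (y - angle s)) ^ (2 * N)
        = (sin (pi * angle s) ^ (2 * N) * (1 + s\<^sup>2) ^ N) * (s * sin (pi * y) + - cos (pi * y)) ^ (2 * N)"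
      by (simp only: power_mult_distrib mult_ac)
    also have "\<dots> = (\<Sum>i\<le>2 * N. of_nat (2 * N choose i) * (s * sin (pi * y)) ^ i * (- cos (pi * y)) ^ (2 * N - i))"
      unfolding sin_angle_power mult_1_left by (rule binomial_ring)
    finally have "(1 + s\<^sup>2) ^ N * (h y * sin (pi * (y - angle s)) ^ (2 * N))
        = h y * (\<Sum>i\<le>2 * N. of_nat (2 * N choose i) * (s * sin (pi * y)) ^ i * (- cos (pi * y)) ^ (2 * N - i))"
      by (simp only: mult_ac)
    also have "\<dots> = (\<Sum>i\<le>2 * N. of_nat (2 * N choose i) * s ^ i * ?f i y)"
      unfolding sum_distrib_left
      by (intro sum.cong refl) (simp add: power_mult_distrib)
    finally show ?thesis .
  qed
  have int: "?f i integrable_on {a..b}" for i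
    by (intro integrable_continuous_interval continuous_intros continuous_on_subset[OF h]) auto
  have "(1 + s\<^sup>2) ^ N * integral {a..b} (\<lambda>y. h y * sin (pi * (y - angle s)) ^ (2 * N))
      = integral {a..b} (\<lambda>y. \<Sum>i\<le>2 * N. of_nat (2 * N choose i) * s ^ i * ?f i y)"
    by (simp only: integral_mult_right[symmetric] pointwise)
  also have "\<dots> = (\<Sum>i\<le>2 * N. integral {a..b} (\<lambda>y. of_nat (2 * N choose i) * s ^ i * ?f i y))"
    by (intro Henstock_Kurzweil_Integration.integral_sum integrable_on_mult_right int) auto
  finally show ?thesis
    by (simp only: integral_mult_right)
qed

lemma coeff_quadratic_power:
  "coeff ([:1, 0, 1:] ^ N :: real poly) (2 * N) = 1" "i > 2 * N \<Longrightarrow> coeff ([:1, 0, 1:] ^ N :: real poly) i = 0"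
proof -
  have deg: "degree ([:1, 0, 1:] ^ N :: real poly) = 2 * N"
    by (simp add: degree_power_eq)
  have "lead_coeff ([:1, 0, 1:] ^ N :: real poly) = 1"
    by (simp add: lead_coeff_power)
  then show "coeff ([:1, 0, 1:] ^ N :: real poly) (2 * N) = 1"
    unfolding deg .
  show "i > 2 * N \<Longrightarrow> coeff ([:1, 0, 1:] ^ N :: real poly) i = 0"
    by (simp add: coeff_eq_0 deg)
qed

text \<open>
  The kernel \<open>g\<close> is chosen so that its convolution with \<open>sin (\<pi> t) ^ (2 N)\<close> is the periodized
  function.  Then \<open>D 0\<close> is a polynomial \<open>Q\<close> plus \<open>T\<close>, a truncated integral of \<open>(s - \<sigma>) ^ (2 N)\<close> against
  a density.  Subtracting the value at 1 removes the coefficient of \<open>s ^ (2 N)\<close> from \<open>Q\<close>, so \<open>Q\<close> does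
  not contribute to the derivative of order \<open>2 N\<close>, and the truncated integral contributes \<open>(2 N)!\<close>
  times a tail integral of the density.  The density has total mass 0 and is first negative, then
  positive, so its tails are nonnegative.
\<close>
lemma rational_lift_derivative_nonneg:
  assumes l: "l \<noteq> 0"
  shows "\<exists>D. (\<forall>s. D 0 s = (1 + s\<^sup>2) ^ N * pinned_v l (angle s)) \<and>
    (\<forall>k<2 * N. \<forall>s. (D k has_real_derivative D (Suc k) s) (at s)) \<and> (\<forall>s. 0 \<le> D (2 * N) s)"
proof -
  define q where "q = exp (- l)"
  have q: "1 - q \<noteq> 0" "q > 0"
    using l by (auto simp: q_def)
  let ?S = "\<lambda>t. sin (pi * t) ^ (2 * N)"
  have S: "?S t \<ge> 0" for t
    by (simp add: power_mult)
  define c where "c = integral {0..1} (\<lambda>t. exp (- l * t) * ?S t)"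
  define c1 where "c1 = integral {0..1} (\<lambda>t. t * exp (- l * t) * ?S t)"
  define m where "m = c1 / c"
  have "c \<noteq> 0"
  proof
    assume "c = 0"
    then have "\<forall>t\<in>{0..1}. exp (- l * t) * ?S t = 0"
      unfolding c_def using S by (subst (asm) integral_eq_0_iff) (auto intro!: continuous_intros)
    then have "exp (- l * (1 / 2)) * ?S (1 / 2) = 0"
      by (rule bspec) simp
    then show False by simp
  qed
  moreover have "c \<ge> 0"
    unfolding c_def using S
    by (intro Henstock_Kurzweil_Integration.integral_nonneg integrable_continuous_interval
      continuous_intros) simp
  ultimately have c: "c > 0" by simp
  \<comment> \<open>The two coefficients of \<open>g\<close> are determined by the requirement \<open>conv\<close> below.\<close>
  define \<alpha> where "\<alpha> = 1 / (c * (1 - q))"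
  define \<beta> where "\<beta> = (q / (1 - q)\<^sup>2 - \<alpha> * c1) / c"
  define g where "g y = exp (- l * y) * (\<alpha> * y + \<beta>)" for y
  define r where "r y = exp (- l * y) * (y - m) / c" for y
  have g_cont: "continuous_on UNIV g" and r_cont: "continuous_on UNIV r"
    unfolding g_def[abs_def] r_def[abs_def] using c by (auto intro!: continuous_intros)
  have g1_cont: "continuous_on UNIV (\<lambda>y. g (y + 1))"
    unfolding g_def by (intro continuous_intros)
  have gr: "g y - g (y + 1) = r y" for y
  proof -
    have "exp (- l * (y + 1)) = exp (- l * y) * q"
      by (simp add: q_def exp_add[symmetric] algebra_simps)
    then have "g y - g (y + 1) = exp (- l * y) * (\<alpha> * (1 - q) * y + (\<beta> * (1 - q) - q * \<alpha>))"
      by (simp add: g_def algebra_simps)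
    moreover have "\<alpha> * (1 - q) = 1 / c"
      using q by (simp add: \<alpha>_def)
    moreover have "\<beta> * (1 - q) - q * \<alpha> = - m / c"
      using q c by (simp add: \<alpha>_def \<beta>_def m_def power2_eq_square divide_simps)
    ultimately have "g y - g (y + 1) = exp (- l * y) * (1 / c * y + - m / c)"
      by (simp only:)
    then show ?thesis
      by (simp add: r_def diff_divide_distrib[symmetric])
  qed
  have conv: "integral {0..1} (\<lambda>t. ?S t * g (t + x)) = periodic_v l x" for x
  proof -
    have i: "(\<lambda>t. t * exp (- l * t) * ?S t) integrable_on {0..1}"
      "(\<lambda>t. exp (- l * t) * ?S t) integrable_on {0..1}"
      by (intro integrable_continuous_interval continuous_intros)+
    have "?S t * g (t + x) = exp (- l * x) * (\<alpha> * (t * exp (- l * t) * ?S t)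
        + (\<alpha> * x + \<beta>) * (exp (- l * t) * ?S t))" for t
    proof -
      have "exp (- l * (t + x)) = exp (- l * t) * exp (- l * x)"
        by (simp add: exp_add[symmetric] algebra_simps)
      then show ?thesis
        by (simp add: g_def algebra_simps)
    qed
    then have "integral {0..1} (\<lambda>t. ?S t * g (t + x))
        = exp (- l * x) * (\<alpha> * c1 + (\<alpha> * x + \<beta>) * c)"
      using i by (simp add: c_def c1_def Henstock_Kurzweil_Integration.integral_add integrable_on_mult_right
          del: mult_minus_left)
    also have "\<alpha> * c1 + (\<alpha> * x + \<beta>) * c = x / (1 - q) + q / (1 - q)\<^sup>2"
    proof -
      have "\<beta> * c = q / (1 - q)\<^sup>2 - \<alpha> * c1"
        using c by (simp add: \<beta>_def)
      moreover have "\<alpha> * c = 1 / (1 - q)"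
        using c by (simp add: \<alpha>_def)
      then have "\<alpha> * x * c = x / (1 - q)"
        by (metis mult.commute mult.left_commute mult_1_right times_divide_eq_right)
      ultimately show ?thesis
        by (simp add: distrib_right)
    qed
    finally show ?thesis
      by (simp add: periodic_v_def q_def)
  qed
  \<comment> \<open>Moments in the binomial expansion: the \<open>V\<close> over the unit interval are constants and go into the
    polynomial \<open>Q\<close>, the \<open>W\<close> over \<open>[x, 1]\<close> depend on \<open>s\<close>.\<close>
  define V where "V j = integral {0..1} (\<lambda>y. g (y + 1) * ((- cos (pi * y)) ^ j * sin (pi * y) ^ (2 * N - j)))" for j
  define w where "w j y = r y * ((- cos (pi * y)) ^ j * sin (pi * y) ^ (2 * N - j))" for j y
  define W where "W j s = integral {angle s..1} (w j)" for j s
  define Q where "Q = (\<Sum>i\<le>2 * N. monom (of_nat (2 * N choose i) * V (2 * N - i)) i) - smult (periodic_v l 1) ([:1, 0, 1:] ^ N)"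
  have Q_high: "coeff Q i = 0" if "i \<ge> 2 * N" for i
  proof (cases "i = 2 * N")
    case True
    have "integral {0..1} (\<lambda>t. ?S t * g (t + 1)) = V 0"
      by (simp add: V_def mult.commute)
    then have "V 0 = periodic_v l 1"
      using conv[of 1] by simp
    then show ?thesis
      by (simp add: True Q_def coeff_sum coeff_quadratic_power)
  next
    case False
    with that have "i > 2 * N" by simp
    then show ?thesis
      by (simp add: Q_def coeff_sum coeff_quadratic_power)
  qed
  have Q_deriv: "((\<lambda>s. poly ((pderiv ^^ k) Q) s) has_real_derivative poly ((pderiv ^^ Suc k) Q) s) (at s)" for k s
    by (simp add: poly_DERIV)
  have Q_top: "(pderiv ^^ (2 * N)) Q = 0"
    using Q_high by (simp add: poly_eq_iff coeff_higher_pderiv)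
  have poly_Q: "poly Q s = (\<Sum>i\<le>2 * N. of_nat (2 * N choose i) * s ^ i * V (2 * N - i)) - periodic_v l 1 * (1 + s\<^sup>2) ^ N" for s
    by (simp add: Q_def poly_sum poly_monom poly_power power2_eq_square mult_ac)
  have w_cont: "continuous_on UNIV (w j)" for j
    unfolding w_def[abs_def] by (intro continuous_intros r_cont)
  have W_deriv: "(W j has_real_derivative (- s) ^ j * (r (angle s) * ?S (angle s) / (pi * (1 + s\<^sup>2)))) (at s)"
    if "j \<le> 2 * N" for j s
  proof -
    have "(W j has_real_derivative (- w j (angle s)) * (- 1 / (pi * (1 + s\<^sup>2)))) (at s)"
      unfolding W_def[abs_def]
      by (rule DERIV_chain2[OF DERIV_integral_lower[OF w_cont] DERIV_angle]) (rule angle_bounds)+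
    moreover have "w j (angle s) = (- s) ^ j * (r (angle s) * ?S (angle s))"
    proof -
      have "- cos (pi * angle s) = (- s) * sin (pi * angle s)"
        by (simp add: cos_angle)
      then have "(- cos (pi * angle s)) ^ j * sin (pi * angle s) ^ (2 * N - j)
          = (- s) ^ j * (sin (pi * angle s) ^ j * sin (pi * angle s) ^ (2 * N - j))"
        by (simp only: power_mult_distrib mult.assoc)
      also have "\<dots> = (- s) ^ j * ?S (angle s)"
        using that by (simp add: power_add[symmetric])
      finally show ?thesis by (simp add: w_def mult_ac)
    qed
    ultimately show ?thesis by simp
  qed
  define T where "T n s = (\<Sum>i\<le>n. of_nat (n choose i) * s ^ i * W (n - i) s)" for n s
  have T_deriv: "(T (Suc n) has_real_derivative of_nat (Suc n) * T n s) (at s)" if "Suc n \<le> 2 * N" for n s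
    unfolding T_def[abs_def] using that by (intro truncated_binomial_deriv[OF W_deriv]) simp
  define D where "D k s = poly ((pderiv ^^ k) Q) s + fact (2 * N) / fact (2 * N - k) * T (2 * N - k) s" for k s
  have "D 0 s = (1 + s\<^sup>2) ^ N * pinned_v l (angle s)" for s
  proof -
    let ?x = "angle s"
    have x: "0 \<le> ?x" "?x \<le> 1" using angle_bounds[of s] by auto
    have "periodic_v l ?x = integral {?x..1} (\<lambda>y. r y * sin (pi * (y - ?x)) ^ (2 * N))
        + integral {0..1} (\<lambda>y. g (y + 1) * sin (pi * (y - ?x)) ^ (2 * N))"
      using sin_convolution[OF g_cont x, of N] by (simp only: conv gr)
    then have "(1 + s\<^sup>2) ^ N * periodic_v l ?x = (\<Sum>i\<le>2 * N. of_nat (2 * N choose i) * s ^ i * W (2 * N - i) s)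
        + (\<Sum>i\<le>2 * N. of_nat (2 * N choose i) * s ^ i * V (2 * N - i))"
      unfolding W_def V_def w_def by (simp only: distrib_left binomial_sin_integral[OF r_cont] binomial_sin_integral[OF g1_cont])
    then show ?thesis
      by (simp add: D_def poly_Q T_def pinned_v_def algebra_simps)
  qed
  moreover have "(D k has_real_derivative D (Suc k) s) (at s)" if k: "k < 2 * N" for k s
  proof -
    obtain n where n: "2 * N - k = Suc n" "2 * N - Suc k = n"
      using k by (metis Suc_diff_Suc)
    have nz: "Suc n \<le> 2 * N" using n by linarith
    have "(D k has_real_derivative poly ((pderiv ^^ Suc k) Q) s + fact (2 * N) / fact (Suc n) * (of_nat (Suc n) * T n s)) (at s)"
      unfolding D_def[abs_def] n
      by (intro DERIV_add Q_deriv DERIV_cmult T_deriv nz)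
    moreover have "fact (2 * N) / fact (Suc n) * (real (Suc n) * T n s) = fact (2 * N) / fact n * T n s"
      unfolding fact_Suc by (simp del: of_nat_Suc)
    ultimately show ?thesis
      by (simp only: D_def n)
  qed
  moreover have "0 \<le> D (2 * N) s" for s
  proof -
    have w0: "w 0 y = r y * ?S y" for y
      by (simp add: w_def)
    have int: "w 0 integrable_on {a..b}" for a b
      by (intro integrable_continuous_interval continuous_on_subset[OF w_cont]) auto
    have total: "integral {0..1} (w 0) = 0"
    proof -
      have i: "(\<lambda>t. t * exp (- l * t) * ?S t) integrable_on {0..1}"
        "(\<lambda>t. exp (- l * t) * ?S t) integrable_on {0..1}"
        by (intro integrable_continuous_interval continuous_intros)+
      have "w 0 = (\<lambda>t. 1 / c * (t * exp (- l * t) * ?S t) - m / c * (exp (- l * t) * ?S t))"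
        using c by (auto simp: w0 r_def field_simps)
      then have "integral {0..1} (w 0) = 1 / c * c1 - m / c * c"
        unfolding c_def c1_def using i
        by (simp only: Henstock_Kurzweil_Integration.integral_diff integrable_on_mult_right integral_mult_right)
      then show ?thesis
        using c by (simp add: m_def)
    qed
    have "0 \<le> W 0 s"
    proof (cases "m \<le> angle s")
      case True
      then show ?thesis
        unfolding W_def using int c S
        by (intro Henstock_Kurzweil_Integration.integral_nonneg) (auto simp: w0 r_def)
    next
      case False
      have "integral {0..angle s} (w 0) \<le> integral {0..angle s} (\<lambda>_. 0)"
        using int c S False
        by (intro integral_le) (auto simp: w0 r_def divide_le_0_iff mult_le_0_iff mult_nonpos_nonneg)
      moreover have "integral {0..angle s} (w 0) + integral {angle s..1} (w 0) = integral {0..1} (w 0)"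
        using int angle_bounds[of s] by (intro Henstock_Kurzweil_Integration.integral_combine) auto
      ultimately show ?thesis
        unfolding W_def total by simp
    qed
    moreover have "D (2 * N) s = fact (2 * N) * W 0 s"
      by (simp add: D_def Q_top T_def)
    ultimately show ?thesis by simp
  qed
  ultimately show ?thesis
    by (intro exI[of _ D]) blast
qed

section \<open>Hermite interpolants of the periodized function\<close>

lemma DERIV_periodic_v:
  "(periodic_v l has_real_derivative exp (- l * x) / (1 - exp (- l)) *
     (1 - l * x - l * exp (- l) / (1 - exp (- l)))) (at x)"
proof -
  define A where "A = 1 / (1 - exp (- l))"
  define B where "B = exp (- l) / (1 - exp (- l))\<^sup>2"
  have "periodic_v l = (\<lambda>x. exp (- l * x) * (x * A + B))"
    by (simp add: periodic_v_def fun_eq_iff A_def B_def)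
  then have "(periodic_v l has_real_derivative (- l * exp (- l * x)) * (x * A + B) + exp (- l * x) * A) (at x)"
    by (simp only:) (rule derivative_eq_intros refl | simp)+
  moreover have "(- l * exp (- l * x)) * (x * A + B) + exp (- l * x) * A
      = exp (- l * x) / (1 - exp (- l)) * (1 - l * x - l * exp (- l) / (1 - exp (- l)))"
    by (simp add: A_def B_def power2_eq_square algebra_simps)
  ultimately show ?thesis by simp
qed

definition pinned_v_deriv :: "real \<Rightarrow> real \<Rightarrow> real" where
  "pinned_v_deriv l x = exp (- l * x) / (1 - exp (- l)) * (1 - l * x - l * exp (- l) / (1 - exp (- l)))"

lemma DERIV_pinned_v: "(pinned_v l has_real_derivative pinned_v_deriv l x) (at x)"
proof -
  have "((\<lambda>x. periodic_v l x - periodic_v l 1) has_real_derivative pinned_v_deriv l x - 0) (at x)"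
    unfolding pinned_v_deriv_def by (intro DERIV_diff DERIV_periodic_v DERIV_const)
  then show ?thesis
    by (simp add: pinned_v_def[abs_def])
qed

text \<open>
  The shape of the right-hand side matters only in that it is linear in the value and the derivative
  of \<open>f\<close>: this lets Hermite interpolation commute with superpositions.
\<close>
lemma DERIV_rational_lift:
  assumes "(f has_real_derivative f') (at (angle s))"
  shows "((\<lambda>s. (1 + s\<^sup>2) ^ N * f (angle s)) has_real_derivative
    of_nat N * (1 + s\<^sup>2) ^ (N - 1) * (2 * s) * f (angle s)
    + (1 + s\<^sup>2) ^ N * (f' * (- 1 / (pi * (1 + s\<^sup>2))))) (at s)"
  by (rule derivative_eq_intros DERIV_chain2[OF assms DERIV_angle] refl | simp add: algebra_simps)+

text \<open>
  The error formula: \<open>\<kappa>\<close> is the value that makes the error minus \<open>\<kappa>\<close> times the node polynomial vanish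
  at \<open>s\<close> as well, and Rolle's theorem shows that \<open>(2 N)! \<kappa>\<close> is a value of the derivative of order
  \<open>2 N\<close>.
\<close>
lemma hermite_interpolant_below:
  assumes l: "l \<noteq> 0" and Z: "finite Z" "card Z = N"
    and p: "\<And>i. i \<ge> 2 * N \<Longrightarrow> coeff p i = 0"
    and p0: "\<And>z. z \<in> Z \<Longrightarrow> poly p z = (1 + z\<^sup>2) ^ N * pinned_v l (angle z)"
    and p1: "\<And>z. z \<in> Z \<Longrightarrow> ((\<lambda>s. (1 + s\<^sup>2) ^ N * pinned_v l (angle s)) has_real_derivative poly (pderiv p) z) (at z)"
  shows "poly p s \<le> (1 + s\<^sup>2) ^ N * pinned_v l (angle s)"
proof (cases "s \<in> Z")
  case True
  then show ?thesis by (simp add: p0)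
next
  case False
  obtain D where D: "\<And>s. D 0 s = (1 + s\<^sup>2) ^ N * pinned_v l (angle s)"
    "\<And>k s. k < 2 * N \<Longrightarrow> (D k has_real_derivative D (Suc k) s) (at s)"
    "\<And>s. 0 \<le> D (2 * N) s"
    using rational_lift_derivative_nonneg[OF l, of N] by blast
  define q where "q = node_square Z"
  note q = node_square[OF Z(1), folded q_def]
  have degq: "degree q = 2 * N" and topq: "coeff q (2 * N) = 1" and qs: "poly q s > 0"
    using q(1,2) q(5)[OF False] Z by simp_all
  have qz: "poly q z = 0" "poly (pderiv q) z = 0" if "z \<in> Z" for z
    using q(3,4)[OF that] .
  define \<kappa> where "\<kappa> = (D 0 s - poly p s) / poly q s"
  define P where "P = p + smult \<kappa> q"
  define G where "G k x = D k x - poly ((pderiv ^^ k) P) x" for k x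
  have "\<exists>t. G (2 * card Z) t = 0"
  proof (rule rolle_double_zeros[of Z s])
    show "G 0 s = 0"
      using qs by (simp add: G_def P_def \<kappa>_def)
    show "G 0 z = 0" if "z \<in> Z" for z
      using that by (simp add: G_def P_def p0 qz D(1))
    show "(G i has_real_derivative G (Suc i) x) (at x)" if "i < 2 * card Z" for i x
      unfolding G_def[abs_def] using that Z
      by (intro DERIV_diff D(2)) (simp_all add: poly_DERIV)
    show "G 1 z = 0" if z: "z \<in> Z" for z
    proof -
      have "N > 0"
        using Z z by (metis card_gt_0_iff empty_iff)
      then have "(D 0 has_real_derivative D 1 z) (at z)"
        using D(2)[of 0 z] by simp
      moreover have "D 0 = (\<lambda>s. (1 + s\<^sup>2) ^ N * pinned_v l (angle s))"
        using D(1) by blast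
      ultimately have "D 1 z = poly (pderiv p) z"
        using DERIV_unique p1[OF z] by metis
      then show ?thesis
        using qz[OF z] by (simp add: G_def P_def pderiv_add pderiv_smult)
    qed
  qed (use Z False in auto)
  then obtain t where t: "G (2 * N) t = 0"
    using Z by auto
  have "(pderiv ^^ (2 * N)) P = [:\<kappa> * fact (2 * N):]"
  proof (rule poly_eqI)
    fix i
    show "coeff ((pderiv ^^ (2 * N)) P) i = coeff [:\<kappa> * fact (2 * N):] i"
      by (cases i) (simp_all add: coeff_higher_pderiv P_def p topq coeff_eq_0 degq pochhammer_fact[symmetric])
  qed
  then have "\<kappa> = D (2 * N) t / fact (2 * N)"
    using t by (simp add: G_def)
  then have "\<kappa> \<ge> 0"
    using D(3)[of t] by simp
  moreover have "D 0 s - poly p s = \<kappa> * poly q s"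
    using qs by (simp add: \<kappa>_def)
  ultimately have "D 0 s - poly p s \<ge> 0"
    using qs by simp
  then show ?thesis
    by (simp add: D(1))
qed

section \<open>Dependence on the parameter\<close>

text \<open>
  For a nonnegative derivative the limits of the antiderivative at the two ends already imply
  integrability.
\<close>
lemma FTC_nonneg_half_line:
  fixes F f :: "real \<Rightarrow> real"
  assumes "\<And>l. l > c \<Longrightarrow> (F has_real_derivative f l) (at l)" "\<And>l. l > c \<Longrightarrow> isCont f l"
    and "\<And>l. l > c \<Longrightarrow> 0 \<le> f l"
    and "(F \<longlongrightarrow> A) (at_right c)" "(F \<longlongrightarrow> B) at_top"
  shows "set_integrable lborel {c<..} f" "(LINT l:{c<..}|lborel. f l) = B - A"
proof -
  have eq: "einterval c \<infinity> = {c<..}"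
    by (auto simp: einterval_def)
  note * = interval_integral_FTC_nonneg[of c \<infinity> F f A B]
  have "set_integrable lborel (einterval c \<infinity>) f"
    by (rule *(1)) (use assms in \<open>auto simp: ereal_tendsto_simps\<close>)
  then show "set_integrable lborel {c<..} f"
    by (simp add: eq)
  have "(LBINT l=c..\<infinity>. f l) = B - A"
    by (rule *(2)) (use assms in \<open>auto simp: ereal_tendsto_simps\<close>)
  then show "(LINT l:{c<..}|lborel. f l) = B - A"
    by (simp add: interval_lebesgue_integral_def eq)
qed

lemma exp_times_le:
  assumes "l > 0"
  shows "(1 + l) * exp (- l) \<le> (1::real)"
proof -
  have "1 + l \<le> exp l" by (rule exp_ge_add_one_self)
  then have "(1 + l) * exp (- l) \<le> exp l * exp (- l)"
    by (intro mult_right_mono) auto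
  then show ?thesis by (simp add: exp_minus)
qed

lemma pinned_v_closed_form:
  assumes "l \<noteq> 0"
  shows "pinned_v l x = (exp (- l * x) * (x * (1 - exp (- l)) + exp (- l)) - exp (- l)) / (1 - exp (- l))\<^sup>2"
proof -
  define q where "q = exp (- l)"
  have "1 - q \<noteq> 0" using assms by (simp add: q_def)
  then show ?thesis
    unfolding pinned_v_def periodic_v_def q_def[symmetric]
    by (simp add: power2_eq_square divide_simps q_def[symmetric])
qed

lemma pinned_v_endpoints [simp]: "pinned_v l 0 = 0" "pinned_v l 1 = 0"
proof -
  show "pinned_v l 1 = 0" by (simp add: pinned_v_def)
  show "pinned_v l 0 = 0" by (cases "l = 0") (simp_all add: pinned_v_closed_form, simp add: pinned_v_def periodic_v_def)
qed

text \<open>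
  Both sides differ from the periodization of the reflected function by a constant, and both vanish
  at the integers.
\<close>
lemma pinned_v_reflect: "pinned_v (- l) x = pinned_v l (1 - x)"
proof (cases "l = 0")
  case False
  define q where "q = exp (- l)"
  have q: "q > 0" "q \<noteq> 1" using False by (auto simp: q_def)
  have e: "exp l = 1 / q" by (simp add: q_def exp_minus inverse_eq_divide)
  define E where "E = exp (l * x)"
  have e2: "exp (- l * (1 - x)) = q * E"
    by (simp add: q_def E_def exp_add[symmetric] algebra_simps)
  have "pinned_v (- l) x = (E * (x * (1 - 1 / q) + 1 / q) - 1 / q) / (1 - 1 / q)\<^sup>2"
    using False by (simp add: pinned_v_closed_form E_def e)
  also have "\<dots> = (E * (x * (q - 1) + 1) - 1) * q / (q - 1)\<^sup>2"
    using q by (simp add: power2_eq_square divide_simps)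
  also have "\<dots> = ((q * E) * ((1 - x) * (1 - q) + q) - q) / (1 - q)\<^sup>2"
    using q by (simp add: power2_commute[of q 1] algebra_simps)
  also have "\<dots> = pinned_v l (1 - x)"
    using False unfolding pinned_v_closed_form[OF False] e2 by (simp add: q_def)
  finally show ?thesis .
qed (simp add: pinned_v_def periodic_v_def)

lemma pinned_v_deriv_reflect: "pinned_v_deriv (- l) x = - pinned_v_deriv l (1 - x)"
proof -
  have "((\<lambda>x. pinned_v l (1 - x)) has_real_derivative pinned_v_deriv l (1 - x) * (0 - 1)) (at x)"
    by (rule DERIV_chain2[OF DERIV_pinned_v]) (auto intro!: derivative_eq_intros)
  moreover have "(pinned_v (- l) has_real_derivative pinned_v_deriv (- l) x) (at x)"
    by (rule DERIV_pinned_v)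
  ultimately show ?thesis
    unfolding pinned_v_reflect by (metis (no_types, lifting) DERIV_unique ext mult_minus_right mult_1_right diff_0 pinned_v_reflect)
qed

text \<open>
  After multiplication by \<open>exp (l x)\<close> this is the convexity of the exponential on the segment from
  \<open>- l\<close> to 0.
\<close>
lemma pinned_v_nonneg:
  assumes "l > 0" "0 \<le> x" "x \<le> 1"
  shows "0 \<le> pinned_v l x"
proof -
  have "exp ((1 - (1 - x)) *\<^sub>R 0 + (1 - x) *\<^sub>R (- l)) \<le> (1 - (1 - x)) * exp 0 + (1 - x) * exp (- l)"
    using assms by (intro convex_onD[OF exp_convex]) auto
  then have "exp (- l * (1 - x)) \<le> x * (1 - exp (- l)) + exp (- l)"
    by (simp add: algebra_simps)
  then have "exp (- l * x) * exp (- l * (1 - x)) \<le> exp (- l * x) * (x * (1 - exp (- l)) + exp (- l))"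
    by (intro mult_left_mono) auto
  moreover have "exp (- l * x) * exp (- l * (1 - x)) = exp (- l)"
    by (simp add: exp_add[symmetric] algebra_simps)
  ultimately have *: "0 \<le> exp (- l * x) * (x * (1 - exp (- l)) + exp (- l)) - exp (- l)"
    by linarith
  have "l \<noteq> 0" using assms by simp
  then show ?thesis
    unfolding pinned_v_closed_form[OF \<open>l \<noteq> 0\<close>] by (intro divide_nonneg_nonneg[OF * zero_le_power2])
qed

lemma pinned_v_le_exp:
  assumes "l \<ge> 1" "0 \<le> x"
  shows "pinned_v l x \<le> 2 * x * exp (- l * x)"
proof -
  define q where "q = exp (- l)"
  have "2 * q \<le> (1 + l) * q"
    using assms by (intro mult_right_mono) (auto simp: q_def)
  then have "2 * q \<le> 1"
    using exp_times_le[of l] assms unfolding q_def[symmetric] by linarith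
  then have q: "q > 0" "q < 1" "1 - q \<ge> 1 / 2" using exp_gt_zero[of "- l"] unfolding q_def by linarith+
  have "exp (- l * x) * q \<le> 1 * q"
    using assms q by (intro mult_right_mono) auto
  then have "pinned_v l x \<le> (exp (- l * x) * (x * (1 - q))) / (1 - q)\<^sup>2"
    using assms unfolding pinned_v_closed_form[of l x, folded q_def, OF less_imp_neq[THEN not_sym, OF less_le_trans[OF zero_less_one assms(1)]]]
    by (intro divide_right_mono) (auto simp: q_def algebra_simps)
  also have "\<dots> = x * exp (- l * x) / (1 - q)"
    using q by (simp add: power2_eq_square)
  also have "\<dots> \<le> x * exp (- l * x) / (1 / 2)"
    using q assms by (intro divide_left_mono) auto
  finally show ?thesis by simp
qed

lemma pinned_v_deriv_bound:
  assumes "l > 0" "0 \<le> x" "x \<le> 1"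
  shows "\<bar>pinned_v_deriv l x\<bar> \<le> (1 + l) * exp (- l * x)"
proof -
  define q where "q = exp (- l)"
  have q: "q > 0" "q < 1" using assms by (auto simp: q_def)
  have lq: "(1 + l) * q \<le> 1" using exp_times_le[of l] assms by (simp add: q_def)
  have ql: "1 - q \<le> l" using exp_ge_add_one_self[of "- l"] by (simp add: q_def)
  have "l * q / (1 - q) \<le> 1"
    using lq q by (simp add: field_simps)
  moreover have "1 - l \<le> l * q / (1 - q)"
    using ql q by (simp add: field_simps)
  moreover have "0 \<le> l * x" "l * x \<le> l * 1"
    using assms by (auto intro: mult_left_mono)
  ultimately have 1: "\<bar>1 - l * x - l * q / (1 - q)\<bar> \<le> l"
    by linarith
  have "\<bar>pinned_v_deriv l x\<bar> = exp (- l * x) / (1 - q) * \<bar>1 - l * x - l * q / (1 - q)\<bar>"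
    unfolding pinned_v_deriv_def q_def[symmetric] using q by (simp add: abs_mult)
  also have "\<dots> \<le> exp (- l * x) / (1 - q) * l"
    using 1 q by (intro mult_left_mono) auto
  also have "\<dots> = (l / (1 - q)) * exp (- l * x)" by simp
  also have "\<dots> \<le> (1 + l) * exp (- l * x)"
    using lq q by (intro mult_right_mono) (auto simp: field_simps)
  finally show ?thesis .
qed

lemma pinned_v_le_linear:
  assumes "0 < l" "l \<le> 1" "0 \<le> x" "x \<le> 1"
  shows "pinned_v l x \<le> 2 * x"
proof (cases "x = 0")
  case False
  then have "x > 0" using assms by simp
  obtain z where z: "0 < z" "z < x" "pinned_v l x - pinned_v l 0 = (x - 0) * pinned_v_deriv l z"
    using MVT2[OF \<open>x > 0\<close>, of "pinned_v l" "pinned_v_deriv l"] DERIV_pinned_v by blast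
  have "pinned_v_deriv l z \<le> (1 + l) * exp (- l * z)"
    using pinned_v_deriv_bound[of l z] z assms by simp
  also have "\<dots> \<le> 2 * 1"
    using assms z by (intro mult_mono) auto
  finally have "x * pinned_v_deriv l z \<le> x * 2"
    using \<open>x > 0\<close> by (intro mult_left_mono) auto
  then show ?thesis using z by simp
qed simp

lemma isCont_pinned_v_param:
  assumes "l \<noteq> 0"
  shows "isCont (\<lambda>l. pinned_v l x) l"
  unfolding pinned_v_def periodic_v_def using assms by (intro continuous_intros) auto

lemma borel_measurable_pinned_v [measurable]: "(\<lambda>l. pinned_v l x) \<in> borel_measurable borel"
  unfolding pinned_v_def periodic_v_def by measurable

lemma borel_measurable_pinned_v_deriv [measurable]: "(\<lambda>l. pinned_v_deriv l x) \<in> borel_measurable borel"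
  unfolding pinned_v_deriv_def by measurable

text \<open>
  The periodized function is minus the derivative in \<open>l\<close> of the periodized exponential
  \<open>exp (- l x) / (1 - exp (- l))\<close>; subtracting the value at \<open>x = 1\<close> makes this regular at \<open>l = 0\<close>.
\<close>
lemma DERIV_param:
  assumes "l > 0"
  shows "((\<lambda>l. - (exp (- l * x) - exp (- l)) / (1 - exp (- l))) has_real_derivative pinned_v l x) (at l)"
proof -
  define q where "q = exp (- l)"
  have q: "1 - q > 0" using assms by (simp add: q_def)
  have "((\<lambda>l. - (exp (- l * x) - exp (- l)) / (1 - exp (- l))) has_real_derivative
     ((x * exp (- l * x) - q) * (1 - q) + (exp (- l * x) - q) * q) / ((1 - q) * (1 - q))) (at l)"
    using q unfolding q_def by (auto intro!: derivative_eq_intros simp: algebra_simps)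
  moreover have "((x * exp (- l * x) - q) * (1 - q) + (exp (- l * x) - q) * q) / ((1 - q) * (1 - q)) = pinned_v l x"
    using assms by (simp add: pinned_v_closed_form q_def[symmetric] power2_eq_square algebra_simps)
  ultimately show ?thesis by simp
qed

lemma integral_pinned_v:
  assumes x: "0 < x" "x < 1"
  shows "set_integrable lborel {0<..} (\<lambda>l. pinned_v l x)" "(LINT l:{0<..}|lborel. pinned_v l x) = 1 - x"
proof -
  let ?F = "\<lambda>l. - (exp (- l * x) - exp (- l)) / (1 - exp (- l))"
  have lim0: "(?F \<longlongrightarrow> - (1 - x)) (at_right 0)"
    by real_asymp
  have liminf: "(?F \<longlongrightarrow> 0) at_top"
    using x by real_asymp
  have l: "(?F has_real_derivative pinned_v l x) (at l)" "isCont (\<lambda>l. pinned_v l x) l" "0 \<le> pinned_v l x" if "l > 0" for l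
    using that x by (intro DERIV_param isCont_pinned_v_param pinned_v_nonneg; simp)+
  note * = FTC_nonneg_half_line[OF l lim0 liminf]
  show "set_integrable lborel {0<..} (\<lambda>l. pinned_v l x)"
    by (rule *(1))
  show "(LINT l:{0<..}|lborel. pinned_v l x) = 1 - x"
    using *(2) by simp
qed

lemma integral_exp_tail:
  assumes x: "0 < (x::real)"
  shows "set_integrable lborel {c<..} (\<lambda>l. x * exp (- l * x))" "(LINT l:{c<..}|lborel. x * exp (- l * x)) = exp (- c * x)"
proof -
  let ?F = "\<lambda>l. - exp (- l * x)"
  have lim0: "(?F \<longlongrightarrow> - exp (- c * x)) (at_right c)"
    by (intro tendsto_intros)
  have liminf: "(?F \<longlongrightarrow> 0) at_top"
    using x by real_asymp
  have d: "(?F has_real_derivative x * exp (- l * x)) (at l)" for l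
    by (auto intro!: derivative_eq_intros)
  have c: "isCont (\<lambda>l. x * exp (- l * x)) l" "0 \<le> x * exp (- l * x)" for l
    using x by (auto intro!: continuous_intros)
  note * = FTC_nonneg_half_line[OF d c lim0 liminf]
  show "set_integrable lborel {c<..} (\<lambda>l. x * exp (- l * x))"
    by (rule *(1))
  show "(LINT l:{c<..}|lborel. x * exp (- l * x)) = exp (- c * x)"
    using *(2) by simp
qed

lemma integrable_linear_exp:
  assumes x: "0 < (x::real)"
  shows "set_integrable lborel {0<..} (\<lambda>l. (1 + l) * exp (- l * x))"
proof -
  let ?F = "\<lambda>l. - exp (- l * x) * ((1 + l) / x + 1 / x\<^sup>2)"
  have lim0: "(?F \<longlongrightarrow> - exp (- 0 * x) * ((1 + 0) / x + 1 / x\<^sup>2)) (at_right 0)"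
    using x by (intro tendsto_intros) auto
  have liminf: "(?F \<longlongrightarrow> 0) at_top"
    using x by real_asymp
  have d: "(?F has_real_derivative (1 + l) * exp (- l * x)) (at l)" for l
    using x by (auto intro!: derivative_eq_intros simp: field_simps power2_eq_square)
  have c: "isCont (\<lambda>l. (1 + l) * exp (- l * x)) l" for l
    by (intro continuous_intros)
  show ?thesis
    by (rule FTC_nonneg_half_line(1)[OF d c _ lim0 liminf]) simp
qed

section \<open>Superpositions\<close>

text \<open>
  The mean value theorem turns the bound on the derivative into a bound on the difference quotients.
\<close>
lemma DERIV_integral_dominated:
  fixes f f' :: "real \<Rightarrow> 'a \<Rightarrow> real"
  assumes S: "open S" "convex S" "x \<in> S"
    and int: "\<And>y. y \<in> S \<Longrightarrow> integrable M (f y)"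
    and deriv: "\<And>y t. y \<in> S \<Longrightarrow> t \<in> space M \<Longrightarrow> ((\<lambda>y. f y t) has_real_derivative f' y t) (at y)"
    and meas: "f' x \<in> borel_measurable M"
    and bound: "\<And>y t. y \<in> S \<Longrightarrow> t \<in> space M \<Longrightarrow> \<bar>f' y t\<bar> \<le> w t" and w: "integrable M w"
  shows "((\<lambda>y. LINT t|M. f y t) has_real_derivative (LINT t|M. f' x t)) (at x)"
proof -
  have "((\<lambda>y. ((LINT t|M. f y t) - (LINT t|M. f x t)) / (y - x)) \<longlongrightarrow> (LINT t|M. f' x t)) (at x within S)"
    unfolding tendsto_at_iff_sequentially
  proof (intro allI impI)
    fix X :: "nat \<Rightarrow> real" assume X: "\<forall>i. X i \<in> S - {x}" "X \<longlonglongrightarrow> x"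
    have "(\<lambda>i. LINT t|M. (f (X i) t - f x t) / (X i - x)) \<longlonglongrightarrow> (LINT t|M. f' x t)"
    proof (rule integral_dominated_convergence[where w = w])
      show "(\<lambda>t. (f (X i) t - f x t) / (X i - x)) \<in> borel_measurable M" for i
        using int[of "X i"] int[of x] X S by (intro borel_measurable_divide borel_measurable_diff) auto
      show "AE t in M. (\<lambda>i. (f (X i) t - f x t) / (X i - x)) \<longlonglongrightarrow> f' x t"
      proof (rule AE_I2)
        fix t assume "t \<in> space M"
        then have "((\<lambda>y. (f y t - f x t) / (y - x)) \<longlongrightarrow> f' x t) (at x)"
          using deriv[of x t] S unfolding has_field_derivative_iff by auto
        then show "(\<lambda>i. (f (X i) t - f x t) / (X i - x)) \<longlonglongrightarrow> f' x t"
          using X unfolding tendsto_at_iff_sequentially o_def by auto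
      qed
      show "AE t in M. norm ((f (X i) t - f x t) / (X i - x)) \<le> w t" for i
      proof (rule AE_I2)
        fix t assume t: "t \<in> space M"
        have seg: "closed_segment x (X i) \<subseteq> S"
          using X S by (intro closed_segment_subset) auto
        have "norm (f (X i) t - f x t) \<le> w t * norm (X i - x)"
        proof (rule field_differentiable_bound[of "closed_segment x (X i)" _ "\<lambda>y. f' y t"])
          show "((\<lambda>y. f y t) has_field_derivative f' y t) (at y within closed_segment x (X i))"
            if "y \<in> closed_segment x (X i)" for y
            using that seg t by (intro DERIV_subset[OF deriv]) auto
        qed (use bound seg t in auto)
        moreover have "X i \<noteq> x" using X by auto
        ultimately show "norm ((f (X i) t - f x t) / (X i - x)) \<le> w t"
          by (simp add: norm_divide divide_le_eq)
      qed
    qed (use meas w in auto)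
    moreover have "(LINT t|M. (f (X i) t - f x t) / (X i - x))
        = ((LINT t|M. f (X i) t) - (LINT t|M. f x t)) / (X i - x)" for i
    proof -
      have "X i \<in> S" using X by auto
      then show ?thesis
        using int S by (simp only: integral_divide_zero Bochner_Integration.integral_diff)
    qed
    ultimately show "((\<lambda>y. ((LINT t|M. f y t) - (LINT t|M. f x t)) / (y - x)) \<circ> X)
        \<longlonglongrightarrow> (LINT t|M. f' x t)"
      by (simp only: o_def)
  qed
  then show ?thesis
    unfolding has_field_derivative_iff at_within_open[OF S(3,1)] .
qed

lemma integrable_weighted:
  fixes g h a :: "real \<Rightarrow> real"
  assumes g: "set_integrable lborel {0<..} g" and [measurable]: "h \<in> borel_measurable borel" "a \<in> borel_measurable borel"
    and h: "\<And>l. l > 0 \<Longrightarrow> \<bar>h l\<bar> \<le> g l" and a: "\<And>l. \<bar>a l\<bar> \<le> 2" "\<And>l. l \<le> 0 \<Longrightarrow> a l = 0"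
  shows "integrable lborel (\<lambda>l. h l * a l)"
proof (rule Bochner_Integration.integrable_bound[of _ "\<lambda>l. 2 * (indicator {0<..} l *\<^sub>R g l)"])
  show "AE l in lborel. norm (h l * a l) \<le> norm (2 * (indicator {0<..} l *\<^sub>R g l))"
  proof (rule AE_I2)
    fix l :: real
    have "\<bar>h l\<bar> * \<bar>a l\<bar> \<le> g l * 2" if "l > 0"
      using h[OF that] a(1)[of l] by (intro mult_mono) auto
    moreover have "g l \<ge> 0" if "l > 0"
      using h[OF that] by linarith
    ultimately show "norm (h l * a l) \<le> norm (2 * (indicator {0<..} l *\<^sub>R g l))"
      using a(2)[of l] by (cases "l > 0") (auto simp: abs_mult)
  qed
qed (use g in \<open>simp_all add: set_integrable_def\<close>)

text \<open>
  The weights vanish on the negative axis, so that integrals over the line are integrals over the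
  positive axis; at 0 this also hides the meaningless value of the closed form of \<open>pinned_v\<close>.
\<close>
locale half_line_weights =
  fixes a b :: "real \<Rightarrow> real"
  assumes measurable_a [measurable]: "a \<in> borel_measurable borel"
    and measurable_b [measurable]: "b \<in> borel_measurable borel"
    and a_bounds: "\<And>l. 0 \<le> a l" "\<And>l. a l \<le> 2" "\<And>l. l \<le> 0 \<Longrightarrow> a l = 0"
    and b_bounds: "\<And>l. 0 \<le> b l" "\<And>l. b l \<le> 2" "\<And>l. l \<le> 0 \<Longrightarrow> b l = 0"
begin

text \<open>
  For the weights \<open>1 + \<mu>\<close> and \<open>1 - \<mu>\<close> this is \<open>1 + F\<close> on the interval from 0 to 1; exchanging them
  gives \<open>1 - F\<close>.
\<close>
definition superposition :: "real \<Rightarrow> real" where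
  "superposition x = (LINT l|lborel. pinned_v l x * a l + pinned_v (- l) x * b l)"

definition superposition' :: "real \<Rightarrow> real" where
  "superposition' x = (LINT l|lborel. pinned_v_deriv l x * a l + pinned_v_deriv (- l) x * b l)"

lemma integrable_pinned_v_weights:
  assumes "0 < x" "x < 1"
  shows "integrable lborel (\<lambda>l. pinned_v l x * a l)" "integrable lborel (\<lambda>l. pinned_v (- l) x * b l)"
proof -
  show "integrable lborel (\<lambda>l. pinned_v l x * a l)"
    using assms a_bounds
    by (intro integrable_weighted[OF integral_pinned_v(1)[OF assms]]) (auto simp: pinned_v_nonneg)
  have x: "0 < 1 - x" "1 - x < 1"
    using assms by auto
  show "integrable lborel (\<lambda>l. pinned_v (- l) x * b l)"
    unfolding pinned_v_reflect using x b_bounds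
    by (intro integrable_weighted[OF integral_pinned_v(1)[OF x]]) (auto simp: pinned_v_nonneg)
qed

lemma integrable_pinned_v_deriv_weights:
  assumes "0 < x" "x < 1"
  shows "integrable lborel (\<lambda>l. pinned_v_deriv l x * a l)" "integrable lborel (\<lambda>l. pinned_v_deriv (- l) x * b l)"
proof -
  have d: "\<bar>pinned_v_deriv l x\<bar> \<le> (1 + l) * exp (- l * x)" "\<bar>- pinned_v_deriv l (1 - x)\<bar> \<le> (1 + l) * exp (- l * (1 - x))"
    if "l > 0" for l
    using that assms pinned_v_deriv_bound[of l x] pinned_v_deriv_bound[of l "1 - x"] by simp_all
  show "integrable lborel (\<lambda>l. pinned_v_deriv l x * a l)"
    using assms a_bounds
    by (intro integrable_weighted[OF integrable_linear_exp _ _ d(1)]) auto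
  show "integrable lborel (\<lambda>l. pinned_v_deriv (- l) x * b l)"
    unfolding pinned_v_deriv_reflect using assms b_bounds
    by (intro integrable_weighted[OF integrable_linear_exp _ _ d(2)]) auto
qed

lemma DERIV_superposition:
  assumes x: "0 < x" "x < 1"
  shows "(superposition has_real_derivative superposition' x) (at x)"
proof -
  \<comment> \<open>Away from both ends, on the interval from \<open>d\<close> to \<open>1 - d\<close>, one integrable function dominates all
    derivatives.\<close>
  define d where "d = min x (1 - x) / 2"
  have d0: "d > 0" using x by (simp add: d_def)
  have d1: "d \<le> x / 2" by (simp add: d_def)
  have d2: "d \<le> (1 - x) / 2" by (simp add: d_def)
  have d: "d > 0" "d < x" "x < 1 - d"
    using x d0 d1 d2 by (simp_all add: field_simps)
  define w where "w l = ((1 + l) * exp (- l * d)) * (a l + b l)" for l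
  have w: "integrable lborel w"
    unfolding w_def distrib_left using d a_bounds b_bounds
    by (intro Bochner_Integration.integrable_add integrable_weighted[OF integrable_linear_exp[OF d(1)]]) auto
  have bound: "\<bar>pinned_v_deriv l y\<bar> \<le> (1 + l) * exp (- l * d)" if "l > 0" "d \<le> y" "y \<le> 1" for l y
  proof -
    have "\<bar>pinned_v_deriv l y\<bar> \<le> (1 + l) * exp (- l * y)"
      using that d by (intro pinned_v_deriv_bound) auto
    also have "\<dots> \<le> (1 + l) * exp (- l * d)"
      using that by (intro mult_left_mono) auto
    finally show ?thesis .
  qed
  show ?thesis
    unfolding superposition_def[abs_def] superposition'_def
  proof (rule DERIV_integral_dominated[of "{d<..<1 - d}"])
    show "\<bar>pinned_v_deriv l y * a l + pinned_v_deriv (- l) y * b l\<bar> \<le> w l" if y: "y \<in> {d<..<1 - d}" for y l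
    proof (cases "l > 0")
      case True
      have "\<bar>pinned_v_deriv l y * a l + pinned_v_deriv (- l) y * b l\<bar> \<le> \<bar>pinned_v_deriv l y\<bar> * a l + \<bar>pinned_v_deriv l (1 - y)\<bar> * b l"
        using a_bounds b_bounds unfolding pinned_v_deriv_reflect
        by (intro order_trans[OF abs_triangle_ineq]) (simp add: abs_mult)
      also have "\<dots> \<le> ((1 + l) * exp (- l * d)) * a l + ((1 + l) * exp (- l * d)) * b l"
        using y d True a_bounds b_bounds by (intro add_mono mult_right_mono bound) auto
      finally show ?thesis by (simp add: w_def distrib_left)
    next
      case False
      then show ?thesis
        using a_bounds b_bounds by (simp add: w_def)
    qed
    show "integrable lborel (\<lambda>l. pinned_v l y * a l + pinned_v (- l) y * b l)" if "y \<in> {d<..<1 - d}" for y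
      using that d by (intro Bochner_Integration.integrable_add integrable_pinned_v_weights) auto
    show "((\<lambda>y. pinned_v l y * a l + pinned_v (- l) y * b l) has_real_derivative pinned_v_deriv l y * a l + pinned_v_deriv (- l) y * b l) (at y)" for l y
      by (intro DERIV_add DERIV_cmult_right DERIV_pinned_v)
  qed (use d x w in auto)
qed

end

context half_line_weights
begin

text \<open>
  Tauberian estimate near \<open>y = 0\<close>, where \<open>u\<^sub>l(y)\<close> is of size \<open>y exp (- l y)\<close>: up to \<open>T / y\<close> it is bounded
  by a multiple of \<open>y\<close>, which leaves \<open>T\<close> times a mean value of \<open>b\<close>, and beyond \<open>T / y\<close> the exponential
  is small by itself.
\<close>
lemma pinned_v_weight_tail_bound:
  assumes y: "0 < y" "y < 1" and T: "y \<le> T"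
  shows "(LINT l|lborel. pinned_v l y * b l) \<le> 4 * y + 2 * y * (LINT l:{0<..T / y}|lborel. b l) + 4 * exp (- T)"
proof -
  have intu: "integrable lborel (\<lambda>l. pinned_v l y * b l)"
    using y b_bounds
    by (intro integrable_weighted[OF integral_pinned_v(1)[OF y]]) (auto simp: pinned_v_nonneg)
  have fin: "integrable lborel (indicator {0<..c} :: real \<Rightarrow> real)" for c
  proof (rule integrable_real_indicator)
    have "bounded {0<..c}"
      by (rule bounded_subset[OF bounded_closed_interval[of 0 c]]) auto
    then show "emeasure lborel {0<..c} < \<infinity>"
      by (rule emeasure_bounded_finite)
  qed simp
  have i1: "integrable lborel (\<lambda>l::real. 4 * y * indicator {0<..1} l)"
    by (intro integrable_mult_right fin)
  have i2: "integrable lborel (\<lambda>l. 2 * y * (indicator {0<..T / y} l * b l))"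
  proof (intro integrable_mult_right Bochner_Integration.integrable_bound[OF integrable_mult_right[OF fin]])
    show "AE l in lborel. norm (indicator {0<..T / y} l * b l) \<le> norm (2 * indicator {0<..T / y} l :: real)"
      using b_bounds by (intro AE_I2) (simp add: indicator_def)
  qed measurable
  have i3: "integrable lborel (\<lambda>l. 4 * (indicator {T / y<..} l * (y * exp (- l * y))))"
    using integral_exp_tail(1)[OF y(1), of "T / y"]
    by (intro integrable_mult_right) (simp add: set_integrable_def)
  have "(LINT l|lborel. pinned_v l y * b l) \<le> (LINT l|lborel. 4 * y * indicator {0<..1} l
      + 2 * y * (indicator {0<..T / y} l * b l) + 4 * (indicator {T / y<..} l * (y * exp (- l * y))))"
  proof (rule integral_mono[OF intu])
    show "integrable lborel (\<lambda>l. 4 * y * indicator {0<..1} l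
      + 2 * y * (indicator {0<..T / y} l * b l) + 4 * (indicator {T / y<..} l * (y * exp (- l * y))))"
      by (intro Bochner_Integration.integrable_add i1 i2 i3)
    fix l :: real
    consider "l \<le> 0" | "0 < l" "l \<le> 1" | "1 < l" "l \<le> T / y" | "1 < l" "T / y < l"
      by linarith
    then show "pinned_v l y * b l \<le> 4 * y * indicator {0<..1} l
      + 2 * y * (indicator {0<..T / y} l * b l) + 4 * (indicator {T / y<..} l * (y * exp (- l * y)))"
    proof cases
      case 1
      then show ?thesis using y b_bounds by (simp add: indicator_def)
    next
      case 2
      have "pinned_v l y * b l \<le> (2 * y) * 2"
        using 2 y b_bounds pinned_v_le_linear[of l y] by (intro mult_mono) auto
      then show ?thesis
        using 2 y b_bounds(1)[of l] by (simp add: indicator_def add_nonneg_nonneg add.assoc add_increasing2)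
    next
      case 3
      have "pinned_v l y * b l \<le> (2 * y * exp (- l * y)) * b l"
        using 3 y b_bounds pinned_v_le_exp[of l y] by (intro mult_right_mono) auto
      also have "\<dots> \<le> (2 * y * 1) * b l"
        using 3 y b_bounds by (intro mult_right_mono mult_left_mono) auto
      finally show ?thesis
        using 3 y by (simp add: indicator_def)
    next
      case 4
      have "pinned_v l y * b l \<le> (2 * y * exp (- l * y)) * 2"
        using 4 y b_bounds pinned_v_le_exp[of l y] by (intro mult_mono) auto
      then show ?thesis
        using 4 y by (simp add: indicator_def)
    qed
  qed
  also have "\<dots> = 4 * y + 2 * y * (LINT l:{0<..T / y}|lborel. b l) + 4 * exp (- T)"
  proof -
    have "(LINT l|lborel. indicator {T / y<..} l * (y * exp (- l * y))) = exp (- (T / y) * y)"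
      using integral_exp_tail(2)[OF y(1), of "T / y"]
      by (simp only: set_lebesgue_integral_def real_scaleR_def)
    then have tail: "(LINT l|lborel. indicator {T / y<..} l * (y * exp (- l * y))) = exp (- T)"
      using y by simp
    have one: "(LINT l|lborel. indicator {0<..1::real} l) = (1 :: real)"
      by simp
    show ?thesis
      unfolding Bochner_Integration.integral_add[OF Bochner_Integration.integrable_add[OF i1 i2] i3]
        Bochner_Integration.integral_add[OF i1 i2] integral_mult_right_zero tail one
        set_lebesgue_integral_def real_scaleR_def by simp
  qed
  finally show ?thesis .
qed

text \<open>
  This is where the mean value of \<open>\<mu>\<close> enters: near 1 the first part of the superposition has size
  \<open>1 - x\<close>, and the second part is controlled by the mean of \<open>b = 1 - \<mu>\<close>, which tends to 0.
\<close>
lemma superposition_vanishes_at_1: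
  assumes avg: "((\<lambda>y. (LINT l:{0<..y}|lborel. b l) / y) \<longlongrightarrow> 0) at_top" and \<epsilon>: "\<epsilon> > 0"
  shows "eventually (\<lambda>x. superposition x < \<epsilon>) (at_left 1)"
proof -
  \<comment> \<open>Then \<open>4 exp (- T) \<le> \<epsilon> / 2\<close>, and \<open>T\<close> is at least as large as any \<open>1 - x\<close> that occurs.\<close>
  define T where "T = max 1 (- ln (\<epsilon> / 8))"
  have "T \<ge> 1" by (simp add: T_def)
  have "exp (- T) \<le> exp (ln (\<epsilon> / 8))"
    by (simp add: T_def)
  then have T: "4 * exp (- T) < \<epsilon>"
    using \<epsilon> by simp
  define B where "B x = 2 * (1 - x) + (4 * (1 - x) +
    2 * T * ((LINT l:{0<..T / (1 - x)}|lborel. b l) / (T / (1 - x))) + 4 * exp (- T))" for x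
  have "filterlim (\<lambda>x. T / (1 - x)) at_top (at_left 1)"
    using \<open>T \<ge> 1\<close> by real_asymp
  from filterlim_compose[OF avg this]
  have "(B \<longlongrightarrow> 2 * (1 - 1) + (4 * (1 - 1) + 2 * T * 0 + 4 * exp (- T))) (at_left 1)"
    unfolding B_def[abs_def] by (intro tendsto_intros) auto
  then have "eventually (\<lambda>x. B x < \<epsilon>) (at_left 1)"
    using T by (intro order_tendstoD(2)) auto
  moreover have "eventually (\<lambda>x. x \<in> {0<..<1}) (at_left (1::real))"
    by (intro eventually_at_left_real) auto
  ultimately show ?thesis
  proof eventually_elim
    case (elim x)
    then have x: "0 < x" "x < 1" by auto
    have "(LINT l|lborel. pinned_v l x * a l) \<le> (LINT l|lborel. 2 * (indicator {0<..} l *\<^sub>R pinned_v l x))"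
    proof (rule integral_mono[OF integrable_pinned_v_weights(1)[OF x]])
      show "integrable lborel (\<lambda>l. 2 * (indicator {0<..} l *\<^sub>R pinned_v l x))"
        using integral_pinned_v(1)[OF x] by (intro integrable_mult_right) (simp add: set_integrable_def)
      show "pinned_v l x * a l \<le> 2 * (indicator {0<..} l *\<^sub>R pinned_v l x)" for l
        using mult_left_mono[OF a_bounds(2)[of l] pinned_v_nonneg[of l x]] a_bounds(3)[of l] x
        by (cases "l > 0") (auto simp: mult.commute)
    qed
    also have "\<dots> = 2 * (1 - x)"
      using integral_pinned_v(2)[OF x] by (simp add: set_lebesgue_integral_def)
    finally have 1: "(LINT l|lborel. pinned_v l x * a l) \<le> 2 * (1 - x)" .
    have 2: "(LINT l|lborel. pinned_v l (1 - x) * b l) \<le> 4 * (1 - x) +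
        2 * (1 - x) * (LINT l:{0<..T / (1 - x)}|lborel. b l) + 4 * exp (- T)"
      using x \<open>T \<ge> 1\<close> by (intro pinned_v_weight_tail_bound) auto
    have "superposition x = (LINT l|lborel. pinned_v l x * a l) + (LINT l|lborel. pinned_v (- l) x * b l)"
      unfolding superposition_def by (rule Bochner_Integration.integral_add[OF integrable_pinned_v_weights[OF x]])
    also have "\<dots> \<le> B x"
    proof -
      have "2 * T * ((LINT l:{0<..T / (1 - x)}|lborel. b l) / (T / (1 - x)))
          = 2 * (1 - x) * (LINT l:{0<..T / (1 - x)}|lborel. b l)"
        using x \<open>T \<ge> 1\<close> by (simp add: field_simps)
      then show ?thesis
        using 1 2 unfolding pinned_v_reflect B_def by linarith
    qed
    finally show ?case using elim by simp
  qed
qed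

text \<open>
  The value of the interpolant at a fixed point \<open>s\<close> is a linear combination of the values and
  derivatives at the nodes, with coefficients independent of the interpolated function, so the
  inequality for each \<open>u\<^sub>l\<close> can be integrated against the nonnegative weights.
\<close>
lemma superposition_hermite_minorant:
  assumes Z: "finite Z" "card Z = N"
  shows "\<exists>p. (\<forall>i\<ge>2 * N. coeff p i = 0) \<and>
    (\<forall>z\<in>Z. poly p z = (1 + z\<^sup>2) ^ N * superposition (angle z)) \<and>
    (\<forall>s. poly p s \<le> (1 + s\<^sup>2) ^ N * superposition (angle s))"
proof -
  have "\<exists>p. (\<forall>i\<ge>2 * N. coeff p i = 0) \<and>
      (\<forall>v\<in>Z. poly p v = (if v = z then 1 else 0) \<and> poly (pderiv p) v = 0)" for z
    using hermite_interpolation_exists[OF Z(1), of "\<lambda>v. if v = z then 1 else 0" "\<lambda>_. 0"] Z by simp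
  then obtain P where P: "\<And>z i. i \<ge> 2 * N \<Longrightarrow> coeff (P z) i = 0"
    "\<And>z v. v \<in> Z \<Longrightarrow> poly (P z) v = (if v = z then 1 else 0)"
    "\<And>z v. v \<in> Z \<Longrightarrow> poly (pderiv (P z)) v = 0"
    by metis
  have "\<exists>p. (\<forall>i\<ge>2 * N. coeff p i = 0) \<and>
      (\<forall>v\<in>Z. poly p v = 0 \<and> poly (pderiv p) v = (if v = z then 1 else 0))" for z
    using hermite_interpolation_exists[OF Z(1), of "\<lambda>_. 0" "\<lambda>v. if v = z then 1 else 0"] Z by simp
  then obtain Q where Q: "\<And>z i. i \<ge> 2 * N \<Longrightarrow> coeff (Q z) i = 0"
    "\<And>z v. v \<in> Z \<Longrightarrow> poly (Q z) v = 0"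
    "\<And>z v. v \<in> Z \<Longrightarrow> poly (pderiv (Q z)) v = (if v = z then 1 else 0)"
    by metis
  define k1 where "k1 s = (1 + s\<^sup>2) ^ N" for s :: real
  define k2 where "k2 s = of_nat N * (1 + s\<^sup>2) ^ (N - 1) * (2 * s)" for s :: real
  define k3 where "k3 s = (1 + s\<^sup>2) ^ N * (- 1 / (pi * (1 + s\<^sup>2)))" for s :: real
  define I where "I f f' = (\<Sum>z\<in>Z. smult (k1 z * f (angle z)) (P z)
    + smult (k2 z * f (angle z) + k3 z * f' (angle z)) (Q z))" for f f' :: "real \<Rightarrow> real"
  have I_high: "coeff (I f f') i = 0" if "i \<ge> 2 * N" for f f' i
    using that P(1) Q(1) by (simp add: I_def coeff_sum)
  have I_val: "poly (I f f') z = k1 z * f (angle z)" if "z \<in> Z" for f f' z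
  proof -
    have "poly (I f f') z = (\<Sum>v\<in>Z. if v = z then k1 v * f (angle v) else 0)"
      unfolding I_def poly_sum using that by (intro sum.cong) (auto simp: P Q)
    then show ?thesis using Z that by simp
  qed
  have I_der: "poly (pderiv (I f f')) z = k2 z * f (angle z) + k3 z * f' (angle z)" if "z \<in> Z" for f f' z
  proof -
    have "poly (pderiv (I f f')) z = (\<Sum>v\<in>Z. if v = z then k2 v * f (angle v) + k3 v * f' (angle v) else 0)"
      unfolding I_def higher_pderiv_sum[of 1, simplified] poly_sum using that
      by (intro sum.cong) (auto simp: P Q pderiv_add pderiv_smult)
    then show ?thesis using Z that by simp
  qed
  have lift: "((\<lambda>s. (1 + s\<^sup>2) ^ N * f (angle s)) has_real_derivative k2 z * f (angle z) + k3 z * f' (angle z)) (at z)"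
    if "(f has_real_derivative f' (angle z)) (at (angle z))" for f f' :: "real \<Rightarrow> real" and z
    using DERIV_rational_lift[OF that, of N] by (simp add: k2_def k3_def mult_ac)
  have below: "poly (I (pinned_v l) (pinned_v_deriv l)) s \<le> k1 s * pinned_v l (angle s)" if "l \<noteq> 0" for l s
    unfolding k1_def
    by (rule hermite_interpolant_below[OF that Z I_high])
      (auto simp: I_val I_der k1_def intro!: lift DERIV_pinned_v)
  have "poly (I superposition superposition') s \<le> k1 s * superposition (angle s)" for s
  proof -
    define \<alpha> where "\<alpha> z = k1 z * poly (P z) s + k2 z * poly (Q z) s" for z
    define \<beta> where "\<beta> z = k3 z * poly (Q z) s" for z
    have I_s: "poly (I f f') s = (\<Sum>z\<in>Z. \<alpha> z * f (angle z) + \<beta> z * f' (angle z))" for f f'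
      unfolding I_def poly_sum by (intro sum.cong) (simp_all add: \<alpha>_def \<beta>_def algebra_simps)
    define U where "U x l = pinned_v l x * a l + pinned_v (- l) x * b l" for x l
    define U' where "U' x l = pinned_v_deriv l x * a l + pinned_v_deriv (- l) x * b l" for x l
    have intU: "integrable lborel (U (angle z))" for z
      unfolding U_def[abs_def]
      by (intro Bochner_Integration.integrable_add integrable_pinned_v_weights angle_bounds)
    have intU': "integrable lborel (U' (angle z))" for z
      unfolding U'_def[abs_def]
      by (intro Bochner_Integration.integrable_add integrable_pinned_v_deriv_weights angle_bounds)
    have "poly (I superposition superposition') s
        = (\<Sum>z\<in>Z. \<alpha> z * (LINT l|lborel. U (angle z) l) + \<beta> z * (LINT l|lborel. U' (angle z) l))"
      by (simp add: I_s superposition_def superposition'_def U_def U'_def)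
    also have "\<dots> = (LINT l|lborel. (\<Sum>z\<in>Z. \<alpha> z * U (angle z) l + \<beta> z * U' (angle z) l))"
      using intU intU' by simp
    also have "\<dots> \<le> (LINT l|lborel. k1 s * U (angle s) l)"
    proof (rule integral_mono)
      show "integrable lborel (\<lambda>l. \<Sum>z\<in>Z. \<alpha> z * U (angle z) l + \<beta> z * U' (angle z) l)"
        using intU intU' by simp
      show "integrable lborel (\<lambda>l. k1 s * U (angle s) l)"
        using intU by simp
      fix l :: real
      have eq: "(\<Sum>z\<in>Z. \<alpha> z * U (angle z) l + \<beta> z * U' (angle z) l)
          = poly (I (pinned_v l) (pinned_v_deriv l)) s * a l + poly (I (pinned_v (- l)) (pinned_v_deriv (- l))) s * b l"
        unfolding I_s sum_distrib_right sum.distrib[symmetric]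
        by (intro sum.cong) (simp_all add: U_def U'_def algebra_simps)
      show "(\<Sum>z\<in>Z. \<alpha> z * U (angle z) l + \<beta> z * U' (angle z) l) \<le> k1 s * U (angle s) l"
      proof (cases "l > 0")
        case True
        have "poly (I (pinned_v l) (pinned_v_deriv l)) s * a l + poly (I (pinned_v (- l)) (pinned_v_deriv (- l))) s * b l
            \<le> k1 s * pinned_v l (angle s) * a l + k1 s * pinned_v (- l) (angle s) * b l"
          using True a_bounds b_bounds by (intro add_mono mult_right_mono below) auto
        then show ?thesis
          unfolding eq by (simp add: U_def algebra_simps)
      next
        case False
        then show ?thesis
          unfolding eq using a_bounds b_bounds by (simp add: U_def)
      qed
    qed
    also have "\<dots> = k1 s * superposition (angle s)"
      by (simp add: superposition_def U_def)
    finally show ?thesis .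
  qed
  then show ?thesis
    using I_high I_val unfolding k1_def by (intro exI[of _ "I superposition superposition'"]) simp
qed

end

section \<open>From polynomials in the cotangent to trigonometric polynomials\<close>

text \<open>
  With \<open>h = e(z / 2)\<close>, both \<open>cos (\<pi> z)\<close> and \<open>sin (\<pi> z)\<close> are \<open>1 / h\<close> times a linear polynomial in \<open>e(z)\<close>.
\<close>
lemma trig_poly_cos_sin:
  "trig_poly N (\<lambda>z. cos (of_real pi * z) ^ i * sin (of_real pi * z) ^ (2 * N - i))" if "i \<le> 2 * N"
proof -
  define h where "h z = circle_e (z / 2)" for z
  have hh: "h z * h z = circle_e z" for z
    by (simp add: h_def circle_e_add[symmetric])
  have h0: "h z \<noteq> 0" for z by (simp add: h_def)
  have c: "cos (of_real pi * z) = inverse (h z) * poly [:1 / 2, 1 / 2:] (circle_e z)" for z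
    unfolding cos_exp_eq hh[symmetric] using h0[of z]
    by (simp add: h_def circle_e_def exp_minus field_simps)
  have s: "sin (of_real pi * z) = inverse (h z) * poly [:- 1 / (2 * \<i>), 1 / (2 * \<i>):] (circle_e z)" for z
    unfolding sin_exp_eq hh[symmetric] using h0[of z]
    by (simp add: h_def circle_e_def exp_minus field_simps)
  define P where "P = [:1 / 2, 1 / 2:] ^ i * [:- 1 / (2 * \<i>), 1 / (2 * \<i>):] ^ (2 * N - i)"
  have "degree P \<le> 2 * N"
  proof -
    have "degree P \<le> degree ([:1 / 2, 1 / 2 :: complex:] ^ i) + degree ([:- 1 / (2 * \<i>), 1 / (2 * \<i>):] ^ (2 * N - i))"
      unfolding P_def by (rule degree_mult_le)
    also have "\<dots> = i + (2 * N - i)"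
      by (simp add: degree_power_eq)
    finally show ?thesis using that by simp
  qed
  then have "\<forall>j>2 * N. coeff P j = 0"
    by (auto intro: coeff_eq_0)
  moreover have "cos (of_real pi * z) ^ i * sin (of_real pi * z) ^ (2 * N - i)
      = circle_e (- (of_nat N * z)) * poly P (circle_e z)" for z
  proof -
    have "inverse (h z) ^ i * inverse (h z) ^ (2 * N - i) = inverse (h z * h z) ^ N"
      using that by (simp add: power_add[symmetric] power_mult power2_eq_square)
    also have "\<dots> = circle_e (- (of_nat N * z))"
      by (simp add: hh circle_e_minus circle_e_of_nat_mult power_inverse)
    finally have e: "inverse (h z) ^ i * inverse (h z) ^ (2 * N - i) = circle_e (- (of_nat N * z))" .
    show ?thesis
      unfolding c s P_def e[symmetric] poly_mult poly_power power_mult_distrib by (simp only: mult_ac)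
  qed
  ultimately show ?thesis
    unfolding trig_poly_iff_poly by blast
qed

text \<open>
  This is \<open>sin (\<pi> z) ^ (2 N) p(cot (\<pi> z))\<close> for a polynomial \<open>p\<close> of degree less than \<open>2 N\<close>.  As the
  sum stops before \<open>2 N\<close>, every term has a factor \<open>sin (\<pi> z)\<close>.
\<close>
definition homogenized :: "nat \<Rightarrow> real poly \<Rightarrow> complex \<Rightarrow> complex" where
  "homogenized N p z = (\<Sum>i<2 * N. of_real (coeff p i) * (cos (of_real pi * z) ^ i * sin (of_real pi * z) ^ (2 * N - i)))"

lemma trig_poly_homogenized: "trig_poly N (homogenized N p)"
  unfolding homogenized_def[abs_def] by (intro trig_poly_sum trig_poly_cmult trig_poly_cos_sin) auto

lemma homogenized_real: "homogenized N p (of_real x) = of_real (\<Sum>i<2 * N. coeff p i * (cos (pi * x) ^ i * sin (pi * x) ^ (2 * N - i)))"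
  by (simp add: homogenized_def cos_of_real sin_of_real del: of_real_mult flip: of_real_mult of_real_power)

lemma homogenized_0: "homogenized N p 0 = 0"
  unfolding homogenized_def by (intro sum.neutral) auto

lemma homogenized_angle:
  assumes "\<And>i. i \<ge> 2 * N \<Longrightarrow> coeff p i = 0"
  shows "homogenized N p (of_real (angle s)) = of_real (poly p s / (1 + s\<^sup>2) ^ N)"
proof -
  have S: "sin (pi * angle s) ^ (2 * N) = 1 / (1 + s\<^sup>2) ^ N"
  proof -
    have "(1 + s\<^sup>2) ^ N \<noteq> 0"
      by (simp add: add_nonneg_eq_0_iff)
    then show ?thesis
      using sin_angle_power[of s N] by (simp add: field_simps)
  qed
  have "(\<Sum>i<2 * N. coeff p i * (cos (pi * angle s) ^ i * sin (pi * angle s) ^ (2 * N - i)))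
      = (\<Sum>i<2 * N. coeff p i * s ^ i * sin (pi * angle s) ^ (2 * N))"
  proof (rule sum.cong[OF refl])
    fix i assume "i \<in> {..<2 * N}"
    then have "sin (pi * angle s) ^ i * sin (pi * angle s) ^ (2 * N - i) = sin (pi * angle s) ^ (2 * N)"
      by (simp add: power_add[symmetric])
    then show "coeff p i * (cos (pi * angle s) ^ i * sin (pi * angle s) ^ (2 * N - i))
        = coeff p i * s ^ i * sin (pi * angle s) ^ (2 * N)"
      unfolding cos_angle power_mult_distrib by (simp add: mult.assoc)
  qed
  also have "\<dots> = (\<Sum>i\<le>2 * N. coeff p i * s ^ i) * sin (pi * angle s) ^ (2 * N)"
    using assms[of "2 * N"] by (simp add: sum_distrib_right lessThan_Suc_atMost[symmetric])
  also have "(\<Sum>i\<le>2 * N. coeff p i * s ^ i) = poly p s"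
  proof -
    have "degree p \<le> 2 * N" using assms by (intro degree_le) auto
    then show ?thesis by (simp add: poly_sum_coeff)
  qed
  finally show ?thesis
    unfolding homogenized_real S by simp
qed

section \<open>The extremal problem\<close>

text \<open>
  Both \<open>F\<close> and \<open>- F\<close> satisfy these conditions.  They approach \<open>- 1\<close> at 0 from opposite sides, so the
  last condition, which bounds minorants at 0, is stated without reference to a side.
\<close>
locale minorant_problem = orthonormal_polynomial \<theta> N \<phi> + half_line_weights a b
  for \<theta> N \<phi> a b +
  fixes f :: "real \<Rightarrow> real"
  assumes f_periodic: "\<And>x n. f (x + of_int n) = f x" and f_0: "f 0 = 0"
    and f_eq: "\<And>x. 0 < x \<Longrightarrow> x < 1 \<Longrightarrow> f x = superposition x - 1"
    and f_jump: "\<And>\<epsilon>. \<epsilon> > 0 \<Longrightarrow> frequently (\<lambda>x. f x < \<epsilon> - 1) (at 0)"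
begin

definition minorant :: "(complex \<Rightarrow> complex) \<Rightarrow> bool" where
  "minorant L \<longleftrightarrow> real_trig_poly N L \<and> (\<forall>x::real. Re (L (of_real x)) \<le> f x)"

definition bound :: real where
  "bound = - 1 / weight 0 + (\<Sum>\<xi>\<in>nodes. f \<xi> / weight \<xi>)"

lemma minorant_at_0:
  assumes "minorant L"
  shows "Re (L 0) \<le> - 1"
proof (rule ccontr)
  assume "\<not> Re (L 0) \<le> - 1"
  define \<epsilon> where "\<epsilon> = (Re (L 0) + 1) / 2"
  have \<epsilon>: "\<epsilon> > 0" using \<open>\<not> Re (L 0) \<le> - 1\<close> by (simp add: \<epsilon>_def)
  have "isCont L 0"
    using assms unfolding minorant_def real_trig_poly_def
    by (intro field_differentiable_imp_continuous_at trig_poly_differentiable) blast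
  then have "isCont (\<lambda>x::real. Re (L (of_real x))) 0"
    by (intro continuous_intros isCont_o2[of _ of_real]) auto
  then have "((\<lambda>x::real. Re (L (of_real x))) \<longlongrightarrow> Re (L 0)) (at 0)"
    by (simp add: isCont_def)
  moreover have "\<epsilon> - 1 < Re (L 0)"
    using \<open>\<not> Re (L 0) \<le> - 1\<close> by (simp add: \<epsilon>_def field_simps)
  ultimately have "eventually (\<lambda>x::real. Re (L (of_real x)) > \<epsilon> - 1) (at 0)"
    by (rule order_tendstoD(1))
  with f_jump[OF \<epsilon>] have "frequently (\<lambda>x::real. Re (L (of_real x)) > \<epsilon> - 1 \<and> f x < \<epsilon> - 1) (at 0)"
    by (rule frequently_eventually_conj)
  then obtain x where "f x < \<epsilon> - 1" "Re (L (of_real x)) > \<epsilon> - 1"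
    by (auto dest: frequently_ex)
  then show False
    using assms unfolding minorant_def by (metis less_trans not_less)
qed

lemma integral_minorant:
  assumes "minorant L"
  shows "bound - (LINT x|\<theta>. Re (L (of_real x)))
    = (- 1 - Re (L 0)) / weight 0 + (\<Sum>\<xi>\<in>nodes. (f \<xi> - Re (L (of_real \<xi>))) / weight \<xi>)"
proof -
  have "trig_poly N L" using assms by (simp add: minorant_def real_trig_poly_def)
  then show ?thesis
    by (simp add: bound_def real_quadrature diff_divide_distrib sum_subtractf)
qed

lemma minorant_terms_nonneg:
  assumes "minorant L"
  shows "0 \<le> (- 1 - Re (L 0)) / weight 0" "\<And>\<xi>. \<xi> \<in> nodes \<Longrightarrow> 0 \<le> (f \<xi> - Re (L (of_real \<xi>))) / weight \<xi>"
  using assms minorant_at_0[OF assms] weight_pos by (auto simp: minorant_def less_imp_le)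

lemma integral_minorant_le:
  assumes "minorant L"
  shows "(LINT x|\<theta>. Re (L (of_real x))) \<le> bound"
proof -
  have "0 \<le> (\<Sum>\<xi>\<in>nodes. (f \<xi> - Re (L (of_real \<xi>))) / weight \<xi>)"
    by (rule sum_nonneg) (rule minorant_terms_nonneg(2)[OF assms])
  then show ?thesis
    using integral_minorant[OF assms] minorant_terms_nonneg(1)[OF assms] by linarith
qed

text \<open>
  If the deficit is zero, then so is each of its terms, and at an inner node the nonnegative function
  \<open>f - L\<close> attains the minimum 0.
\<close>
lemma extremal_minorant_interpolates:
  assumes L: "minorant L" and eq: "(LINT x|\<theta>. Re (L (of_real x))) = bound"
  shows "L 0 = - 1" "\<And>\<xi>. \<xi> \<in> nodes \<Longrightarrow> L (of_real \<xi>) = of_real (f \<xi>)"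
    "\<And>\<xi>. \<xi> \<in> nodes \<Longrightarrow> deriv L (of_real \<xi>) = of_real (superposition' \<xi>)"
proof -
  have trig: "trig_poly N L" and real: "\<And>x::real. L (of_real x) \<in> \<real>"
    and below: "\<And>x::real. Re (L (of_real x)) \<le> f x"
    using L by (auto simp: minorant_def real_trig_poly_def)
  have L_real: "L (of_real x) = of_real (Re (L (of_real x)))" for x :: real
    using real[of x] by (simp add: of_real_Re)
  let ?g = "\<lambda>\<xi>. (f \<xi> - Re (L (of_real \<xi>))) / weight \<xi>"
  note nonneg = minorant_terms_nonneg[OF L]
  have "sum ?g nodes \<ge> 0"
    by (rule sum_nonneg) (rule nonneg(2))
  moreover have "(- 1 - Re (L 0)) / weight 0 + sum ?g nodes = 0"
    using integral_minorant[OF L] eq by simp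
  ultimately have s0: "sum ?g nodes = 0" and w0: "(- 1 - Re (L 0)) / weight 0 = 0"
    using nonneg(1) by linarith+
  have "Re (L 0) = - 1"
    using w0 weight_pos[of 0] by simp
  then show "L 0 = - 1"
    using L_real[of 0] by simp
  have f_node: "f \<xi> = Re (L (of_real \<xi>))" if "\<xi> \<in> nodes" for \<xi>
  proof -
    have "?g \<xi> = 0"
      using s0 that nonneg(2) by (simp add: sum_nonneg_eq_0_iff finite_nodes)
    then show ?thesis
      using weight_pos[of \<xi>] that by simp
  qed
  then show "L (of_real \<xi>) = of_real (f \<xi>)" if "\<xi> \<in> nodes" for \<xi>
    using L_real[of \<xi>] that by simp
  show "deriv L (of_real \<xi>) = of_real (superposition' \<xi>)" if \<xi>: "\<xi> \<in> nodes" for \<xi>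
  proof -
    have x: "0 < \<xi>" "\<xi> < 1"
      using \<xi> by (auto simp: nodes_def)
    have "(L has_field_derivative deriv L (of_real \<xi>)) (at (of_real \<xi>))"
      using trig_poly_differentiable[OF trig] by (simp add: DERIV_deriv_iff_field_differentiable)
    then have "((\<lambda>x. L (of_real x)) has_vector_derivative deriv L (of_real \<xi>)) (at \<xi>)"
      using has_vector_derivative_real_field by blast
    then have Re': "((\<lambda>x. Re (L (of_real x))) has_real_derivative Re (deriv L (of_real \<xi>))) (at \<xi>)"
      and Im': "((\<lambda>x. Im (L (of_real x))) has_real_derivative Im (deriv L (of_real \<xi>))) (at \<xi>)"
      unfolding has_real_derivative_iff_has_vector_derivative
      by (auto dest: bounded_linear.has_vector_derivative[OF bounded_linear_Re]
          bounded_linear.has_vector_derivative[OF bounded_linear_Im])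
    have "Im (L (of_real x)) = 0" for x :: real
      using real[of x] by (simp add: complex_is_Real_iff)
    with Im' have im: "Im (deriv L (of_real \<xi>)) = 0"
      by (simp add: DERIV_unique[OF _ DERIV_const])
    define g where "g x = superposition x - 1 - Re (L (of_real x))" for x
    have "(g has_real_derivative superposition' \<xi> - 0 - Re (deriv L (of_real \<xi>))) (at \<xi>)"
      unfolding g_def[abs_def] by (intro DERIV_diff DERIV_superposition x Re' DERIV_const)
    moreover have "0 < min \<xi> (1 - \<xi>)" using x by simp
    moreover have "\<forall>y. \<bar>\<xi> - y\<bar> < min \<xi> (1 - \<xi>) \<longrightarrow> g \<xi> \<le> g y"
    proof (intro allI impI)
      fix y assume "\<bar>\<xi> - y\<bar> < min \<xi> (1 - \<xi>)"
      then have y: "0 < y" "y < 1" by linarith+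
      have "g \<xi> = 0"
        using f_eq[OF x] f_node[OF \<xi>] by (simp add: g_def)
      moreover have "g y \<ge> 0"
        using below[of y] f_eq[OF y] by (simp add: g_def)
      ultimately show "g \<xi> \<le> g y" by simp
    qed
    ultimately have "superposition' \<xi> - 0 - Re (deriv L (of_real \<xi>)) = 0"
      by (rule DERIV_local_min)
    then show ?thesis
      using im by (simp add: complex_eq_iff)
  qed
qed

lemma extremal_minorant_unique:
  assumes "minorant L" "(LINT x|\<theta>. Re (L (of_real x))) = bound"
    and "minorant M" "(LINT x|\<theta>. Re (M (of_real x))) = bound"
  shows "L = M"
proof
  fix z
  have trig: "trig_poly N L" "trig_poly N M"
    using assms by (auto simp: minorant_def real_trig_poly_def)
  note * = extremal_minorant_interpolates[OF assms(1,2)] extremal_minorant_interpolates[OF assms(3,4)]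
  have "L z + - 1 * M z = 0"
  proof (rule trig_poly_eq_0[where X = nodes and W = "\<lambda>z. L z + - 1 * M z"])
    show "trig_poly N (\<lambda>z. L z + - 1 * M z)"
      by (intro trig_poly_add trig_poly_cmult trig)
    show "nodes \<subseteq> {0<..<1}" by (auto simp: nodes_def)
    fix \<xi> assume \<xi>: "\<xi> \<in> nodes"
    have "deriv (\<lambda>z. L z + - 1 * M z) (of_real \<xi>) = deriv L (of_real \<xi>) + - 1 * deriv M (of_real \<xi>)"
      by (intro DERIV_imp_deriv DERIV_add DERIV_cmult)
        (simp_all add: DERIV_deriv_iff_field_differentiable trig_poly_differentiable[OF trig(1)]
          trig_poly_differentiable[OF trig(2)])
    then show "deriv (\<lambda>z. L z + - 1 * M z) (of_real \<xi>) = 0"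
      using *(3,6)[OF \<xi>] by simp
  qed (use * finite_nodes card_nodes in simp_all)
  then show "L z = M z" by simp
qed

lemma extremal_minorant_exists:
  "\<exists>L. minorant L \<and> (LINT x|\<theta>. Re (L (of_real x))) = bound"
proof -
  define Z where "Z = (\<lambda>\<xi>. cot (pi * \<xi>)) ` nodes"
  have node: "angle (cot (pi * \<xi>)) = \<xi>" if "\<xi> \<in> nodes" for \<xi>
    using that by (intro angle_cot) (auto simp: nodes_def)
  then have "inj_on (\<lambda>\<xi>. cot (pi * \<xi>)) nodes"
    by (rule inj_on_inverseI)
  then have Z: "finite Z" "card Z = N"
    by (simp_all add: Z_def finite_nodes card_image card_nodes)
  obtain p where p: "\<forall>i\<ge>2 * N. coeff p i = 0"
    "\<forall>z\<in>Z. poly p z = (1 + z\<^sup>2) ^ N * superposition (angle z)"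
    "\<forall>s. poly p s \<le> (1 + s\<^sup>2) ^ N * superposition (angle s)"
    using superposition_hermite_minorant[OF Z] by blast
  define L where "L z = homogenized N p z + - 1" for z
  have pos: "(1 + s\<^sup>2) ^ N > 0" for s :: real
    by (intro zero_less_power add_pos_nonneg) auto
  have L_angle: "L (of_real (angle s)) = of_real (poly p s / (1 + s\<^sup>2) ^ N - 1)" for s
    using homogenized_angle[of N p s] p(1) by (simp add: L_def)
  have L_0: "L 0 = - 1"
    by (simp add: L_def homogenized_0)
  have trig: "trig_poly N L"
    unfolding L_def[abs_def] by (intro trig_poly_add trig_poly_homogenized trig_poly_const)
  have real: "L (of_real x) \<in> \<real>" for x :: real
    by (simp add: L_def homogenized_real)
  have below: "Re (L (of_real x)) \<le> f x" for x :: real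
  proof -
    have "of_real x = complex_of_real (frac x) + of_int \<lfloor>x\<rfloor>"
      by (simp add: frac_def)
    then have Lx: "L (of_real x) = L (of_real (frac x))"
      using trig_poly_periodic[OF trig] by metis
    have fx: "f x = f (frac x)"
      using f_periodic[of "frac x" "\<lfloor>x\<rfloor>"] by (simp add: frac_def)
    show ?thesis
    proof (cases "frac x = 0")
      case True
      then show ?thesis
        unfolding Lx fx True using f_0 L_0 by simp
    next
      case False
      then have y: "0 < frac x" "frac x < 1"
        using frac_ge_0[of x] frac_lt_1[of x] by linarith+
      define s where "s = cot (pi * frac x)"
      have s: "angle s = frac x"
        unfolding s_def by (rule angle_cot[OF y])
      have "poly p s / (1 + s\<^sup>2) ^ N \<le> superposition (angle s)"
        using p(3) pos[of s] by (simp add: divide_le_eq mult.commute)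
      then show ?thesis
        using L_angle[of s] f_eq[OF y] unfolding Lx fx s by simp
    qed
  qed
  have L: "minorant L"
    using trig real below by (simp add: minorant_def real_trig_poly_def)
  have "Re (L (of_real \<xi>)) = f \<xi>" if \<xi>: "\<xi> \<in> nodes" for \<xi>
  proof -
    have "cot (pi * \<xi>) \<in> Z" using \<xi> by (simp add: Z_def)
    then have "poly p (cot (pi * \<xi>)) = (1 + (cot (pi * \<xi>))\<^sup>2) ^ N * superposition \<xi>"
      using p(2) node[OF \<xi>] by simp
    then have "poly p (cot (pi * \<xi>)) / (1 + (cot (pi * \<xi>))\<^sup>2) ^ N = superposition \<xi>"
      using pos[of "cot (pi * \<xi>)"] by (metis less_irrefl nonzero_mult_div_cancel_left)
    then show ?thesis
      using L_angle[of "cot (pi * \<xi>)"] f_eq[of \<xi>] \<xi> by (simp add: node[OF \<xi>] nodes_def)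
  qed
  then have "(LINT x|\<theta>. Re (L (of_real x))) = bound"
    using integral_minorant[OF L] L_0 by simp
  with L show ?thesis by blast
qed

theorem minorant_problem_solution:
  "(\<forall>L. minorant L \<longrightarrow> (LINT x|\<theta>. Re (L (of_real x))) \<le> bound) \<and>
   (\<exists>!L. minorant L \<and> (LINT x|\<theta>. Re (L (of_real x))) = bound)"
  using integral_minorant_le extremal_minorant_exists extremal_minorant_unique by blast

end

section \<open>The odd periodic function\<close>

lemma periodic_v_has_sum:
  assumes "l > 0" "y > 0"
  shows "((\<lambda>j::nat. (y + real j) * exp (- l * (y + real j))) has_sum periodic_v l y) UNIV"
proof (rule sums_nonneg_imp_has_sum)
  define q where "q = exp (- l)"
  have q: "norm q < 1" "1 - q \<noteq> 0" using assms by (auto simp: q_def)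
  have "(\<lambda>j. exp (- l * y) * ((y - 1) * q ^ j + of_nat (Suc j) * q ^ j)) sums
      (exp (- l * y) * ((y - 1) * (1 / (1 - q)) + 1 / (1 - q)\<^sup>2))"
    using q by (intro sums_mult sums_add geometric_sums geometric_deriv_sums)
  moreover have "exp (- l * y) * ((y - 1) * q ^ j + of_nat (Suc j) * q ^ j)
      = (y + real j) * exp (- l * (y + real j))" for j
  proof -
    have "exp (- l * (y + real j)) = exp (- l * y) * q ^ j"
      by (simp add: q_def exp_of_nat_mult[symmetric] exp_add[symmetric] algebra_simps)
    then show ?thesis by (simp add: algebra_simps)
  qed
  moreover have "exp (- l * y) * ((y - 1) * (1 / (1 - q)) + 1 / (1 - q)\<^sup>2) = periodic_v l y"
  proof -
    have "(y - 1) * (1 / (1 - q)) + 1 / (1 - q)\<^sup>2 = y / (1 - q) + q / (1 - q)\<^sup>2"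
      using q by (simp add: power2_eq_square divide_simps) (simp add: algebra_simps)
    then show ?thesis
      by (simp add: periodic_v_def q_def)
  qed
  ultimately show "(\<lambda>j::nat. (y + real j) * exp (- l * (y + real j))) sums periodic_v l y"
    by simp
qed (use assms in simp)

lemma odd_h_eq:
  assumes l: "l > 0" and x: "0 < x" "x < 1"
  shows "odd_h l x = pinned_v l x - pinned_v l (1 - x)"
proof -
  let ?f = "\<lambda>n::int. odd_v l (x + of_int n)"
  \<comment> \<open>The integers are split at 0; those below it are written as \<open>- 1 - j\<close>.\<close>
  have "((\<lambda>j. ?f (int j)) has_sum periodic_v l x) UNIV"
  proof -
    have "?f (int j) = (x + real j) * exp (- l * (x + real j))" for j
      using x by (simp add: odd_v_def trunc_v_def)
    then show ?thesis using periodic_v_has_sum[OF l x(1)] by simp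
  qed
  then have 1: "(?f has_sum periodic_v l x) (range int)"
    by (subst has_sum_reindex) (simp_all add: o_def)
  have "((\<lambda>j. ?f (- 1 - int j)) has_sum - periodic_v l (1 - x)) UNIV"
  proof -
    have "?f (- 1 - int j) = - ((1 - x + real j) * exp (- l * (1 - x + real j)))" for j
      using x by (simp add: odd_v_def trunc_v_def algebra_simps)
    then show ?thesis using periodic_v_has_sum[OF l, of "1 - x"] x by (simp add: has_sum_uminus)
  qed
  then have 2: "(?f has_sum - periodic_v l (1 - x)) (range (\<lambda>j. - 1 - int j))"
    by (subst has_sum_reindex) (simp_all add: o_def inj_on_def)
  have "(?f has_sum (periodic_v l x + - periodic_v l (1 - x))) (range int \<union> range (\<lambda>j. - 1 - int j))"
    by (rule has_sum_Un_disjoint[OF 1 2]) auto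
  moreover have "range int \<union> range (\<lambda>j. - 1 - int j) = UNIV"
  proof -
    have "n \<in> range int \<union> range (\<lambda>j. - 1 - int j)" for n
    proof (cases "n \<ge> 0")
      case True
      then have "n = int (nat n)" by simp
      then show ?thesis by blast
    next
      case False
      then have "n = - 1 - int (nat (- 1 - n))" by simp
      then show ?thesis by blast
    qed
    then show ?thesis by blast
  qed
  ultimately show ?thesis
    unfolding odd_h_def by (simp add: infsumI pinned_v_def)
qed

lemma odd_h_periodic: "odd_h l (x + of_int k) = odd_h l x"
proof -
  have "bij_betw (\<lambda>n. k + n) UNIV (UNIV :: int set)"
    by (rule bij_betw_byWitness[where f' = "\<lambda>n. n - k"]) auto
  from infsum_reindex_bij_betw[OF this, of "\<lambda>n. odd_v l (x + of_int n)"]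
  show ?thesis
    by (simp add: odd_h_def add.assoc)
qed

lemma odd_h_0: "odd_h l 0 = 0"
proof -
  have "bij_betw (\<lambda>n. - n) UNIV (UNIV :: int set)"
    by (rule bij_betw_byWitness[where f' = "\<lambda>n. - n"]) auto
  from infsum_reindex_bij_betw[OF this, of "\<lambda>n. odd_v l (of_int n)"]
  have "odd_h l 0 = infsum (\<lambda>n::int. - odd_v l (of_int n)) UNIV"
    by (simp add: odd_h_def odd_v_def)
  then show ?thesis
    by (simp add: odd_h_def infsum_uminus)
qed

lemma odd_F_periodic: "odd_F m (x + of_int k) = odd_F m x"
  by (simp add: odd_F_def odd_h_periodic)

lemma odd_F_0: "odd_F m 0 = 0"
  by (simp add: odd_F_def odd_h_0 set_lebesgue_integral_def)

lemma odd_F_reflect: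
  assumes x: "0 < x" "x < 1"
  shows "odd_F m (1 - x) = - odd_F m x"
  unfolding odd_F_def set_lebesgue_integral_def Bochner_Integration.integral_minus[symmetric]
proof (rule Bochner_Integration.integral_cong[OF refl])
  fix l :: real
  have "odd_h l (1 - x) = - odd_h l x" if "l > 0"
    using that x by (simp add: odd_h_eq)
  then show "indicator {0<..} l *\<^sub>R (odd_h l (1 - x) * signed_cdf m l)
      = - (indicator {0<..} l *\<^sub>R (odd_h l x * signed_cdf m l))"
    by (cases "l > 0") simp_all
qed

text \<open>
  Were \<open>\<mu>\<close> not integrable on \<open>{..y}\<close> for large \<open>y\<close>, the integral would be 0 by convention and the mean
  could not tend to 1.  Integrability on these half-lines includes measurability.
\<close>
lemma mean_value_measurable:
  fixes \<mu> :: "real \<Rightarrow> real"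
  assumes "((\<lambda>y. 1 / y * (LINT x:{..y}|lborel. \<mu> x)) \<longlongrightarrow> 1) at_top"
  shows "\<mu> \<in> borel_measurable borel" "set_integrable lborel {..y} \<mu>"
proof -
  have "eventually (\<lambda>y. 1 / y * (LINT x:{..y}|lborel. \<mu> x) > 0) at_top"
    using assms by (rule order_tendstoD(1)) simp
  then obtain y0 where y0: "\<And>y. y \<ge> y0 \<Longrightarrow> 1 / y * (LINT x:{..y}|lborel. \<mu> x) > 0"
    unfolding eventually_at_top_linorder by blast
  have int: "set_integrable lborel {..y} \<mu>" if "y \<ge> y0" for y
  proof (rule ccontr)
    assume "\<not> set_integrable lborel {..y} \<mu>"
    then have "(LINT x:{..y}|lborel. \<mu> x) = 0"
      unfolding set_integrable_def set_lebesgue_integral_def by (rule not_integrable_integral_eq)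
    then show False using y0[OF that] by simp
  qed
  show "set_integrable lborel {..y} \<mu>"
    by (rule set_integrable_subset[OF int[of "max y y0"]]) auto
  show "\<mu> \<in> borel_measurable borel"
  proof (rule borel_measurable_LIMSEQ_real)
    show "(\<lambda>x. indicator {..y0 + real n} x *\<^sub>R \<mu> x) \<in> borel_measurable borel" for n
      using int[of "y0 + real n"] unfolding set_integrable_def
      by (auto dest: borel_measurable_integrable)
    fix x :: real
    obtain k where "x - y0 \<le> real k" using real_arch_simple by blast
    then have "eventually (\<lambda>n. indicator {..y0 + real n} x *\<^sub>R \<mu> x = \<mu> x) sequentially"
      unfolding eventually_sequentially
      by (intro exI[of _ k]) (auto simp: indicator_def)
    then show "(\<lambda>n. indicator {..y0 + real n} x *\<^sub>R \<mu> x) \<longlonglongrightarrow> \<mu> x"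
      by (rule tendsto_eventually)
  qed
qed

lemma average_complement:
  fixes \<mu> :: "real \<Rightarrow> real"
  assumes lim: "((\<lambda>y. 1 / y * (LINT x:{..y}|lborel. \<mu> x)) \<longlongrightarrow> 1) at_top"
  shows "((\<lambda>y. (LINT l:{0<..y}|lborel. indicator {0<..} l * (1 - \<mu> l)) / y) \<longlongrightarrow> 0) at_top"
proof -
  note int = mean_value_measurable(2)[OF lim]
  define C where "C = (LINT x:{..0}|lborel. \<mu> x)"
  have eq: "(LINT l:{0<..y}|lborel. indicator {0<..} l * (1 - \<mu> l)) / y
      = 1 - (1 / y * (LINT x:{..y}|lborel. \<mu> x)) + C * (1 / y)" if y: "y > 0" for y
  proof -
    have i: "set_integrable lborel {0<..y} \<mu>"
      by (rule set_integrable_subset[OF int[of y]]) auto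
    have "(LINT x:{..0} \<union> {0<..y}|lborel. \<mu> x) = C + (LINT x:{0<..y}|lborel. \<mu> x)"
      unfolding C_def by (rule set_integral_Un[OF _ int i]) auto
    moreover have "{..0} \<union> {0<..y} = {..y}" using y by auto
    ultimately have 1: "(LINT x:{0<..y}|lborel. \<mu> x) = (LINT x:{..y}|lborel. \<mu> x) - C"
      by simp
    have fin: "integrable lborel (indicator {0<..y} :: real \<Rightarrow> real)"
      using y by (intro integrable_real_indicator) simp_all
    have "(LINT l:{0<..y}|lborel. indicator {0<..} l * (1 - \<mu> l))
        = (LINT l|lborel. indicator {0<..y} l - indicator {0<..y} l *\<^sub>R \<mu> l)"
      unfolding set_lebesgue_integral_def
      by (intro Bochner_Integration.integral_cong) (auto simp: indicator_def)
    also have "\<dots> = y - (LINT x:{0<..y}|lborel. \<mu> x)"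
      using fin i y unfolding set_integrable_def set_lebesgue_integral_def
      by (subst Bochner_Integration.integral_diff) auto
    finally show ?thesis
      using y 1 by (simp add: field_simps)
  qed
  have "((\<lambda>y. 1 - (1 / y * (LINT x:{..y}|lborel. \<mu> x)) + C * (1 / y)) \<longlongrightarrow> 1 - 1 + C * 0) at_top"
    by (intro tendsto_intros lim) real_asymp
  then have "((\<lambda>y. 1 - (1 / y * (LINT x:{..y}|lborel. \<mu> x)) + C * (1 / y)) \<longlongrightarrow> 0) at_top"
    by simp
  moreover have "eventually (\<lambda>y. 1 - (1 / y * (LINT x:{..y}|lborel. \<mu> x)) + C * (1 / y)
      = (LINT l:{0<..y}|lborel. indicator {0<..} l * (1 - \<mu> l)) / y) at_top"
    using eventually_gt_at_top[of "0::real"] by eventually_elim (simp add: eq)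
  ultimately show ?thesis
    by (rule Lim_transform_eventually)
qed

lemma (in half_line_weights) swap: "half_line_weights b a"
  using half_line_weights_axioms unfolding half_line_weights_def by blast

lemma (in half_line_weights) superposition_swap:
  "half_line_weights.superposition b a x = superposition (1 - x)"
proof -
  interpret s: half_line_weights b a by (rule swap)
  show ?thesis
    unfolding s.superposition_def superposition_def pinned_v_reflect by (simp add: add.commute)
qed

text \<open>
  The constant 1 is \<open>(1 - x) + x\<close>, the integral of \<open>u\<^sub>l(x) + u\<^sub>l(1 - x)\<close> over the positive axis; adding it
  to \<open>F\<close> makes both weights nonnegative.
\<close>
lemma odd_F_superposition:
  fixes m
  defines "a \<equiv> \<lambda>l. indicator {0<..} l * (1 + signed_cdf m l)"
    and "b \<equiv> \<lambda>l. indicator {0<..} l * (1 - signed_cdf m l)"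
  assumes w: "half_line_weights a b" and x: "0 < x" "x < 1"
  shows "half_line_weights.superposition a b x = 1 + odd_F m x"
proof -
  interpret half_line_weights a b by (rule w)
  have y: "0 < 1 - x" "1 - x < 1" using x by auto
  have i1: "integrable lborel (\<lambda>l. indicator {0<..} l *\<^sub>R pinned_v l x)"
    and i2: "integrable lborel (\<lambda>l. indicator {0<..} l *\<^sub>R pinned_v l (1 - x))"
    using integral_pinned_v(1)[OF x] integral_pinned_v(1)[OF y] by (simp_all add: set_integrable_def)
  have I: "(LINT l|lborel. indicator {0<..} l *\<^sub>R pinned_v l x) = 1 - x"
    "(LINT l|lborel. indicator {0<..} l *\<^sub>R pinned_v l (1 - x)) = x"
    using integral_pinned_v(2)[OF x] integral_pinned_v(2)[OF y] by (simp_all add: set_lebesgue_integral_def)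
  let ?s = "\<lambda>l. indicator {0<..} l *\<^sub>R pinned_v l x + indicator {0<..} l *\<^sub>R pinned_v l (1 - x)"
  have odd: "odd_F m x = (LINT l|lborel. (pinned_v l x * a l + pinned_v (- l) x * b l) - ?s l)"
    unfolding odd_F_def set_lebesgue_integral_def
  proof (rule Bochner_Integration.integral_cong[OF refl])
    fix l :: real
    show "indicator {0<..} l *\<^sub>R (odd_h l x * signed_cdf m l) = (pinned_v l x * a l + pinned_v (- l) x * b l) - ?s l"
      by (cases "l > 0") (simp_all add: odd_h_eq x a_def b_def pinned_v_reflect algebra_simps)
  qed
  have "odd_F m x = superposition x - (1 - x + x)"
    unfolding odd superposition_def
    using integrable_pinned_v_weights[OF x] i1 i2
    by (simp only: Bochner_Integration.integral_diff Bochner_Integration.integrable_add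
        Bochner_Integration.integral_add[OF i1 i2] I)
  then show ?thesis by simp
qed

theorem theorem13:
  fixes m :: "real set \<Rightarrow> real" and \<theta> :: "real measure" and N :: nat and c :: "nat \<Rightarrow> complex"
  assumes "locally_finite_signed_measure m"
    and "signed_support m \<subseteq> {0..}"
    and "\<forall>x. 0 \<le> signed_cdf m x \<and> signed_cdf m x \<le> 1"
    and "((\<lambda>y. 1 / y * (LINT x:{..y}|lborel. signed_cdf m x)) \<longlongrightarrow> 1) at_top"
    and "prob_measure_on_circle \<theta>"
    and "nontrivial_measure \<theta>"
    and "admissible_phases \<theta> c"
  shows
    "(\<forall>L. real_trig_poly N L \<and> (\<forall>x :: real. Re (L (of_real x)) \<le> odd_F m x) \<longrightarrow>
        (LINT x|\<theta>. Re (L (of_real x))) \<le>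
          - 1 / Re (kernel_K \<theta> c N 1 1)
          + (\<Sum>\<xi>\<in>B_nodes \<theta> c (N + 1).
               odd_F m \<xi> / Re (kernel_K \<theta> c N (circle_e (of_real \<xi>)) (circle_e (of_real \<xi>)))))
     \<and> (\<exists>!L. real_trig_poly N L \<and> (\<forall>x :: real. Re (L (of_real x)) \<le> odd_F m x) \<and>
        (LINT x|\<theta>. Re (L (of_real x))) =
          - 1 / Re (kernel_K \<theta> c N 1 1)
          + (\<Sum>\<xi>\<in>B_nodes \<theta> c (N + 1).
               odd_F m \<xi> / Re (kernel_K \<theta> c N (circle_e (of_real \<xi>)) (circle_e (of_real \<xi>)))))
     \<and> (\<forall>M. real_trig_poly N M \<and> (\<forall>x :: real. odd_F m x \<le> Re (M (of_real x))) \<longrightarrow>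
        (LINT x|\<theta>. Re (M (of_real x))) \<ge>
          1 / Re (kernel_K \<theta> c N 1 1)
          + (\<Sum>\<xi>\<in>B_nodes \<theta> c (N + 1).
               odd_F m \<xi> / Re (kernel_K \<theta> c N (circle_e (of_real \<xi>)) (circle_e (of_real \<xi>)))))
     \<and> (\<exists>!M. real_trig_poly N M \<and> (\<forall>x :: real. odd_F m x \<le> Re (M (of_real x))) \<and>
        (LINT x|\<theta>. Re (M (of_real x))) =
          1 / Re (kernel_K \<theta> c N 1 1)
          + (\<Sum>\<xi>\<in>B_nodes \<theta> c (N + 1).
               odd_F m \<xi> / Re (kernel_K \<theta> c N (circle_e (of_real \<xi>)) (circle_e (of_real \<xi>)))))"
proof -
  define \<phi> where "\<phi> = normalized_OP \<theta> c (N + 1)"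
  define \<mu> where "\<mu> = signed_cdf m"
  define a where "a l = indicator {0<..} l * (1 + \<mu> l)" for l
  define b where "b l = indicator {0<..} l * (1 - \<mu> l)" for l
  have \<mu>: "0 \<le> 1 + \<mu> l" "\<mu> l \<le> 1" "0 \<le> \<mu> l" for l
    using assms(3) by (auto simp: \<mu>_def add_nonneg_nonneg)
  have lim: "((\<lambda>y. 1 / y * (LINT x:{..y}|lborel. \<mu> x)) \<longlongrightarrow> 1) at_top"
    using assms(4) by (simp add: \<mu>_def)
  have [measurable]: "\<mu> \<in> borel_measurable borel"
    by (rule mean_value_measurable(1)[OF lim])
  interpret nontrivial_circle_measure \<theta>
    using assms by unfold_locales
  interpret orthonormal_polynomial \<theta> N \<phi>
  proof
    have c: "cmod (c (N + 1)) = 1" and r: "poly \<phi> 1 \<in> \<real>"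
      using assms(7) by (auto simp: admissible_phases_def \<phi>_def)
    show "poly \<phi> 1 \<in> \<real>" by (rule r)
    show "degree \<phi> = Suc N" "inner_circle \<theta> \<phi> \<phi> = 1"
      using normalized_OP[of c "N + 1", OF c] by (simp_all add: \<phi>_def)
    show "inner_circle \<theta> \<phi> (monom 1 j) = 0" if "j \<le> N" for j
      using normalized_OP(2)[of c "N + 1", OF c] that by (simp add: \<phi>_def)
  qed
  interpret w: half_line_weights a b
  proof
    show "a \<in> borel_measurable borel" "b \<in> borel_measurable borel"
      unfolding a_def[abs_def] b_def[abs_def] by measurable
  next
    fix l
    show "0 \<le> a l" "a l \<le> 2" "0 \<le> b l" "b l \<le> 2"
      unfolding a_def b_def using \<mu>[of l] by (auto simp: indicator_def)
  qed (auto simp: a_def b_def)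
  interpret w': half_line_weights b a
    by (rule w.swap)
  have F_eq: "w.superposition x = 1 + odd_F m x" if "0 < x" "x < 1" for x
    using odd_F_superposition[of m x] w.half_line_weights_axioms that
    by (simp add: a_def[abs_def] b_def[abs_def] \<mu>_def)
  have F'_eq: "w'.superposition x = 1 - odd_F m x" if x: "0 < x" "x < 1" for x
    using w.superposition_swap[of x] F_eq[of "1 - x"] odd_F_reflect[OF x] x by simp
  have avg: "((\<lambda>y. (LINT l:{0<..y}|lborel. b l) / y) \<longlongrightarrow> 0) at_top"
    using average_complement[OF lim] by (simp add: b_def[abs_def])
  have near_1: "eventually (\<lambda>x. x \<in> {0<..<1} \<and> w.superposition x < \<epsilon>) (at_left 1)" if "\<epsilon> > 0" for \<epsilon>
    using w.superposition_vanishes_at_1[OF avg that]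
    by (intro eventually_conj eventually_at_left_real) simp_all
  interpret lower: minorant_problem \<theta> N \<phi> a b "odd_F m"
  proof
    fix \<epsilon> :: real assume "\<epsilon> > 0"
    have "eventually (\<lambda>x. x - 1 \<noteq> 0 \<and> odd_F m (x - 1) < \<epsilon> - 1) (at_left 1)"
      using near_1[OF \<open>\<epsilon> > 0\<close>]
    proof eventually_elim
      case (elim x)
      then show ?case
        using F_eq[of x] odd_F_periodic[of m "x" "- 1"] by auto
    qed
    then have "frequently (\<lambda>x. odd_F m (x - 1) < \<epsilon> - 1) (at_left 1)"
      by (intro eventually_frequently) (auto elim: eventually_mono)
    moreover have "filterlim (\<lambda>x. x - 1) (at 0) (at_left (1::real))"
      by real_asymp
    ultimately show "frequently (\<lambda>x. odd_F m x < \<epsilon> - 1) (at 0)"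
      unfolding frequently_def filterlim_iff by blast
  qed (use F_eq odd_F_periodic odd_F_0 in auto)
  \<comment> \<open>Reflection carries the limit at 1 of the first superposition to the limit at 0 of the second, so
    \<open>- F\<close> tends to \<open>- 1\<close> from the right.\<close>
  interpret upper: minorant_problem \<theta> N \<phi> b a "\<lambda>x. - odd_F m x"
  proof
    fix \<epsilon> :: real assume "\<epsilon> > 0"
    have "eventually (\<lambda>x. - odd_F m (1 - x) < \<epsilon> - 1) (at_left 1)"
      using near_1[OF \<open>\<epsilon> > 0\<close>]
    proof eventually_elim
      case (elim x)
      then show ?case
        using F'_eq[of "1 - x"] w.superposition_swap[of "1 - x"] by simp
    qed
    then have "frequently (\<lambda>x. - odd_F m (1 - x) < \<epsilon> - 1) (at_left 1)"
      by (intro eventually_frequently) auto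
    moreover have "filterlim (\<lambda>x. 1 - x) (at 0) (at_left (1::real))"
      by real_asymp
    ultimately show "frequently (\<lambda>x. - odd_F m x < \<epsilon> - 1) (at 0)"
      unfolding frequently_def filterlim_iff by blast
  qed (use F'_eq odd_F_periodic odd_F_0 in auto)
  have OP: "normalized_OP \<theta> c (Suc N) = \<phi>"
    by (simp add: \<phi>_def)
  have nodes: "B_nodes \<theta> c (N + 1) = nodes"
    by (auto simp: B_nodes_def nodes_def companion_B_def B_def OP)
  have K: "Re (kernel_K \<theta> c N (circle_e (of_real \<xi>)) (circle_e (of_real \<xi>))) = weight \<xi>"
    if "\<xi> \<in> insert 0 nodes" for \<xi>
  proof -
    let ?w = "circle_e (of_real \<xi>)"
    have "cnj ?w * ?w = 1"
      by (simp add: complex_norm_square[symmetric] mult.commute)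
    moreover have "Lim (at ?w) (kernel_quot \<theta> c N ?w) = poly (kern ?w) ?w"
      using kern_limit[OF node_in_roots[OF that]]
      by (intro tendsto_Lim) (simp_all add: kernel_quot_def[abs_def] OP)
    ultimately show ?thesis
      by (simp add: kernel_K_def weight_def)
  qed
  have K1: "Re (kernel_K \<theta> c N 1 1) = weight 0"
    using K[of 0] by simp
  have sum: "(\<Sum>\<xi>\<in>B_nodes \<theta> c (N + 1).
      odd_F m \<xi> / Re (kernel_K \<theta> c N (circle_e (of_real \<xi>)) (circle_e (of_real \<xi>))))
      = (\<Sum>\<xi>\<in>nodes. odd_F m \<xi> / weight \<xi>)"
    unfolding nodes by (intro sum.cong refl) (simp add: K)
  have lower: "(\<forall>L. real_trig_poly N L \<and> (\<forall>x :: real. Re (L (of_real x)) \<le> odd_F m x) \<longrightarrow>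
        (LINT x|\<theta>. Re (L (of_real x))) \<le> lower.bound)
     \<and> (\<exists>!L. real_trig_poly N L \<and> (\<forall>x :: real. Re (L (of_real x)) \<le> odd_F m x) \<and>
        (LINT x|\<theta>. Re (L (of_real x))) = lower.bound)"
    using lower.minorant_problem_solution unfolding lower.minorant_def conj_assoc .
  have flip: "real_trig_poly N (\<lambda>z. - M z) \<longleftrightarrow> real_trig_poly N M" for M
    using trig_poly_cmult[of N M "- 1"] trig_poly_cmult[of N "\<lambda>z. - M z" "- 1"]
    by (auto simp: real_trig_poly_def)
  have upper_minorant: "upper.minorant (\<lambda>z. - M z) \<longleftrightarrow>
      real_trig_poly N M \<and> (\<forall>x :: real. odd_F m x \<le> Re (M (of_real x)))" for M
    by (simp add: upper.minorant_def flip)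
  have upper_bound: "upper.bound = - (1 / weight 0 + (\<Sum>\<xi>\<in>nodes. odd_F m \<xi> / weight \<xi>))"
    by (simp add: upper.bound_def sum_negf)
  have int: "(LINT x|\<theta>. Re (- M (of_real x))) = - (LINT x|\<theta>. Re (M (of_real x)))" for M :: "complex \<Rightarrow> complex"
    by simp
  have upper: "(\<forall>M. real_trig_poly N M \<and> (\<forall>x :: real. odd_F m x \<le> Re (M (of_real x))) \<longrightarrow>
        (LINT x|\<theta>. Re (M (of_real x))) \<ge> - upper.bound)
     \<and> (\<exists>!M. real_trig_poly N M \<and> (\<forall>x :: real. odd_F m x \<le> Re (M (of_real x))) \<and>
        (LINT x|\<theta>. Re (M (of_real x))) = - upper.bound)"
  proof (intro conjI allI impI)
    fix M assume "real_trig_poly N M \<and> (\<forall>x :: real. odd_F m x \<le> Re (M (of_real x)))"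
    then have "upper.minorant (\<lambda>z. - M z)" by (simp add: upper_minorant)
    then have "(LINT x|\<theta>. Re (- M (of_real x))) \<le> upper.bound"
      by (rule upper.integral_minorant_le)
    then show "(LINT x|\<theta>. Re (M (of_real x))) \<ge> - upper.bound"
      unfolding int by linarith
  next
    obtain L where L: "upper.minorant L" "(LINT x|\<theta>. Re (L (of_real x))) = upper.bound"
      using upper.extremal_minorant_exists by blast
    show "\<exists>!M. real_trig_poly N M \<and> (\<forall>x :: real. odd_F m x \<le> Re (M (of_real x))) \<and>
        (LINT x|\<theta>. Re (M (of_real x))) = - upper.bound"
    proof (rule ex1I[of _ "\<lambda>z. - L z"])
      show "real_trig_poly N (\<lambda>z. - L z) \<and> (\<forall>x :: real. odd_F m x \<le> Re (- L (of_real x))) \<and>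
          (LINT x|\<theta>. Re (- L (of_real x))) = - upper.bound"
        using L upper_minorant[of "\<lambda>z. - L z"] by simp
    next
      fix M assume M: "real_trig_poly N M \<and> (\<forall>x :: real. odd_F m x \<le> Re (M (of_real x))) \<and>
          (LINT x|\<theta>. Re (M (of_real x))) = - upper.bound"
      then have "upper.minorant (\<lambda>z. - M z)" by (simp add: upper_minorant)
      moreover have "(LINT x|\<theta>. Re (- M (of_real x))) = upper.bound"
        unfolding int using M by simp
      ultimately have "(\<lambda>z. - M z) = L"
        by (rule upper.extremal_minorant_unique[OF _ _ L])
      then show "M = (\<lambda>z. - L z)" by auto
    qed
  qed
  show ?thesis
    using conjI[OF lower upper]
    unfolding sum K1 lower.bound_def upper_bound minus_minus conj_assoc .
qed

end
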